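(* Let $V$ be an $\mathbb{N}$-graded vertex algebra over $\mathbb{C}$. If $V$ is classically free, then the natural projection $$\eta_V:R_V\twoheadrightarrow\operatorname{gr}A(V),\qquad a+F^1V\mapsto a+V_{<\deg a}+O(V)\quad(a\in V\text{ homogeneous}),$$ from the $C_2$-algebra $R_V$ to the associated graded algebra of Zhu's algebra $A(V)$ is an isomorphism.
   Context: Everything is over $\mathbb{C}$ and $\mathbb{N}=\{0,1,2,\dots\}$. A vertex algebra is a (purely even) vector space $V$ with $\mathbf 1\in V$ and a linear map $a\mapsto Y(a,z)=\sum_{n\in\mathbb{Z}}a_{(n)}z^{-n-1}$, $a_{(n)}\in\operatorname{End}V$, such that for all $a,b,c\in V$: $a_{(n)}b=0$ for $n\gg0$; $Y(\mathbf 1,z)=\mathrm{id}$, $a_{(n)}\mathbf 1=0$ for $n\ge0$, $a_{(-1)}\mathbf 1=a$; and the Borcherds identity holds: for all $m,n,k\in\mathbb{Z}$, $\sum_{j\ge0}\binom mj(a_{(n+j)}b)_{(m+k-j)}c=\sum_{j\ge0}(-1)^j\binom nj\big(a_{(m+n-j)}b_{(k+j)}c-(-1)^n b_{(n+k-j)}a_{(m+j)}c\big)$. Put $Ta=a_{(-2)}\mathbf 1$. It is $\mathbb{N}$-graded if equipped with a diagonalizable operator $H$ with eigenvalues in $\mathbb{N}$ such that $[H,Y(a,z)]=z\partial_zY(a,z)+Y(Ha,z)$; write $V=\bigoplus_{n\in\mathbb{N}}V_n$, $V_n=\ker(H-n)$, $\deg a=n$ for (homogeneous) $a\in V_n$,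 $V_{\le n}=\bigoplus_{j\le n}V_j$, $V_{<n}=V_{\le n-1}$. Li filtration: $F^pV=\operatorname{span}\{a^1_{(-n_1-1)}\cdots a^r_{(-n_r-1)}\mathbf 1\mid a^i\in V,\ n_i\ge0,\ n_1+\cdots+n_r\ge p\}$. Set $R_V=V/F^1V$ (the $C_2$-algebra) and $\operatorname{gr}V=\bigoplus_{p\ge0}F^pV/F^{p+1}V$. The operation $(a,b)\mapsto a_{(-1)}b$ induces a commutative associative multiplication on $\operatorname{gr}V$, and $\partial(a+F^{p+1}V)=Ta+F^{p+2}V$ for $a\in F^pV$ makes it a differential algebra (unital commutative algebra with a derivation), generated as a differential algebra by its degree-zero part $R_V$. Jet algebra: for a unital commutative $\mathbb{C}$-algebra $R$, $\mathcal{J}_\infty R$ is the differential algebra with an algebra map $j:R\to\mathcal{J}_\infty R$ such that every algebra homomorphism from $R$ to a differential algebra $A$ factors uniquely through $j$ by a differential algebra homomorphism $\mathcal{J}_\infty R\to A$. $V$ is classically free if the canonical surjection $\mathcal{J}_\infty R_V\to\operatorname{gr}V$ induced by $R_V\subseteq\operatorname{gr}V$ is an isomorphism. Zhu's algebra: for $a$ homogeneous and $b\in V$ let $a*b=\operatorname{Res}_z\frac{(1+z)^{\deg a}}{z}Y(a,z)b$ and $a\circ b=\operatorname{Res}_z\frac{(1+z)^{\deg a}}{z^2}Y(a,z)b$, extended bilinearly; $O(V)=\operatorname{span}\{a\circ b\mid a,b\in V\}$ and $A(V)=V/O(V)$, an associative algebra with product induced by $*$. Let $A_n(V)$ be the image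 of $V_{\le n}$ in $A(V)$; then $A_m(V)*A_n(V)\subseteq A_{m+n}(V)$, and $\operatorname{gr}A(V)=\bigoplus_{n\ge0}A_n(V)/A_{n-1}(V)$ is a commutative algebra. The map $\eta_V$ above is known to be a well-defined surjective homomorphism of commutative algebras. *)

theory Defs
  imports
    Complex_Main
    "HOL-Algebra.QuotRing"
    "HOL-Algebra.Module"
    "HOL-Algebra.Algebraic_Closure_Type"
    "HOL-Library.Groups_Big_Fun"
begin

section \<open>Commutative and differential algebras over the complex numbers\<close>

abbreviation complex_ring :: "complex ring" where
  "complex_ring \<equiv> ring_of_type_algebra"

record 'b diff_alg = "(complex, 'b) module" +
  der :: "'b \<Rightarrow> 'b" (\<open>\<partial>\<index>\<close>)

locale differential_algebra = algebra complex_ring A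
  for A :: "('b, 'z) diff_alg_scheme" (structure) +
  assumes der_closed: "x \<in> carrier A \<Longrightarrow> \<partial> x \<in> carrier A"
    and der_add: "x \<in> carrier A \<Longrightarrow> y \<in> carrier A \<Longrightarrow> \<partial> (x \<oplus> y) = \<partial> x \<oplus> \<partial> y"
    and der_smult: "x \<in> carrier A \<Longrightarrow> \<partial> (c \<odot> x) = c \<odot> \<partial> x"
    and der_mult: "x \<in> carrier A \<Longrightarrow> y \<in> carrier A \<Longrightarrow>
      \<partial> (x \<otimes> y) = \<partial> x \<otimes> y \<oplus> x \<otimes> \<partial> y"

definition alg_hom ::
    "(complex, 'a, 'y) module_scheme \<Rightarrow> (complex, 'b, 'z) module_scheme \<Rightarrow> ('a \<Rightarrow> 'b) set" where
  "alg_hom A B = {h \<in> ring_hom A B. \<forall>c. \<forall>x\<in>carrier A. h (c \<odot>\<^bsub>A\<^esub> x) = c \<odot>\<^bsub>B\<^esub> h x}"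

definition alg_iso ::
    "(complex, 'a, 'y) module_scheme \<Rightarrow> (complex, 'b, 'z) module_scheme \<Rightarrow> ('a \<Rightarrow> 'b) set" where
  "alg_iso A B = {h \<in> alg_hom A B. bij_betw h (carrier A) (carrier B)}"

definition diff_alg_hom ::
    "('a, 'y) diff_alg_scheme \<Rightarrow> ('b, 'z) diff_alg_scheme \<Rightarrow> ('a \<Rightarrow> 'b) set" where
  "diff_alg_hom A B = {h \<in> alg_hom A B. \<forall>x\<in>carrier A. h (\<partial>\<^bsub>A\<^esub> x) = \<partial>\<^bsub>B\<^esub> (h x)}"

definition diff_alg_iso ::
    "('a, 'y) diff_alg_scheme \<Rightarrow> ('b, 'z) diff_alg_scheme \<Rightarrow> ('a \<Rightarrow> 'b) set" where
  "diff_alg_iso A B = {h \<in> diff_alg_hom A B. bij_betw h (carrier A) (carrier B)}"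


section \<open>The jet algebra\<close>

text \<open>
  The universal property of the jet algebra quantifies over differential algebras of arbitrary
  size, so it cannot be the defining formula of a HOL constant. The jet algebra is therefore
  constructed, as the set of formal differential-algebra expressions in the elements of \<open>R\<close>
  modulo the congruence generated by the axioms of differential algebras and the requirement
  that the inclusion of generators is an algebra homomorphism. The universal property,
  for target algebras over an arbitrary type, is \<open>jet_universal\<close> below.
\<close>

datatype 'r jet_term =
    Gen 'r
  | Const complex
  | Add "'r jet_term" "'r jet_term"
  | Mul "'r jet_term" "'r jet_term"
  | Der "'r jet_term"

definition jet_terms :: "(complex, 'r, 'z) module_scheme \<Rightarrow> 'r jet_term set" where
  "jet_terms R = {t. set_jet_term t \<subseteq> carrier R}"

inductive jet_eq :: "(complex, 'r, 'z) module_scheme \<Rightarrow> 'r jet_term \<Rightarrow> 'r jet_term \<Rightarrow> bool"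
  for R :: "(complex, 'r, 'z) module_scheme" where
  refl: "s \<in> jet_terms R \<Longrightarrow> jet_eq R s s"
| sym: "jet_eq R s t \<Longrightarrow> jet_eq R t s"
| trans: "jet_eq R s t \<Longrightarrow> jet_eq R t u \<Longrightarrow> jet_eq R s u"
| cong_add: "jet_eq R s s' \<Longrightarrow> jet_eq R t t' \<Longrightarrow> jet_eq R (Add s t) (Add s' t')"
| cong_mul: "jet_eq R s s' \<Longrightarrow> jet_eq R t t' \<Longrightarrow> jet_eq R (Mul s t) (Mul s' t')"
| cong_der: "jet_eq R s s' \<Longrightarrow> jet_eq R (Der s) (Der s')"
| add_assoc: "s \<in> jet_terms R \<Longrightarrow> t \<in> jet_terms R \<Longrightarrow> u \<in> jet_terms R \<Longrightarrow>
    jet_eq R (Add (Add s t) u) (Add s (Add t u))"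
| add_comm: "s \<in> jet_terms R \<Longrightarrow> t \<in> jet_terms R \<Longrightarrow> jet_eq R (Add s t) (Add t s)"
| add_zero: "s \<in> jet_terms R \<Longrightarrow> jet_eq R (Add (Const 0) s) s"
| add_neg: "s \<in> jet_terms R \<Longrightarrow> jet_eq R (Add (Mul (Const (-1)) s) s) (Const 0)"
| mul_assoc: "s \<in> jet_terms R \<Longrightarrow> t \<in> jet_terms R \<Longrightarrow> u \<in> jet_terms R \<Longrightarrow>
    jet_eq R (Mul (Mul s t) u) (Mul s (Mul t u))"
| mul_comm: "s \<in> jet_terms R \<Longrightarrow> t \<in> jet_terms R \<Longrightarrow> jet_eq R (Mul s t) (Mul t s)"
| mul_one: "s \<in> jet_terms R \<Longrightarrow> jet_eq R (Mul (Const 1) s) s"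
| distrib: "s \<in> jet_terms R \<Longrightarrow> t \<in> jet_terms R \<Longrightarrow> u \<in> jet_terms R \<Longrightarrow>
    jet_eq R (Mul (Add s t) u) (Add (Mul s u) (Mul t u))"
| const_add: "jet_eq R (Const (a + b)) (Add (Const a) (Const b))"
| const_mul: "jet_eq R (Const (a * b)) (Mul (Const a) (Const b))"
| der_add: "s \<in> jet_terms R \<Longrightarrow> t \<in> jet_terms R \<Longrightarrow>
    jet_eq R (Der (Add s t)) (Add (Der s) (Der t))"
| der_mul: "s \<in> jet_terms R \<Longrightarrow> t \<in> jet_terms R \<Longrightarrow>
    jet_eq R (Der (Mul s t)) (Add (Mul (Der s) t) (Mul s (Der t)))"
| der_const: "jet_eq R (Der (Const a)) (Const 0)"
| gen_add: "x \<in> carrier R \<Longrightarrow> y \<in> carrier R \<Longrightarrow>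
    jet_eq R (Gen (x \<oplus>\<^bsub>R\<^esub> y)) (Add (Gen x) (Gen y))"
| gen_mul: "x \<in> carrier R \<Longrightarrow> y \<in> carrier R \<Longrightarrow>
    jet_eq R (Gen (x \<otimes>\<^bsub>R\<^esub> y)) (Mul (Gen x) (Gen y))"
| gen_smult: "x \<in> carrier R \<Longrightarrow> jet_eq R (Gen (a \<odot>\<^bsub>R\<^esub> x)) (Mul (Const a) (Gen x))"
| gen_one: "jet_eq R (Gen \<one>\<^bsub>R\<^esub>) (Const 1)"

definition jet_rel :: "(complex, 'r, 'z) module_scheme \<Rightarrow> ('r jet_term \<times> 'r jet_term) set" where
  "jet_rel R = {(s, t). jet_eq R s t}"

definition jet_class :: "(complex, 'r, 'z) module_scheme \<Rightarrow> 'r jet_term \<Rightarrow> 'r jet_term set" where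
  "jet_class R t = jet_rel R `` {t}"

definition jet :: "(complex, 'r, 'z) module_scheme \<Rightarrow> 'r jet_term set diff_alg" where
  "jet R = \<lparr>carrier = jet_terms R // jet_rel R,
     monoid.mult = (\<lambda>P Q. \<Union>s\<in>P. \<Union>t\<in>Q. jet_class R (Mul s t)),
     one = jet_class R (Const 1),
     zero = jet_class R (Const 0),
     add = (\<lambda>P Q. \<Union>s\<in>P. \<Union>t\<in>Q. jet_class R (Add s t)),
     module.smult = (\<lambda>c P. \<Union>s\<in>P. jet_class R (Mul (Const c) s)),
     der = (\<lambda>P. \<Union>s\<in>P. jet_class R (Der s))\<rparr>"

definition jet_gen :: "(complex, 'r, 'z) module_scheme \<Rightarrow> 'r \<Rightarrow> 'r jet_term set" where
  "jet_gen R x = jet_class R (Gen x)"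

primrec jet_eval :: "('b, 'y) diff_alg_scheme \<Rightarrow> ('r \<Rightarrow> 'b) \<Rightarrow> 'r jet_term \<Rightarrow> 'b" where
  "jet_eval A f (Gen x) = f x"
| "jet_eval A f (Const c) = c \<odot>\<^bsub>A\<^esub> \<one>\<^bsub>A\<^esub>"
| "jet_eval A f (Add s t) = jet_eval A f s \<oplus>\<^bsub>A\<^esub> jet_eval A f t"
| "jet_eval A f (Mul s t) = jet_eval A f s \<otimes>\<^bsub>A\<^esub> jet_eval A f t"
| "jet_eval A f (Der s) = \<partial>\<^bsub>A\<^esub> (jet_eval A f s)"

text \<open>The map out of the jet algebra induced by an algebra homomorphism \<open>f\<close> into \<open>A\<close>.\<close>

definition jet_lift :: "('b, 'y) diff_alg_scheme \<Rightarrow> ('r \<Rightarrow> 'b) \<Rightarrow> 'r jet_term set \<Rightarrow> 'b" where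
  "jet_lift A f P = the_elem (jet_eval A f ` P)"

text \<open>For every commutative algebra \<open>R\<close>, the jet algebra is a differential algebra, \<open>jet_gen R\<close>
  is an algebra homomorphism into it, and each algebra homomorphism from \<open>R\<close> to a differential
  algebra factors uniquely through \<open>jet_gen R\<close>.\<close>

lemma complex_ring_simps [simp]:
  "carrier complex_ring = UNIV" "x \<otimes>\<^bsub>complex_ring\<^esub> y = x * y" "x \<oplus>\<^bsub>complex_ring\<^esub> y = x + y"
  "\<one>\<^bsub>complex_ring\<^esub> = 1" "\<zero>\<^bsub>complex_ring\<^esub> = 0"
  by (simp_all add: ring_of_type_algebra_def)

lemma jet_terms_simps [simp]:
  "Gen x \<in> jet_terms R \<longleftrightarrow> x \<in> carrier R"
  "Const c \<in> jet_terms R"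
  "Add s t \<in> jet_terms R \<longleftrightarrow> s \<in> jet_terms R \<and> t \<in> jet_terms R"
  "Mul s t \<in> jet_terms R \<longleftrightarrow> s \<in> jet_terms R \<and> t \<in> jet_terms R"
  "Der s \<in> jet_terms R \<longleftrightarrow> s \<in> jet_terms R"
  by (auto simp: jet_terms_def)

context
  fixes R :: "(complex, 'r, 'z) module_scheme"
  assumes R: "algebra complex_ring R"
begin

interpretation R: algebra complex_ring R by (rule R)

lemma jet_eq_terms: "jet_eq R s t \<Longrightarrow> s \<in> jet_terms R \<and> t \<in> jet_terms R"
  by (induction rule: jet_eq.induct) auto

lemma jet_rel_equiv: "equiv (jet_terms R) (jet_rel R)"
  unfolding equiv_def refl_on_def sym_on_def trans_on_def jet_rel_def
  by (auto dest: jet_eq_terms intro: jet_eq.refl jet_eq.sym jet_eq.trans)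

lemma jet_class_eq_iff:
  "s \<in> jet_terms R \<Longrightarrow> t \<in> jet_terms R \<Longrightarrow> jet_class R s = jet_class R t \<longleftrightarrow> jet_eq R s t"
  unfolding jet_class_def using eq_equiv_class_iff[OF jet_rel_equiv] by (simp add: jet_rel_def)

lemma jet_class_eqI: "jet_eq R s t \<Longrightarrow> jet_class R s = jet_class R t"
  using jet_class_eq_iff jet_eq_terms by blast

lemma jet_class_closed [simp]: "s \<in> jet_terms R \<Longrightarrow> jet_class R s \<in> carrier (jet R)"
  by (simp add: jet_def jet_class_def quotientI)

lemma jet_carrierE:
  assumes "P \<in> carrier (jet R)"
  obtains s where "s \<in> jet_terms R" "P = jet_class R s"
  using assms by (auto simp: jet_def jet_class_def elim: quotientE)

lemma in_jet_class: "t \<in> jet_class R s \<longleftrightarrow> jet_eq R s t"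
  by (simp add: jet_class_def jet_rel_def)

lemma UN_jet_class:
  assumes "s \<in> jet_terms R" "\<And>s'. jet_eq R s s' \<Longrightarrow> f s = f s'"
  shows "(\<Union>s'\<in>jet_class R s. f s') = f s"
proof (rule SUP_eq_const)
  show "jet_class R s \<noteq> {}"
    using jet_eq.refl[OF assms(1)] in_jet_class by blast
next
  fix s' assume "s' \<in> jet_class R s"
  then show "f s' = f s"
    using assms(2)[of s'] by (simp add: in_jet_class)
qed

lemma jet_ops:
  assumes s: "s \<in> jet_terms R"
  shows "t \<in> jet_terms R \<Longrightarrow> jet_class R s \<oplus>\<^bsub>jet R\<^esub> jet_class R t = jet_class R (Add s t)"
    and "t \<in> jet_terms R \<Longrightarrow> jet_class R s \<otimes>\<^bsub>jet R\<^esub> jet_class R t = jet_class R (Mul s t)"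
    and "c \<odot>\<^bsub>jet R\<^esub> jet_class R s = jet_class R (Mul (Const c) s)"
    and "\<partial>\<^bsub>jet R\<^esub> (jet_class R s) = jet_class R (Der s)"
proof -
  have UN2: "(\<Union>s'\<in>jet_class R s. \<Union>t'\<in>jet_class R t. jet_class R (g s' t')) = jet_class R (g s t)"
    if t: "t \<in> jet_terms R"
      and g: "\<And>s s' t t'. jet_eq R s s' \<Longrightarrow> jet_eq R t t' \<Longrightarrow> jet_eq R (g s t) (g s' t')"
    for t g
  proof -
    have "(\<Union>t'\<in>jet_class R t. jet_class R (g s' t')) = jet_class R (g s' t)"
      if "jet_eq R s s'" for s'
    proof (rule UN_jet_class[OF t])
      have "jet_eq R s' s'" using that jet_eq_terms jet_eq.refl by blast
      then show "jet_class R (g s' t) = jet_class R (g s' t')" if "jet_eq R t t'" for t'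
        using that by (rule jet_class_eqI[OF g])
    qed
    then have "(\<Union>s'\<in>jet_class R s. \<Union>t'\<in>jet_class R t. jet_class R (g s' t'))
        = (\<Union>s'\<in>jet_class R s. jet_class R (g s' t))"
      by (intro SUP_cong) (auto simp: in_jet_class)
    also have "\<dots> = jet_class R (g s t)"
      by (rule UN_jet_class[OF s]) (rule jet_class_eqI[OF g[OF _ jet_eq.refl[OF t]]])
    finally show ?thesis .
  qed
  show "jet_class R s \<oplus>\<^bsub>jet R\<^esub> jet_class R t = jet_class R (Add s t)" if "t \<in> jet_terms R"
    using UN2[OF that jet_eq.cong_add] by (simp add: jet_def)
  show "jet_class R s \<otimes>\<^bsub>jet R\<^esub> jet_class R t = jet_class R (Mul s t)" if "t \<in> jet_terms R"
    using UN2[OF that jet_eq.cong_mul] by (simp add: jet_def)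
  have "(\<Union>s'\<in>jet_class R s. jet_class R (Mul (Const c) s')) = jet_class R (Mul (Const c) s)"
    by (rule UN_jet_class[OF s], rule jet_class_eqI, rule jet_eq.cong_mul, rule jet_eq.refl) simp_all
  then show "c \<odot>\<^bsub>jet R\<^esub> jet_class R s = jet_class R (Mul (Const c) s)"
    by (simp add: jet_def)
  have "(\<Union>s'\<in>jet_class R s. jet_class R (Der s')) = jet_class R (Der s)"
    by (rule UN_jet_class[OF s], rule jet_class_eqI, rule jet_eq.cong_der)
  then show "\<partial>\<^bsub>jet R\<^esub> (jet_class R s) = jet_class R (Der s)"
    by (simp add: jet_def)
qed

lemma jet_consts: "\<zero>\<^bsub>jet R\<^esub> = jet_class R (Const 0)" "\<one>\<^bsub>jet R\<^esub> = jet_class R (Const 1)"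
  by (simp_all add: jet_def)

lemma jet_abelian_group: "abelian_group (jet R)"
proof (rule abelian_groupI)
  fix x assume "x \<in> carrier (jet R)"
  then obtain s where s: "s \<in> jet_terms R" "x = jet_class R s" by (rule jet_carrierE)
  show "\<exists>y\<in>carrier (jet R). y \<oplus>\<^bsub>jet R\<^esub> x = \<zero>\<^bsub>jet R\<^esub>"
    using s by (intro bexI[of _ "jet_class R (Mul (Const (-1)) s)"])
      (auto simp: jet_ops jet_consts intro!: jet_class_eqI intro: jet_eq.add_neg)
qed (auto elim!: jet_carrierE del: equalityI simp: jet_ops jet_consts
       jet_class_eqI jet_eq.add_assoc jet_eq.add_comm jet_eq.add_zero)

lemma jet_cring: "cring (jet R)"
proof (rule cringI[OF jet_abelian_group])
  show "comm_monoid (jet R)"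
    by (rule comm_monoidI) (auto elim!: jet_carrierE del: equalityI simp: jet_ops jet_consts
       jet_class_eqI jet_eq.mul_assoc jet_eq.mul_comm jet_eq.mul_one)
qed (auto elim!: jet_carrierE del: equalityI simp: jet_ops jet_class_eqI jet_eq.distrib)

lemma jet_const_hom:
  "jet_class R (Const (a + b)) = jet_class R (Const a) \<oplus>\<^bsub>jet R\<^esub> jet_class R (Const b)"
  "jet_class R (Const (a * b)) = jet_class R (Const a) \<otimes>\<^bsub>jet R\<^esub> jet_class R (Const b)"
  by (simp_all add: jet_ops jet_class_eqI jet_eq.const_add jet_eq.const_mul)

lemma jet_smult: "x \<in> carrier (jet R) \<Longrightarrow> c \<odot>\<^bsub>jet R\<^esub> x = jet_class R (Const c) \<otimes>\<^bsub>jet R\<^esub> x"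
  by (auto elim!: jet_carrierE del: equalityI simp: jet_ops)

lemma jet_algebra: "algebra complex_ring (jet R)"
proof -
  interpret J: cring "jet R" by (rule jet_cring)
  show ?thesis
    by (rule algebraI)
      (auto simp: jet_smult jet_const_hom J.l_distr J.r_distr J.m_assoc R.R_cring jet_cring
        simp flip: jet_consts)
qed

lemma jet_differential_algebra: "differential_algebra (jet R)"
proof -
  interpret J: algebra complex_ring "jet R" by (rule jet_algebra)
  show ?thesis
  proof unfold_locales
    fix x c assume x: "x \<in> carrier (jet R)"
    then obtain s where s: "s \<in> jet_terms R" "x = jet_class R s" by (rule jet_carrierE)
    have "\<partial>\<^bsub>jet R\<^esub> (c \<odot>\<^bsub>jet R\<^esub> x) = \<partial>\<^bsub>jet R\<^esub> (jet_class R (Const c)) \<otimes>\<^bsub>jet R\<^esub> x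
        \<oplus>\<^bsub>jet R\<^esub> jet_class R (Const c) \<otimes>\<^bsub>jet R\<^esub> \<partial>\<^bsub>jet R\<^esub> x"
      using s by (simp add: jet_ops jet_class_eqI jet_eq.der_mul)
    also have "\<partial>\<^bsub>jet R\<^esub> (jet_class R (Const c)) = \<zero>\<^bsub>jet R\<^esub>"
      by (simp add: jet_ops jet_consts jet_class_eqI jet_eq.der_const)
    also have "\<partial>\<^bsub>jet R\<^esub> x \<in> carrier (jet R)" using s by (simp add: jet_ops)
    ultimately show "\<partial>\<^bsub>jet R\<^esub> (c \<odot>\<^bsub>jet R\<^esub> x) = c \<odot>\<^bsub>jet R\<^esub> \<partial>\<^bsub>jet R\<^esub> x"
      using x by (simp add: jet_smult)
  qed (auto elim!: jet_carrierE del: equalityI simp: jet_ops jet_class_eqI jet_eq.der_add jet_eq.der_mul)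
qed

lemma jet_gen_hom: "jet_gen R \<in> alg_hom R (jet R)"
  unfolding alg_hom_def ring_hom_def
  by (auto simp: jet_gen_def jet_ops jet_consts
       intro!: jet_class_eqI intro: jet_eq.gen_add jet_eq.gen_mul jet_eq.gen_smult jet_eq.gen_one)

context
  fixes A :: "('b, 'y) diff_alg_scheme" and f :: "'r \<Rightarrow> 'b"
  assumes A: "differential_algebra A" and f: "f \<in> alg_hom R A"
begin

interpretation A: differential_algebra A by (rule A)

lemma jet_eval_closed: "t \<in> jet_terms R \<Longrightarrow> jet_eval A f t \<in> carrier A"
  using f A.smult_closed by (induction t) (auto simp: alg_hom_def ring_hom_def A.der_closed)

lemma A_const_mult: "x \<in> carrier A \<Longrightarrow> (c \<odot>\<^bsub>A\<^esub> \<one>\<^bsub>A\<^esub>) \<otimes>\<^bsub>A\<^esub> x = c \<odot>\<^bsub>A\<^esub> x"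
  using A.smult_assoc2[of c "\<one>\<^bsub>A\<^esub>" x] by simp

lemma A_der_one: "\<partial>\<^bsub>A\<^esub> \<one>\<^bsub>A\<^esub> = \<zero>\<^bsub>A\<^esub>"
proof -
  have c: "\<partial>\<^bsub>A\<^esub> \<one>\<^bsub>A\<^esub> \<in> carrier A" by (simp add: A.der_closed)
  have "\<partial>\<^bsub>A\<^esub> \<one>\<^bsub>A\<^esub> = \<partial>\<^bsub>A\<^esub> \<one>\<^bsub>A\<^esub> \<oplus>\<^bsub>A\<^esub> \<partial>\<^bsub>A\<^esub> \<one>\<^bsub>A\<^esub>"
    using A.der_mult[of "\<one>\<^bsub>A\<^esub>" "\<one>\<^bsub>A\<^esub>"] c by simp
  then show ?thesis using c A.add.l_cancel_one' by metis
qed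

lemma jet_eval_cong: "jet_eq R s t \<Longrightarrow> jet_eval A f s = jet_eval A f t"
proof (induction rule: jet_eq.induct)
  case (add_neg s)
  then have c: "jet_eval A f s \<in> carrier A" by (rule jet_eval_closed)
  have "((-1) \<odot>\<^bsub>A\<^esub> jet_eval A f s) \<oplus>\<^bsub>A\<^esub> (1 \<odot>\<^bsub>A\<^esub> jet_eval A f s) = (0::complex) \<odot>\<^bsub>A\<^esub> jet_eval A f s"
    using A.smult_l_distr[of "-1" 1 "jet_eval A f s"] c by simp
  then show ?case
    using c A.smult_one[of "jet_eval A f s"] A.smult_l_null[of "jet_eval A f s"]
      A.smult_l_null[of "\<one>\<^bsub>A\<^esub>"] by (simp add: A_const_mult)
next
  case (add_assoc s t u)
  then show ?case by (simp add: jet_eval_closed A.a_assoc)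
next
  case (mul_assoc s t u)
  then show ?case by (simp add: jet_eval_closed A.m_assoc)
next
  case (distrib s t u)
  then show ?case by (simp add: jet_eval_closed A.l_distr)
next
  case (add_zero s)
  then show ?case using A.smult_l_null[of "\<one>\<^bsub>A\<^esub>"] by (simp add: jet_eval_closed)
next
  case (mul_one s)
  then show ?case using A.smult_one[of "\<one>\<^bsub>A\<^esub>"] by (simp add: jet_eval_closed)
next
  case (const_add a b)
  then show ?case using A.smult_l_distr[of a b "\<one>\<^bsub>A\<^esub>"] by simp
next
  case (const_mul a b)
  then show ?case using A.smult_assoc1[of a b "\<one>\<^bsub>A\<^esub>"] A.smult_closed[of b "\<one>\<^bsub>A\<^esub>"]
    by (simp add: A_const_mult)
next
  case (der_const a)
  then show ?case
    using A.smult_r_null[of a] A.smult_l_null[of "\<one>\<^bsub>A\<^esub>"] by (simp add: A.der_smult A_der_one)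
next
  case gen_one
  then show ?case using f A.smult_one[of "\<one>\<^bsub>A\<^esub>"] by (simp add: alg_hom_def ring_hom_def)
next
  case (gen_smult x a)
  then show ?case using f by (auto simp: alg_hom_def ring_hom_def intro!: A_const_mult[symmetric])
qed (use f in \<open>auto simp: jet_eval_closed A.a_comm A.m_comm
       A.der_add A.der_mult alg_hom_def ring_hom_def\<close>)

lemma jet_lift_class: "s \<in> jet_terms R \<Longrightarrow> jet_lift A f (jet_class R s) = jet_eval A f s"
proof -
  assume s: "s \<in> jet_terms R"
  have "jet_eval A f t = jet_eval A f s" if "t \<in> jet_class R s" for t
    using that jet_eval_cong[of s t] by (simp add: in_jet_class)
  moreover have "s \<in> jet_class R s"
    using jet_eq.refl[OF s] by (simp add: in_jet_class)
  ultimately have "jet_eval A f ` jet_class R s = {jet_eval A f s}"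
    by blast
  then show ?thesis by (simp add: jet_lift_def)
qed

theorem jet_universal:
  "jet_lift A f \<in> diff_alg_hom (jet R) A"
  "x \<in> carrier R \<Longrightarrow> jet_lift A f (jet_gen R x) = f x"
  "g \<in> diff_alg_hom (jet R) A \<Longrightarrow> (\<And>x. x \<in> carrier R \<Longrightarrow> g (jet_gen R x) = f x) \<Longrightarrow>
     P \<in> carrier (jet R) \<Longrightarrow> g P = jet_lift A f P"
proof -
  show "jet_lift A f \<in> diff_alg_hom (jet R) A"
    using A.smult_one[of "\<one>\<^bsub>A\<^esub>"]
    unfolding diff_alg_hom_def alg_hom_def ring_hom_def
    by (auto elim!: jet_carrierE
         simp: jet_ops jet_consts jet_lift_class jet_eval_closed A_const_mult)
  show "x \<in> carrier R \<Longrightarrow> jet_lift A f (jet_gen R x) = f x"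
    by (simp add: jet_gen_def jet_lift_class)
  assume g: "g \<in> diff_alg_hom (jet R) A"
    and gx: "\<And>x. x \<in> carrier R \<Longrightarrow> g (jet_gen R x) = f x"
    and P: "P \<in> carrier (jet R)"
  interpret J: algebra complex_ring "jet R" by (rule jet_algebra)
  have const: "g (jet_class R (Const c)) = c \<odot>\<^bsub>A\<^esub> \<one>\<^bsub>A\<^esub>" for c
  proof -
    have "jet_class R (Const c) = c \<odot>\<^bsub>jet R\<^esub> \<one>\<^bsub>jet R\<^esub>"
      by (simp add: jet_smult)
    then show ?thesis using g by (simp add: diff_alg_hom_def alg_hom_def ring_hom_def)
  qed
  have "g (jet_class R s) = jet_eval A f s" if "s \<in> jet_terms R" for s
    using that
  proof (induction s)
    case (Gen x)
    then show ?case using gx by (simp add: jet_gen_def)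
  next
    case (Const c)
    then show ?case by (simp add: const)
  qed (use g in \<open>auto simp: diff_alg_hom_def alg_hom_def ring_hom_def simp flip: jet_ops\<close>)
  then show "g P = jet_lift A f P"
    using P by (auto elim!: jet_carrierE del: equalityI simp: jet_lift_class)
qed

end

end

section \<open>Quotients and associated graded algebras\<close>

text \<open>
  In this section \<open>B\<close> may be any record with a bilinear product; associativity is not assumed,
  since the products \<open>a\<^sub>(\<^sub>-\<^sub>1\<^sub>) b\<close> and \<open>a * b\<close> on a vertex algebra are not associative.
  All operations on cosets are unions over representatives, so they yield a coset only if
  the operation is compatible with the cosets.
\<close>

definition quot_alg :: "(complex, 'a, 'z) module_scheme \<Rightarrow> 'a set \<Rightarrow> (complex, 'a set) module" where
  "quot_alg B I = \<lparr>carrier = a_rcosets\<^bsub>B\<^esub> I, monoid.mult = rcoset_mult B I,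
     one = I +>\<^bsub>B\<^esub> \<one>\<^bsub>B\<^esub>, zero = I, add = set_add B,
     module.smult = (\<lambda>c P. \<Union>a\<in>P. I +>\<^bsub>B\<^esub> (c \<odot>\<^bsub>B\<^esub> a))\<rparr>"

text \<open>
  \<open>gr_alg B M N\<close> is the direct sum over \<open>n\<close> of the quotients \<open>M n / N n\<close>, an element being the
  family of its components; the product of components in degrees \<open>p\<close> and \<open>q\<close> is induced
  by the product of \<open>B\<close> and lies in degree \<open>p + q\<close>.
\<close>

definition gr_alg ::
    "(complex, 'a, 'z) module_scheme \<Rightarrow> (nat \<Rightarrow> 'a set) \<Rightarrow> (nat \<Rightarrow> 'a set)
      \<Rightarrow> (complex, nat \<Rightarrow> 'a set) module" where
  "gr_alg B M N = \<lparr>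
     carrier = {f. (\<forall>n. f n \<in> (\<lambda>a. N n +>\<^bsub>B\<^esub> a) ` M n) \<and> finite {n. f n \<noteq> N n}},
     monoid.mult = (\<lambda>f g n. finsum (quot_alg B (N n)) (\<lambda>p. rcoset_mult B (N n) (f p) (g (n - p))) {..n}),
     one = (\<lambda>n. if n = 0 then N 0 +>\<^bsub>B\<^esub> \<one>\<^bsub>B\<^esub> else N n),
     zero = N,
     add = (\<lambda>f g n. set_add B (f n) (g n)),
     module.smult = (\<lambda>c f n. \<Union>a\<in>f n. N n +>\<^bsub>B\<^esub> (c \<odot>\<^bsub>B\<^esub> a))\<rparr>"


section \<open>Vertex algebras\<close>

text \<open>The vector \<open>md a n b\<close> is \<open>a\<^sub>(\<^sub>n\<^sub>) b\<close>. The sums in the Borcherds identity have finite support.\<close>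

locale vertex_algebra = vector_space scale
  for scale :: "complex \<Rightarrow> 'v::ab_group_add \<Rightarrow> 'v" (infixr \<open>*s\<close> 75) +
  fixes vac :: 'v
    and md :: "'v \<Rightarrow> int \<Rightarrow> 'v \<Rightarrow> 'v"
  assumes md_linear_left: "Vector_Spaces.linear scale scale (\<lambda>a. md a n b)"
    and md_linear_right: "Vector_Spaces.linear scale scale (\<lambda>b. md a n b)"
    and md_truncation: "\<exists>N. \<forall>n\<ge>N. md a n b = 0"
    and vac_left: "md vac n b = (if n = -1 then b else 0)"
    and vac_right_nonneg: "n \<ge> 0 \<Longrightarrow> md a n vac = 0"
    and vac_right: "md a (-1) vac = a"
    and borcherds:
      "Sum_any (\<lambda>j::nat. (of_int m gchoose j) *s md (md a (n + int j) b) (m + k - int j) c) =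
       Sum_any (\<lambda>j::nat. ((-1) ^ j * (of_int n gchoose j)) *s
          (md a (m + n - int j) (md b (k + int j) c)
           - ((-1) powi n) *s md b (n + k - int j) (md a (m + int j) c)))"
begin

definition translation :: "'v \<Rightarrow> 'v" where
  "translation a = md a (-2) vac"

text \<open>The list \<open>[(a\<^sub>1, n\<^sub>1), \<dots>, (a\<^sub>r, n\<^sub>r)]\<close> encodes the monomial
  \<open>a\<^sub>1\<^sub>(\<^sub>-\<^sub>n\<^sub>1\<^sub>-\<^sub>1\<^sub>) \<cdots> a\<^sub>r\<^sub>(\<^sub>-\<^sub>n\<^sub>r\<^sub>-\<^sub>1\<^sub>) vac\<close>.\<close>

definition monomial :: "('v \<times> nat) list \<Rightarrow> 'v" where
  "monomial xs = foldr (\<lambda>(a, n) v. md a (- int n - 1) v) xs vac"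

definition li_filtration :: "nat \<Rightarrow> 'v set" where
  "li_filtration p = span {monomial xs | xs. sum_list (map snd xs) \<ge> p}"

text \<open>\<open>V\<close> with a bilinear product \<open>m\<close>.\<close>

definition with_product :: "('v \<Rightarrow> 'v \<Rightarrow> 'v) \<Rightarrow> (complex, 'v) module" where
  "with_product m = \<lparr>carrier = UNIV, monoid.mult = m, one = vac, zero = 0, add = (+), module.smult = scale\<rparr>"

abbreviation normal_product :: "(complex, 'v) module" where
  "normal_product \<equiv> with_product (\<lambda>a b. md a (-1) b)"

definition C2_algebra :: "(complex, 'v set) module" where
  "C2_algebra = quot_alg normal_product (li_filtration 1)"

definition gr_li :: "(nat \<Rightarrow> 'v set) diff_alg" where
  "gr_li = module.extend (gr_alg normal_product li_filtration (\<lambda>p. li_filtration (Suc p)))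
     (diff_alg.fields
       (\<lambda>f p. case p of
          0 \<Rightarrow> li_filtration 1
        | Suc q \<Rightarrow> (\<Union>a\<in>f q. li_filtration (Suc (Suc q)) +>\<^bsub>normal_product\<^esub> translation a)))"

text \<open>The inclusion of \<open>R\<^sub>V\<close> as the degree-zero part of the associated graded algebra.\<close>

definition C2_incl :: "'v set \<Rightarrow> nat \<Rightarrow> 'v set" where
  "C2_incl x p = (if p = 0 then x else li_filtration (Suc p))"

definition classically_free :: bool where
  "classically_free \<longleftrightarrow> jet_lift gr_li C2_incl \<in> diff_alg_iso (jet C2_algebra) gr_li"

end

locale graded_vertex_algebra = vertex_algebra scale vac md
  for scale :: "complex \<Rightarrow> 'v::ab_group_add \<Rightarrow> 'v" (infixr \<open>*s\<close> 75)
    and vac :: 'v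
    and md :: "'v \<Rightarrow> int \<Rightarrow> 'v \<Rightarrow> 'v" +
  fixes H :: "'v \<Rightarrow> 'v"
  assumes H_linear: "Vector_Spaces.linear scale scale H"
    and H_diagonalizable: "span (\<Union>n::nat. {v. H v = of_nat n *s v}) = UNIV"
    \<comment> \<open>the coefficient of \<open>z\<^sup>-\<^sup>n\<^sup>-\<^sup>1\<close> in \<open>[H, Y(a,z)] = z \<partial>\<^sub>z Y(a,z) + Y(H a,z)\<close>\<close>
    and H_commutator: "H (md a n b) - md a n (H b) = of_int (- n - 1) *s md a n b + md (H a) n b"
begin

definition homogeneous :: "nat \<Rightarrow> 'v set" where
  "homogeneous n = {v. H v = of_nat n *s v}"

definition component :: "nat \<Rightarrow> 'v \<Rightarrow> 'v" where
  "component n v =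
     (THE f. (\<forall>i. f i \<in> homogeneous i) \<and> finite {i. f i \<noteq> 0} \<and> v = Sum_any f) n"

definition V_le :: "nat \<Rightarrow> 'v set" where
  "V_le n = span (\<Union>j\<in>{..n}. homogeneous j)"

definition V_less :: "nat \<Rightarrow> 'v set" where
  "V_less n = span (\<Union>j\<in>{..<n}. homogeneous j)"

text \<open>For homogeneous \<open>a\<close> of degree \<open>d\<close>, the residue of
  \<open>(1 + z)\<^sup>d z\<^sup>-\<^sup>k Y(a,z) b = (\<Sum>i. \<Sum>n. (d choose i) a\<^sub>(\<^sub>n\<^sub>) b z\<^sup>i\<^sup>-\<^sup>k\<^sup>-\<^sup>n\<^sup>-\<^sup>1)\<close>
  picks out \<open>n = i - k\<close>.\<close>

definition zhu_residue :: "nat \<Rightarrow> 'v \<Rightarrow> 'v \<Rightarrow> 'v" where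
  "zhu_residue k a b =
     Sum_any (\<lambda>d. \<Sum>i\<in>{..d}. of_nat (d choose i) *s md (component d a) (int i - int k) b)"

definition zhu_product :: "'v \<Rightarrow> 'v \<Rightarrow> 'v" where
  "zhu_product = zhu_residue 1"

definition zhu_circle :: "'v \<Rightarrow> 'v \<Rightarrow> 'v" where
  "zhu_circle = zhu_residue 2"

definition zhu_ideal :: "'v set" where
  "zhu_ideal = span {zhu_circle a b | a b. True}"

definition zhu_algebra :: "(complex, 'v set) module" where
  "zhu_algebra = quot_alg (with_product zhu_product) zhu_ideal"

definition zhu_class :: "'v \<Rightarrow> 'v set" where
  "zhu_class a = zhu_ideal +>\<^bsub>with_product zhu_product\<^esub> a"

text \<open>The filtration index \<open>n - 1\<close> is expressed by \<open>V_less n\<close>, so that it is the zero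
  subspace for \<open>n = 0\<close>.\<close>

definition gr_zhu :: "(complex, nat \<Rightarrow> 'v set set) module" where
  "gr_zhu = gr_alg zhu_algebra (\<lambda>n. zhu_class ` V_le n) (\<lambda>n. zhu_class ` V_less n)"

text \<open>For homogeneous \<open>a\<close> of degree \<open>d\<close>, the only nonzero component of the image of the class
  of \<open>a\<close> is the class of \<open>a\<close> in degree \<open>d\<close>; this is extended linearly.\<close>

definition eta :: "'v set \<Rightarrow> nat \<Rightarrow> 'v set set" where
  "eta x n = (\<Union>a\<in>x. zhu_class ` V_less n +>\<^bsub>zhu_algebra\<^esub> zhu_class (component n a))"

end

end

theory Submission
  imports Defs
begin

text \<open>The ideal \<open>O(V)\<close> is spanned by the vectors \<open>a \<circ> b\<close> with \<open>a\<close>, \<open>b\<close> homogeneous, and \<open>a \<circ> b\<close> is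
\<open>a\<^sub>(\<^sub>-\<^sub>2\<^sub>) b\<close>, of degree \<open>deg a + deg b + 1\<close>, plus terms of lower degree. That \<open>\<eta>\<close> is a
well-defined surjective homomorphism is formal. It is injective if cancellation of leading terms
produces nothing new: if \<open>O\<^sub>N\<close> is the span of the \<open>a \<circ> b\<close> with \<open>deg a + deg b + 1 \<le> N\<close>, then an
element of \<open>O\<^sub>N\<close> without component of degree \<open>N\<close> has to lie in \<open>O\<^sub>N\<^sub>-\<^sub>1\<close>. Indeed, if \<open>a\<close> of degree
\<open>n\<close> lies in \<open>V\<^sub>\<le>\<^sub>n\<^sub>-\<^sub>1 + O(V)\<close>, descending in \<open>N\<close> one may then take the element of \<open>O(V)\<close> in \<open>O\<^sub>n\<close>,
where components of degree \<open>n\<close> are sums of vectors \<open>a\<^sub>(\<^sub>-\<^sub>2\<^sub>) b\<close> and lie in \<open>F\<^sup>1 V\<close>.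

So a relation \<open>\<Sum> a\<^sub>(\<^sub>-\<^sub>2\<^sub>) b = 0\<close> has to lift to a relation between the \<open>a \<circ> b\<close> modulo lower degree.
Filter \<open>O\<^sub>N\<close> by the subspaces \<open>G\<^sup>p\<close> spanned by \<open>O\<^sub>N\<^sub>-\<^sub>1\<close> and the \<open>a \<circ> b\<close> with \<open>a \<in> F\<^sup>i V\<close>,
\<open>b \<in> F\<^sup>j V\<close> and \<open>i + j + 1 \<ge> p\<close>. It suffices that the map \<open>\<iota>\<close> which sends \<open>a \<circ> b\<close> to
\<open>b \<partial>a\<close> is injective from \<open>X = \<Oplus> G\<^sup>p / G\<^sup>p\<^sup>+\<^sup>1\<close> (summed over \<open>N\<close> as well) to \<open>gr V\<close>: then an
element of \<open>O\<^sub>N\<close> with vanishing component of degree \<open>N\<close> moves down through all \<open>G\<^sup>p\<close>, and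
\<open>G\<^sup>p = O\<^sub>N\<^sub>-\<^sub>1\<close> for \<open>p > N\<close>, since \<open>F\<^sup>p V\<close> lives in degrees at least \<open>p\<close>.

The injectivity of \<open>\<iota>\<close> follows from the universal property of the jet algebra. To leading order,
Zhu's product makes \<open>X\<close> a module over \<open>gr V\<close> by \<open>u * (a \<circ> b) \<equiv> a \<circ> (u\<^sub>(\<^sub>-\<^sub>1\<^sub>) b)\<close>, the map
\<open>D a = a \<circ> 1\<close> is a derivation with \<open>b D a \<equiv> a \<circ> b\<close>, and \<open>\<iota>(x) y = \<iota>(y) x\<close>. Hence \<open>R\<^sub>V \<oplus> X\<close> with
the product \<open>x y = \<iota>(x) y\<close> on \<open>X\<close> is a commutative differential algebra that contains \<open>R\<^sub>V\<close>, and
\<open>(r, x) \<mapsto> r + \<iota>(x)\<close> is a homomorphism of differential algebras from it to \<open>gr V\<close>. If \<open>gr V\<close> is the jet algebra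
of \<open>R\<^sub>V\<close>, this homomorphism has a section \<open>s\<close>, and \<open>s (b \<partial>a) = b D a\<close> shows that \<open>s \<circ> \<iota>\<close> is the
inclusion of \<open>X\<close>.

The identities that define this algebra are \<open>zhu_product_circle\<close>, \<open>zhu_circle_product\<close> and
\<open>zhu_circle_leibniz\<close>; all of them are read off from the Borcherds identity with weights
(\<open>eventually_zmode_borcherds\<close>). The algebra itself appears as the families \<open>rees\<close> of vectors modulo
the families \<open>rees_ideal\<close>, and the homomorphism from the jet algebra as the evaluation
\<open>rees_eval\<close> of jet expressions, which respects \<open>jet_eq\<close> by \<open>jet_eq_rees_cong\<close>. The injectivity
of \<open>\<iota>\<close> is \<open>zhu_filtration_strict\<close>.\<close>

section \<open>Cosets in an algebra covered by a vector space\<close>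

text \<open>The operations of \<open>quot_alg\<close> and \<open>gr_alg\<close> are unions over representatives. They are computed
  for an algebra \<open>B\<close> onto which a vector space with a product \<open>m\<close> is mapped. With \<open>c\<close> the identity
  this covers the \<open>C\<^sub>2\<close>-algebra and \<open>gr V\<close>; with \<open>c\<close> the class map to Zhu's algebra it covers
  \<open>gr A(V)\<close>, whose components are cosets of cosets.\<close>

locale algebra_image = vector_space scale
  for scale :: "complex \<Rightarrow> 'v::ab_group_add \<Rightarrow> 'v" (infixr \<open>*s\<close> 75) +
  fixes B :: "(complex, 'b, 'z) module_scheme"
    and c :: "'v \<Rightarrow> 'b"
    and m :: "'v \<Rightarrow> 'v \<Rightarrow> 'v"
  assumes carrier_image: "carrier B = range c"
    and add_image: "c x \<oplus>\<^bsub>B\<^esub> c y = c (x + y)"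
    and mult_image: "c x \<otimes>\<^bsub>B\<^esub> c y = c (m x y)"
    and smult_image: "k \<odot>\<^bsub>B\<^esub> c x = c (k *s x)"
begin

definition coset :: "'v set \<Rightarrow> 'v \<Rightarrow> 'b set" where
  "coset K a = (\<lambda>k. c (k + a)) ` K"

lemma a_coset_image: "c ` K +>\<^bsub>B\<^esub> c a = coset K a"
  by (auto simp: a_r_coset_def' coset_def add_image)

lemma coset_zero: "coset K 0 = c ` K"
  by (simp add: coset_def)

lemma coset_eqI:
  assumes "subspace K" "a - b \<in> K"
  shows "coset K a = coset K b"
proof -
  have "coset K a \<subseteq> coset K b" if "a - b \<in> K" for a b
  proof
    fix x assume "x \<in> coset K a"
    then obtain k where k: "k \<in> K" "x = c (k + a)" by (auto simp: coset_def)
    then have "k + (a - b) \<in> K" "x = c (k + (a - b) + b)"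
      using that assms(1) by (simp_all add: subspace_add)
    then show "x \<in> coset K b" unfolding coset_def by blast
  qed
  moreover have "b - a \<in> K" using subspace_neg[OF assms] by simp
  ultimately show ?thesis using assms(2) by blast
qed

lemma coset_self: "subspace K \<Longrightarrow> c a \<in> coset K a"
  unfolding coset_def by (rule image_eqI[of _ _ 0]) (simp_all add: subspace_0)

lemma coset_add:
  assumes "subspace K"
  shows "set_add B (coset K a) (coset K b) = coset K (a + b)"
proof -
  have "set_add B (coset K a) (coset K b) = (\<Union>k\<in>K. \<Union>k'\<in>K. {c ((k + k') + (a + b))})"
    unfolding set_add_def' coset_def by (simp add: add_image add_ac)
  also have "\<dots> = (\<Union>l\<in>K. {c (l + (a + b))})"
  proof (intro equalityI UN_least)
    fix k k' assume "k \<in> K" "k' \<in> K"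
    then show "{c ((k + k') + (a + b))} \<subseteq> (\<Union>l\<in>K. {c (l + (a + b))})"
      using subspace_add[OF assms] by blast
  next
    fix l assume "l \<in> K"
    then show "{c (l + (a + b))} \<subseteq> (\<Union>k\<in>K. \<Union>k'\<in>K. {c ((k + k') + (a + b))})"
      using subspace_0[OF assms] by (intro SUP_upper2[of l] SUP_upper2[of 0]) simp_all
  qed
  also have "\<dots> = coset K (a + b)" by (auto simp: coset_def)
  finally show ?thesis .
qed

lemma UN_coset:
  assumes "subspace K" "\<And>k. k \<in> K \<Longrightarrow> f (c (k + a)) = y"
  shows "(\<Union>x\<in>coset K a. f x) = y"
  using assms subspace_0[OF assms(1)] by (auto simp: coset_def)

lemma coset_mult:
  assumes K: "subspace K" "subspace K1" "subspace K2"
    and "\<And>k1 k2. k1 \<in> K1 \<Longrightarrow> k2 \<in> K2 \<Longrightarrow> m (k1 + a) (k2 + b) - m a b \<in> K"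
  shows "rcoset_mult B (c ` K) (coset K1 a) (coset K2 b) = coset K (m a b)"
  unfolding rcoset_mult_def
  by (intro UN_coset K) (simp add: mult_image a_coset_image coset_eqI[OF K(1)] assms(4))

lemma coset_smult:
  assumes "subspace K"
  shows "(\<Union>x\<in>coset K a. c ` K +>\<^bsub>B\<^esub> (k \<odot>\<^bsub>B\<^esub> x)) = coset K (k *s a)"
  by (intro UN_coset assms)
    (simp add: smult_image a_coset_image coset_eqI[OF assms] scale_right_distrib subspace_scale[OF assms])

lemma quot_alg_carrier: "carrier (quot_alg B (c ` K)) = range (coset K)"
  by (auto simp: quot_alg_def A_RCOSETS_def' carrier_image a_coset_image)

lemma quot_alg_abelian_monoid:
  assumes "subspace K"
  shows "abelian_monoid (quot_alg B (c ` K))"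
proof (rule abelian_monoidI)
  show "\<zero>\<^bsub>quot_alg B (c ` K)\<^esub> \<in> carrier (quot_alg B (c ` K))"
    unfolding quot_alg_carrier by (simp add: quot_alg_def flip: coset_zero)
qed (auto simp: quot_alg_carrier, auto simp: quot_alg_def coset_add[OF assms] add_ac simp flip: coset_zero)

lemma finsum_coset:
  assumes "subspace K" "finite S"
  shows "finsum (quot_alg B (c ` K)) (\<lambda>i. coset K (f i)) S = coset K (sum f S)"
  using assms(2)
proof (induction S rule: finite_induct)
  case empty
  interpret abelian_monoid "quot_alg B (c ` K)" by (rule quot_alg_abelian_monoid[OF assms(1)])
  show ?case by (simp add: coset_zero) (simp add: quot_alg_def)
next
  case (insert i S)
  interpret abelian_monoid "quot_alg B (c ` K)" by (rule quot_alg_abelian_monoid[OF assms(1)])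
  have "finsum (quot_alg B (c ` K)) (\<lambda>i. coset K (f i)) (insert i S)
     = coset K (f i) \<oplus>\<^bsub>quot_alg B (c ` K)\<^esub> finsum (quot_alg B (c ` K)) (\<lambda>i. coset K (f i)) S"
    by (rule finsum_insert) (use insert in \<open>auto simp: quot_alg_carrier\<close>)
  then show ?case
    using insert by (simp add: quot_alg_def coset_add[OF assms(1)])
qed

text \<open>The hypothesis says that the products of representatives agree modulo \<open>K n\<close>, so that each summand
  of the convolution is a single coset.\<close>

lemma gr_alg_mult:
  assumes K: "\<And>n. subspace (K n)"
    and "\<And>p k1 k2. p \<le> n \<Longrightarrow> k1 \<in> K p \<Longrightarrow> k2 \<in> K (n - p) \<Longrightarrow>
      m (k1 + x p) (k2 + y (n - p)) - m (x p) (y (n - p)) \<in> K n"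
  shows "(monoid.mult (gr_alg B M (\<lambda>n. c ` K n)) (\<lambda>p. coset (K p) (x p)) (\<lambda>p. coset (K p) (y p))) n
     = coset (K n) (\<Sum>p\<le>n. m (x p) (y (n - p)))"
proof -
  interpret abelian_monoid "quot_alg B (c ` K n)" by (rule quot_alg_abelian_monoid[OF K])
  have "(monoid.mult (gr_alg B M (\<lambda>n. c ` K n)) (\<lambda>p. coset (K p) (x p)) (\<lambda>p. coset (K p) (y p))) n
    = finsum (quot_alg B (c ` K n)) (\<lambda>p. rcoset_mult B (c ` K n) (coset (K p) (x p)) (coset (K (n - p)) (y (n - p)))) {..n}"
    by (simp add: gr_alg_def)
  also have "\<dots> = finsum (quot_alg B (c ` K n)) (\<lambda>p. coset (K n) (m (x p) (y (n - p)))) {..n}"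
  proof (rule finsum_cong'[OF HOL.refl])
    show "rcoset_mult B (c ` K n) (coset (K p) (x p)) (coset (K (n - p)) (y (n - p))) = coset (K n) (m (x p) (y (n - p)))"
      if "p \<in> {..n}" for p
      by (rule coset_mult[OF K K K]) (use that assms(2) in simp)
  qed (auto simp: quot_alg_carrier)
  also have "\<dots> = coset (K n) (\<Sum>p\<le>n. m (x p) (y (n - p)))"
    by (rule finsum_coset[OF K]) simp
  finally show ?thesis .
qed

lemma gr_alg_smult:
  assumes "\<And>n. subspace (K n)"
  shows "(module.smult (gr_alg B M (\<lambda>n. c ` K n)) k (\<lambda>p. coset (K p) (x p))) n = coset (K n) (k *s x n)"
  by (simp add: gr_alg_def coset_smult[OF assms])

lemma gr_alg_add:
  assumes "\<And>n. subspace (K n)"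
  shows "(ring.add (gr_alg B M (\<lambda>n. c ` K n)) (\<lambda>p. coset (K p) (x p)) (\<lambda>p. coset (K p) (y p))) n
    = coset (K n) (x n + y n)"
  by (simp add: gr_alg_def coset_add[OF assms])

end

context vertex_algebra
begin

section \<open>Modes of a vertex algebra\<close>

lemma md_add_left: "md (a + a') n b = md a n b + md a' n b"
  and md_scale_left: "md (c *s a) n b = c *s md a n b"
  using md_linear_left[of n b] by (auto simp: Vector_Spaces.linear_iff)

lemma md_add_right: "md a n (b + b') = md a n b + md a n b'"
  and md_scale_right: "md a n (c *s b) = c *s md a n b"
  using md_linear_right[of a n] by (auto simp: Vector_Spaces.linear_iff)

lemma md_zero [simp]: "md 0 n b = 0" "md a n 0 = 0"
  using md_scale_left[of 0 0 n b] md_scale_right[of a n 0 0] by simp_all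

lemma md_uminus: "md (- a) n b = - md a n b" "md a n (- b) = - md a n b"
  using md_scale_left[of "-1" a n b] md_scale_right[of a n "-1" b] by simp_all

lemma md_diff_left: "md (a - a') n b = md a n b - md a' n b"
  and md_diff_right: "md a n (b - b') = md a n b - md a n b'"
  using md_add_left[of a "- a'" n b] md_add_right[of a n b "- b'"] by (simp_all add: md_uminus)

lemma md_sum_right: "md a n (sum f S) = (\<Sum>i\<in>S. md a n (f i))"
  by (induction S rule: infinite_finite_induct) (simp_all add: md_add_right)

lemma eventually_mode_zero: "\<forall>\<^sub>F j in sequentially. \<forall>i\<ge>j. md a (n + int i) b = 0"
proof -
  obtain N where N: "\<And>n. n \<ge> N \<Longrightarrow> md a n b = 0" using md_truncation by blast
  have "\<forall>i\<ge>j. md a (n + int i) b = 0" if "j \<ge> nat (N - n)" for j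
    using that by (auto intro!: N)
  then show ?thesis by (rule eventually_sequentiallyI)
qed

lemma Sum_any_eq_sum_lessThan:
  fixes f :: "nat \<Rightarrow> 'b::comm_monoid_add"
  assumes "\<And>i. i \<ge> L \<Longrightarrow> f i = 0"
  shows "Sum_any f = (\<Sum>i<L. f i)"
  by (rule Sum_any.expand_superset) (use assms in \<open>auto intro: leI\<close>)

text \<open>Stating the identity for all large bounds allows finitely many instances of it to be
  combined without keeping track of where each of the sums stops.\<close>

lemma eventually_borcherds:
  "\<forall>\<^sub>F L in sequentially.
     (\<Sum>l<L. (of_int m gchoose l) *s md (md a (n + int l) b) (m + k - int l) c)
   = (\<Sum>j<L. ((-1) ^ j * (of_int n gchoose j)) *s
        (md a (m + n - int j) (md b (k + int j) c)
          - ((-1) powi n) *s md b (n + k - int j) (md a (m + int j) c)))"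
  using eventually_mode_zero[of a n b] eventually_mode_zero[of b k c] eventually_mode_zero[of a m c]
proof eventually_elim
  case (elim L)
  then show ?case
    using borcherds[of m a n b k c]
    by (subst (asm) (1 2) Sum_any_eq_sum_lessThan[where L = L]) simp_all
qed

lemma sum_lessThan_gchoose_zero:
  "L > 0 \<Longrightarrow> (\<Sum>j<L. (((-1) ^ j * (of_int 0 gchoose j)) *s g j)) = g 0"
  "L > 0 \<Longrightarrow> (\<Sum>j<L. (of_int 0 gchoose j) *s g j) = g 0"
  by (subst sum.remove[of _ 0]; simp add: gbinomial_0_left)+

lemma eventually_commutator:
  "\<forall>\<^sub>F L in sequentially.
     md a m (md b k c) - md b k (md a m c)
       = (\<Sum>l<L. (of_int m gchoose l) *s md (md a (int l) b) (m + k - int l) c)"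
  using eventually_borcherds[of m a 0 b k c] eventually_gt_at_top[of 0]
  by eventually_elim (simp add: sum_lessThan_gchoose_zero[where g = "\<lambda>j. md a (m - int j) (md b (k + int j) c)
          - md b (k - int j) (md a (m + int j) c)", simplified])

lemma eventually_iterate:
  "\<forall>\<^sub>F L in sequentially.
     md (md a n b) k c = (\<Sum>j<L. ((-1) ^ j * (of_int n gchoose j)) *s
        (md a (n - int j) (md b (k + int j) c)
          - ((-1) powi n) *s md b (n + k - int j) (md a (int j) c)))"
  using eventually_borcherds[of 0 a n b k c] eventually_gt_at_top[of 0]
  by eventually_elim (simp add: sum_lessThan_gchoose_zero[where g = "\<lambda>l. md (md a (n + int l) b) (k - int l) c", simplified])

lemma gchoose_minus_two: "(-1) ^ j * ((-2 :: complex) gchoose j) = of_nat (j + 1)"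
proof -
  have "(-2 :: complex) gchoose j = (-1) ^ j * ((2 + of_nat j - 1) gchoose j)"
    by (rule gbinomial_minus)
  also have "(2 + of_nat j - 1 :: complex) = of_nat (j + 1)" by simp
  also have "(of_nat (j + 1) gchoose j :: complex) = of_nat ((j + 1) choose j)"
    by (simp only: binomial_gbinomial)
  finally show ?thesis by (simp flip: power_mult_distrib mult.assoc)
qed

lemma gchoose_minus_one: "(-1) ^ j * ((-1 :: complex) gchoose j) = 1"
  using gbinomial_minus[of "1::complex" j] by (simp add: binomial_gbinomial[symmetric] flip: power_mult_distrib mult.assoc)

text \<open>In the iterate formula for \<open>(a\<^sub>(\<^sub>-\<^sub>2\<^sub>) 1)\<^sub>(\<^sub>n\<^sub>) b\<close> all modes of the vacuum but the one of index \<open>-1\<close>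
  vanish, which leaves a single term: with \<open>a\<close> outermost for \<open>n < 0\<close>, with the vacuum outermost for \<open>n > 0\<close>.\<close>

lemma md_translation: "md (translation a) n b = of_int (- n) *s md a (n - 1) b"
proof -
  have "\<forall>\<^sub>F L in sequentially. L > nat (\<bar>n\<bar>) + 1" by (rule eventually_gt_at_top)
  with eventually_iterate[of a "-2" vac n b]
  have "\<forall>\<^sub>F L in sequentially. md (translation a) n b = of_int (- n) *s md a (n - 1) b"
  proof eventually_elim
    case (elim L)
    have "md (translation a) n b = (\<Sum>j<L. of_nat (j + 1) *s
        (md a (-2 - int j) (md vac (n + int j) b) - md vac (n - 2 - int j) (md a (int j) b)))"
      using elim(1) by (simp add: translation_def gchoose_minus_two[simplified] cong: sum.cong)
    also have "\<dots> = (\<Sum>j<L. if int j = (if n < 0 then - n - 1 else n - 1) then of_int (- n) *s md a (n - 1) b else 0)"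
    proof (rule sum.cong[OF HOL.refl])
      fix j
      consider "n = - int j - 1" | "n = int j + 1" | "n + int j \<noteq> -1" "n - 2 - int j \<noteq> -1"
        by linarith
      then show "of_nat (j + 1) *s (md a (-2 - int j) (md vac (n + int j) b) - md vac (n - 2 - int j) (md a (int j) b))
          = (if int j = (if n < 0 then - n - 1 else n - 1) then of_int (- n) *s md a (n - 1) b else 0)"
      proof cases
        case 1
        then have "n < 0" "n + int j = -1" "-2 - int j = n - 1" "n - 2 - int j \<noteq> -1" "of_int (- n) = (of_nat (j + 1) :: complex)"
          by simp_all
        then show ?thesis
          unfolding \<open>-2 - int j = n - 1\<close> by (simp add: vac_left del: of_nat_add of_int_minus)
      next
        case 2
        then have "n > 0" "n + int j \<noteq> -1" "n - 2 - int j = -1" "of_int (- n) = - (of_nat (j + 1) :: complex)"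
          and j: "int j = n - 1"
          by simp_all
        then show ?thesis
          unfolding j by (simp add: vac_left flip: scale_minus_left del: of_nat_add of_int_minus)
      next
        case 3
        then show ?thesis by (auto simp: vac_left)
      qed
    qed
    also have "\<dots> = of_int (- n) *s md a (n - 1) b"
    proof (cases "n = 0")
      case False
      then obtain i where i: "int i = (if n < 0 then - n - 1 else n - 1)"
        by (cases "n < 0") (auto intro!: that[of "nat (if n < 0 then - n - 1 else n - 1)"])
      then have "i < L" using elim(2) by (auto split: if_splits)
      then show ?thesis unfolding i[symmetric] by (simp add: sum.delta)
    qed auto
    finally show ?case .
  qed
  then show ?thesis by simp
qed

section \<open>The Li filtration\<close>

lemma md_mem_span_right:
  assumes "b \<in> span S" "subspace W" "\<And>s. s \<in> S \<Longrightarrow> md a n s \<in> W"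
  shows "md a n b \<in> W"
  using assms(1)
proof (rule span_induct)
  show "subspace {b. md a n b \<in> W}"
    using assms(2) by (auto simp: subspace_def md_add_right md_scale_right)
qed (use assms in auto)

lemma md_mem_span_left:
  assumes "a \<in> span S" "subspace W" "\<And>s. s \<in> S \<Longrightarrow> md s n b \<in> W"
  shows "md a n b \<in> W"
  using assms(1)
proof (rule span_induct)
  show "subspace {a. md a n b \<in> W}"
    using assms(2) by (auto simp: subspace_def md_add_left md_scale_left)
qed (use assms in auto)

lemma monomial_simps [simp]:
  "monomial [] = vac"
  "monomial ((a, n) # xs) = md a (- int n - 1) (monomial xs)"
  by (simp_all add: monomial_def)

lemma subspace_li [simp]: "subspace (li_filtration p)"
  by (simp add: li_filtration_def)

lemma monomial_in_li: "p \<le> sum_list (map snd xs) \<Longrightarrow> monomial xs \<in> li_filtration p"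
  unfolding li_filtration_def by (rule span_base) blast

lemma li_antimono: "p \<le> q \<Longrightarrow> v \<in> li_filtration q \<Longrightarrow> v \<in> li_filtration p"
  unfolding li_filtration_def by (erule rev_subsetD, rule span_mono) auto

lemma li_zero [simp]: "li_filtration 0 = UNIV"
proof -
  have "v \<in> li_filtration 0" for v
    using monomial_in_li[of 0 "[(v, 0)]"] by (simp add: vac_right)
  then show ?thesis by blast
qed

lemma md_neg_li: "v \<in> li_filtration q \<Longrightarrow> md a (- int n - 1) v \<in> li_filtration (q + n)"
  unfolding li_filtration_def[of q]
proof (rule md_mem_span_right)
  fix s assume "s \<in> {monomial xs |xs. q \<le> sum_list (map snd xs)}"
  then obtain xs where xs: "s = monomial xs" "q \<le> sum_list (map snd xs)" by blast
  then show "md a (- int n - 1) s \<in> li_filtration (q + n)"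
    using monomial_in_li[of "q + n" "(a, n) # xs"] by simp
qed simp_all

lemma li_sum: "(\<And>i. i \<in> S \<Longrightarrow> f i \<in> li_filtration p) \<Longrightarrow> sum f S \<in> li_filtration p"
  by (rule subspace_sum[OF subspace_li])

lemma li_scale: "v \<in> li_filtration p \<Longrightarrow> c *s v \<in> li_filtration p"
  by (rule subspace_scale[OF subspace_li])

lemma li_diff: "v \<in> li_filtration p \<Longrightarrow> w \<in> li_filtration p \<Longrightarrow> v - w \<in> li_filtration p"
  by (rule subspace_diff[OF subspace_li])

lemma md_neg_li':
  assumes "v \<in> li_filtration q" "n < 0" "int r \<le> int q - n - 1"
  shows "md a n v \<in> li_filtration r"
  using md_neg_li[OF assms(1), of a "nat (- n - 1)"] assms(2,3)
  by (auto intro: li_antimono[rotated])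

text \<open>Moving \<open>a\<^sub>(\<^sub>n\<^sub>)\<close> past the first factor \<open>b\<^sub>(\<^sub>-\<^sub>m\<^sub>-\<^sub>1\<^sub>)\<close> leaves commutator terms
  \<open>(a\<^sub>(\<^sub>l\<^sub>) b)\<^sub>(\<^sub>n\<^sub>-\<^sub>m\<^sub>-\<^sub>1\<^sub>-\<^sub>l\<^sub>)\<close> acting on a shorter monomial, so the induction on the length
  runs over all \<open>a\<close> and \<open>n\<close> at once.\<close>

lemma md_nonneg_monomial_li:
  "md a (int n) (monomial xs) \<in> li_filtration (sum_list (map snd xs) - n)"
proof (induction xs arbitrary: a n)
  case Nil
  then show ?case by simp
next
  case (Cons x xs)
  obtain b m where x: "x = (b, m)" by force
  let ?w = "monomial xs" and ?s = "sum_list (map snd xs)"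
  let ?G = "li_filtration (sum_list (map snd (x # xs)) - n)"
  obtain L where L: "md a (int n) (md b (- int m - 1) ?w) - md b (- int m - 1) (md a (int n) ?w)
       = (\<Sum>l<L. (of_int (int n) gchoose l) *s md (md a (int l) b) (int n + (- int m - 1) - int l) ?w)"
    using eventually_happens[OF eventually_commutator[of a "int n" b "- int m - 1" ?w]] by auto
  have "(\<Sum>l<L. (of_int (int n) gchoose l) *s md (md a (int l) b) (int n + (- int m - 1) - int l) ?w) \<in> ?G"
  proof (intro li_sum)
    fix l
    let ?k = "int n + (- int m - 1) - int l"
    show "(of_int (int n) gchoose l) *s md (md a (int l) b) ?k ?w \<in> ?G"
    proof (cases "l \<le> n")
      case False
      then have "(of_int (int n) gchoose l :: complex) = 0"
        by (simp flip: binomial_gbinomial)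
      then show ?thesis by (simp add: subspace_0)
    next
      case True
      show ?thesis
      proof (cases "?k < 0")
        case True
        show ?thesis
          by (intro li_scale md_neg_li'[OF monomial_in_li[OF order_refl] True]) (use True x \<open>l \<le> n\<close> in auto)
      next
        case False
        then have k: "?k = int (n - m - 1 - l)" by auto
        show ?thesis unfolding k
          by (intro li_scale li_antimono[OF _ Cons.IH]) (use x False in auto)
      qed
    qed
  qed
  moreover have "md b (- int m - 1) (md a (int n) ?w) \<in> ?G"
    by (rule md_neg_li'[OF Cons.IH]) (use x in auto)
  ultimately show ?case
    unfolding x monomial_simps L[symmetric, unfolded eq_diff_eq]
    by (metis L diff_add_cancel subspace_add subspace_li)
qed

lemma md_nonneg_li: "v \<in> li_filtration q \<Longrightarrow> md a (int n) v \<in> li_filtration (q - n)"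
  unfolding li_filtration_def[of q]
proof (rule md_mem_span_right)
  fix s assume "s \<in> {monomial xs |xs. q \<le> sum_list (map snd xs)}"
  then obtain xs where xs: "s = monomial xs" "q \<le> sum_list (map snd xs)" by blast
  then show "md a (int n) s \<in> li_filtration (q - n)"
    by (auto intro: li_antimono[OF _ md_nonneg_monomial_li])
qed simp_all

text \<open>The iterate formula expresses the modes of \<open>c\<^sub>(\<^sub>-\<^sub>m\<^sub>-\<^sub>1\<^sub>) a'\<close> by those of \<open>c\<close>, whose effect on the
  filtration is known, and those of the shorter monomial \<open>a'\<close>.\<close>

lemma md_monomial_li:
  assumes "v \<in> li_filtration q"
    and "int r \<le> int (sum_list (map snd xs)) + int q - n - (if n < 0 then 1 else 0) \<or> r = 0"
  shows "md (monomial xs) n v \<in> li_filtration r"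
  using assms
proof (induction xs arbitrary: n v q r)
  case Nil
  show ?case
  proof (cases "n = -1")
    case True
    then show ?thesis using Nil by (auto simp: vac_left intro: li_antimono[rotated])
  qed (simp add: vac_left subspace_0)
next
  case (Cons x xs)
  obtain c m where x: "x = (c, m)" by force
  let ?a = "monomial xs" and ?s = "int (sum_list (map snd xs))"
  obtain L where L: "md (md c (- int m - 1) ?a) n v
     = (\<Sum>j<L. ((-1) ^ j * (of_int (- int m - 1) gchoose j)) *s
        (md c (- int m - 1 - int j) (md ?a (n + int j) v)
          - ((-1) powi (- int m - 1)) *s md ?a (- int m - 1 + n - int j) (md c (int j) v)))"
    using eventually_happens[OF eventually_iterate[of c "- int m - 1" ?a n v]] by auto
  show ?case
    unfolding x monomial_simps L
  proof (intro li_sum li_scale li_diff)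
    fix j
    let ?q1 = "nat (?s + int q - (n + int j) - (if n + int j < 0 then 1 else 0))"
    have "md ?a (n + int j) v \<in> li_filtration ?q1"
      by (rule Cons.IH[OF Cons.prems(1)]) linarith
    then show "md c (- int m - 1 - int j) (md ?a (n + int j) v) \<in> li_filtration r"
      by (rule md_neg_li') (use Cons.prems(2) x in \<open>auto split: if_splits\<close>)
    have "md c (int j) v \<in> li_filtration (q - j)" by (rule md_nonneg_li[OF Cons.prems(1)])
    then show "md ?a (- int m - 1 + n - int j) (md c (int j) v) \<in> li_filtration r"
      by (rule Cons.IH) (use Cons.prems(2) x in \<open>auto split: if_splits\<close>)
  qed
qed

text \<open>A mode \<open>n\<close> has Li degree \<open>-n-1\<close>, but for \<open>n \<ge> 0\<close> one degree is gained: on \<open>gr V\<close> these modes act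
  by zero, which is why \<open>gr V\<close> is commutative. The alternative \<open>r = 0\<close> covers negative bounds.\<close>

lemma md_li:
  assumes "a \<in> li_filtration p" "v \<in> li_filtration q"
    and "int r \<le> int p + int q - n - (if n < 0 then 1 else 0) \<or> r = 0"
  shows "md a n v \<in> li_filtration r"
  using assms(1) unfolding li_filtration_def[of p]
proof (rule md_mem_span_left)
  fix s assume "s \<in> {monomial xs |xs. p \<le> sum_list (map snd xs)}"
  then obtain xs where xs: "s = monomial xs" "p \<le> sum_list (map snd xs)" by blast
  show "md s n v \<in> li_filtration r"
    unfolding xs(1) by (rule md_monomial_li[OF assms(2)]) (use assms(3) xs(2) in \<open>auto split: if_splits\<close>)
qed simp

lemma translation_li: "a \<in> li_filtration p \<Longrightarrow> translation a \<in> li_filtration (Suc p)"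
  unfolding translation_def by (rule md_li[of _ p _ 0]) simp_all

lemma normal_product_li:
  "a \<in> li_filtration p \<Longrightarrow> b \<in> li_filtration q \<Longrightarrow> md a (-1) b \<in> li_filtration (p + q)"
  by (rule md_li) auto

text \<open>As \<open>b = b\<^sub>(\<^sub>-\<^sub>1\<^sub>) 1\<close>, the difference is a commutator applied to the vacuum, and each of its terms
  \<open>(b\<^sub>(\<^sub>l\<^sub>) a)\<^sub>(\<^sub>-\<^sub>2\<^sub>-\<^sub>l\<^sub>) 1\<close> contains a mode \<open>l \<ge> 0\<close>.\<close>

lemma normal_product_commute_li:
  assumes "a \<in> li_filtration p" "b \<in> li_filtration q"
  shows "md a (-1) b - md b (-1) a \<in> li_filtration (Suc (p + q))"
proof -
  obtain L where L: "md b (-1) (md a (-1) vac) - md a (-1) (md b (-1) vac)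
     = (\<Sum>l<L. (of_int (-1) gchoose l) *s md (md b (int l) a) (-1 + -1 - int l) vac)"
    using eventually_happens[OF eventually_commutator[of b "-1" a "-1" vac]] by auto
  have "(\<Sum>l<L. (of_int (-1) gchoose l) *s md (md b (int l) a) (-1 + -1 - int l) vac)
      \<in> li_filtration (Suc (p + q))"
  proof (intro li_sum li_scale)
    fix l
    have "md b (int l) a \<in> li_filtration (q + p - l)"
      by (rule md_li[OF assms(2,1)]) auto
    then show "md (md b (int l) a) (-1 + -1 - int l) vac \<in> li_filtration (Suc (p + q))"
      by (rule md_li[of _ _ _ 0]) auto
  qed
  then show ?thesis
    using subspace_neg[OF subspace_li] by (metis L minus_diff_eq vac_right)
qed

text \<open>The term \<open>j = 0\<close> of the iterate formula is \<open>a\<^sub>(\<^sub>-\<^sub>1\<^sub>) b\<^sub>(\<^sub>-\<^sub>1\<^sub>) c\<close>; all other terms contain a mode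
  of index at least \<open>0\<close>.\<close>

lemma normal_product_assoc_li:
  assumes "a \<in> li_filtration p" "b \<in> li_filtration q" "c \<in> li_filtration r"
  shows "md (md a (-1) b) (-1) c - md a (-1) (md b (-1) c) \<in> li_filtration (Suc (p + q + r))"
proof -
  have "\<forall>\<^sub>F L in sequentially. md (md a (-1) b) (-1) c - md a (-1) (md b (-1) c) \<in> li_filtration (Suc (p + q + r))"
    using eventually_iterate[of a "-1" b "-1" c] eventually_gt_at_top[of 0]
  proof eventually_elim
    case (elim L)
    have "md (md a (-1) b) (-1) c = (\<Sum>j<L. (md a (-1 - int j) (md b (-1 + int j) c) + md b (-2 - int j) (md a (int j) c)))"
      using elim(1) by (simp add: gchoose_minus_one[simplified])
    also have "\<dots> = (\<Sum>j<L. md a (-1 - int j) (md b (-1 + int j) c)) + (\<Sum>j<L. md b (-2 - int j) (md a (int j) c))"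
      by (rule sum.distrib)
    also have "(\<Sum>j<L. md a (-1 - int j) (md b (-1 + int j) c)) = md a (-1) (md b (-1) c)
        + (\<Sum>j\<in>{..<L}-{0}. md a (-1 - int j) (md b (-1 + int j) c))"
      using elim(2) by (subst sum.remove[of _ 0]) auto
    finally have e: "md (md a (-1) b) (-1) c - md a (-1) (md b (-1) c)
      = (\<Sum>j\<in>{..<L}-{0}. md a (-1 - int j) (md b (-1 + int j) c)) + (\<Sum>j<L. md b (-2 - int j) (md a (int j) c))"
      by simp
    show ?case unfolding e
    proof (intro subspace_add[OF subspace_li] li_sum)
      fix j assume "j \<in> {..<L}-{0}"
      then have j: "j > 0" by simp
      have "md b (-1 + int j) c \<in> li_filtration (q + r + 1 - j)"
        by (rule md_li[OF assms(2,3)]) (use j in auto)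
      then show "md a (-1 - int j) (md b (-1 + int j) c) \<in> li_filtration (Suc (p + q + r))"
        by (rule md_li[OF assms(1)]) (use j in auto)
    next
      fix j
      have "md a (int j) c \<in> li_filtration (p + r - j)"
        by (rule md_li[OF assms(1,3)]) auto
      then show "md b (-2 - int j) (md a (int j) c) \<in> li_filtration (Suc (p + q + r))"
        by (rule md_li[OF assms(2)]) auto
    qed
  qed
  then show ?thesis by simp
qed

section \<open>Residues with a binomial weight\<close>

text \<open>The residue of \<open>(1 + z)\<^sup>e z\<^sup>m Y(a,z) b\<close>.\<close>

definition zmode :: "nat \<Rightarrow> int \<Rightarrow> 'v \<Rightarrow> 'v \<Rightarrow> 'v" where
  "zmode e m a b = (\<Sum>i\<le>e. of_nat (e choose i) *s md a (m + int i) b)"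

lemma zmode_0 [simp]: "zmode 0 m a b = md a m b"
  by (simp add: zmode_def)

lemma zmode_zero [simp]: "zmode e m 0 b = 0" "zmode e m a 0 = 0"
  by (simp_all add: zmode_def)

lemma zmode_add_left: "zmode e m (a + a') b = zmode e m a b + zmode e m a' b"
  and zmode_scale_left: "zmode e m (c *s a) b = c *s zmode e m a b"
  and zmode_add_right: "zmode e m a (b + b') = zmode e m a b + zmode e m a b'"
  and zmode_scale_right: "zmode e m a (c *s b) = c *s zmode e m a b"
  by (simp_all add: zmode_def md_add_left md_add_right md_scale_left md_scale_right
      scale_right_distrib sum.distrib scale_sum_right mult.commute)

lemma zmode_uminus_right: "zmode e m a (- b) = - zmode e m a b"
  using zmode_scale_right[of e m a "-1" b] by simp

lemma zmode_diff_right: "zmode e m a (b - b') = zmode e m a b - zmode e m a b'"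
  using zmode_add_right[of e m a b "- b'"] by (simp add: zmode_uminus_right)

lemma pascal_sum:
  "(\<Sum>i\<le>Suc e. of_nat (Suc e choose i) *s f i)
     = (\<Sum>i\<le>e. of_nat (e choose i) *s f i) + (\<Sum>i\<le>e. of_nat (e choose i) *s f (Suc i))"
proof -
  have "(\<Sum>i\<le>Suc e. of_nat (Suc e choose i) *s f i)
      = f 0 + (\<Sum>i\<le>e. of_nat (e choose Suc i) *s f (Suc i)) + (\<Sum>i\<le>e. of_nat (e choose i) *s f (Suc i))"
    by (subst sum.atMost_Suc_shift) (simp add: scale_left_distrib sum.distrib)
  also have "f 0 + (\<Sum>i\<le>e. of_nat (e choose Suc i) *s f (Suc i)) = (\<Sum>i\<le>Suc e. of_nat (e choose i) *s f i)"
    by (simp add: sum.atMost_Suc_shift del: sum.atMost_Suc)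
  finally show ?thesis by simp
qed

lemma zmode_Suc: "zmode (Suc e) m a b = zmode e m a b + zmode e (m + 1) a b"
  unfolding zmode_def by (simp add: pascal_sum algebra_simps del: sum.atMost_Suc binomial_Suc_Suc)

lemma zmode_exponent_add:
  "zmode (e + e') m a b = (\<Sum>i\<le>e'. of_nat (e' choose i) *s zmode e (m + int i) a b)"
proof (induction e' arbitrary: m)
  case (Suc e')
  have "zmode (e + Suc e') m a b = zmode (e + e') m a b + zmode (e + e') (m + 1) a b"
    by (simp add: zmode_Suc)
  then show ?case
    by (simp add: Suc.IH pascal_sum algebra_simps del: sum.atMost_Suc binomial_Suc_Suc)
qed simp

lemma zmode_zmode:
  "zmode e m a (zmode e' k b c)
     = (\<Sum>i\<le>e. \<Sum>i'\<le>e'. (of_nat (e choose i) * of_nat (e' choose i')) *s md a (m + int i) (md b (k + int i') c))"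
  by (simp add: zmode_def md_sum_right md_scale_right scale_sum_right)

lemma sum_choose_choose:
  "(\<Sum>i\<le>e. (of_nat (e choose i) * of_nat (i choose r)) *s f i)
     = of_nat (e choose r) *s (\<Sum>i\<le>e - r. of_nat (e - r choose i) *s f (r + i))"
proof (cases "r \<le> e")
  case True
  have "(\<Sum>i\<le>e. (of_nat (e choose i) * of_nat (i choose r)) *s f i)
      = (\<Sum>i\<in>{r..e}. (of_nat (e choose i) * of_nat (i choose r)) *s f i)"
    by (rule sum.mono_neutral_right) auto
  also have "\<dots> = (\<Sum>i\<in>{0..e - r}. (of_nat (e choose (r + i)) * of_nat ((r + i) choose r)) *s f (r + i))"
    using sum.atLeastAtMost_shift_0[OF True] by (simp add: o_def)
  also have "\<dots> = (\<Sum>i\<in>{0..e - r}. (of_nat (e choose r) * of_nat (e - r choose i)) *s f (r + i))"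
  proof (rule sum.cong[OF HOL.refl])
    fix i assume "i \<in> {0..e - r}"
    then have "(e choose (r + i)) * ((r + i) choose r) = (e choose r) * (e - r choose i)"
      using choose_mult[of r "r + i" e] True by simp
    then show "(of_nat (e choose (r + i)) * of_nat ((r + i) choose r)) *s f (r + i)
        = (of_nat (e choose r) * of_nat (e - r choose i)) *s f (r + i)"
      by (metis of_nat_mult)
  qed
  finally show ?thesis by (simp add: scale_sum_right atMost_atLeast0)
next
  case False
  then have "(of_nat (e choose i) * of_nat (i choose r)) *s f i = 0" if "i \<le> e" for i
    using that by (simp add: binomial_eq_0)
  then have "(\<Sum>i\<le>e. (of_nat (e choose i) * of_nat (i choose r)) *s f i) = 0"
    by (intro sum.neutral) simp
  then show ?thesis using False by (simp add: binomial_eq_0)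
qed

text \<open>With \<open>f x = z\<^sup>x\<close> this is the Leibniz rule for the divided derivative of order \<open>l\<close> of
  \<open>(1 + z)\<^sup>e z\<^sup>m\<close>: order \<open>k\<close> falls on the power of \<open>z\<close> and order \<open>l - k\<close> on the power of \<open>1 + z\<close>.\<close>

lemma sum_choose_gchoose:
  "(\<Sum>i\<le>e. of_nat (e choose i) *s (of_int (m + int i) gchoose l) *s f (m + int i - int l))
   = (\<Sum>k\<le>l. ((of_int m gchoose k) * of_nat (e choose (l - k))) *s
        (\<Sum>i\<le>e - (l - k). of_nat (e - (l - k) choose i) *s f (m - int k + int i)))"
proof -
  have "(of_int (m + int i) gchoose l :: complex) = (\<Sum>k\<le>l. (of_int m gchoose k) * of_nat (i choose (l - k)))" for i
    using gbinomial_Vandermonde[of "of_int m :: complex" "of_nat i" l] by (simp add: binomial_gbinomial atMost_atLeast0)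
  then have "(\<Sum>i\<le>e. of_nat (e choose i) *s (of_int (m + int i) gchoose l) *s f (m + int i - int l))
      = (\<Sum>i\<le>e. \<Sum>k\<le>l. (of_int m gchoose k) *s (of_nat (e choose i) * of_nat (i choose (l - k))) *s f (m + int i - int l))"
    by (simp add: scale_sum_left scale_sum_right mult_ac del: of_int_add)
  also have "\<dots> = (\<Sum>k\<le>l. (of_int m gchoose k) *s (\<Sum>i\<le>e. (of_nat (e choose i) * of_nat (i choose (l - k))) *s f (m + int i - int l)))"
    by (subst sum.swap) (simp only: scale_sum_right)
  also have "\<dots> = (\<Sum>k\<le>l. ((of_int m gchoose k) * of_nat (e choose (l - k))) *s
        (\<Sum>i\<le>e - (l - k). of_nat (e - (l - k) choose i) *s f (m - int k + int i)))"
  proof (rule sum.cong[OF HOL.refl])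
    fix k assume "k \<in> {..l}"
    then have shift: "m + int (l - k + i) - int l = m - int k + int i" for i by simp
    then show "(of_int m gchoose k) *s (\<Sum>i\<le>e. (of_nat (e choose i) * of_nat (i choose (l - k))) *s f (m + int i - int l))
      = ((of_int m gchoose k) * of_nat (e choose (l - k))) *s
        (\<Sum>i\<le>e - (l - k). of_nat (e - (l - k) choose i) *s f (m - int k + int i))"
      by (simp only: sum_choose_choose shift scale_scale)
  qed
  finally show ?thesis .
qed

text \<open>The Borcherds identity for \<open>m + i\<close> and \<open>k + i'\<close>, summed with the coefficients of
  \<open>(1 + z)\<^sup>e (1 + w)\<^sup>e\<^sup>'\<close>. The identities between Zhu's products below are
  derived from it.\<close>

lemma eventually_zmode_borcherds:
  "\<forall>\<^sub>F L in sequentially.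
     (\<Sum>l<L. \<Sum>k'\<le>l. ((of_int m gchoose k') * of_nat (e choose (l - k'))) *s
        zmode (e - (l - k') + e') (m + k - int k') (md a (n + int l) b) c)
   = (\<Sum>j<L. ((-1) ^ j * (of_int n gchoose j)) *s
        (zmode e (m + n - int j) a (zmode e' (k + int j) b c)
          - ((-1) powi n) *s zmode e' (n + k - int j) b (zmode e (m + int j) a c)))"
proof -
  have "\<forall>\<^sub>F L in sequentially. \<forall>i\<in>{..e}. \<forall>i'\<in>{..e'}.
     (\<Sum>l<L. (of_int (m + int i) gchoose l) *s md (md a (n + int l) b) (m + int i + (k + int i') - int l) c)
   = (\<Sum>j<L. ((-1) ^ j * (of_int n gchoose j)) *s
        (md a (m + int i + n - int j) (md b (k + int i' + int j) c)
          - ((-1) powi n) *s md b (n + (k + int i') - int j) (md a (m + int i + int j) c)))"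
    by (intro eventually_ball_finite ballI eventually_borcherds finite_atMost)
  then show ?thesis
  proof eventually_elim
    case (elim L)
    let ?C = "\<lambda>i i'. of_nat (e choose i) * of_nat (e' choose i') :: complex"
    let ?u = "\<lambda>l x. md (md a (n + int l) b) x c"
    have "(\<Sum>l<L. \<Sum>k'\<le>l. ((of_int m gchoose k') * of_nat (e choose (l - k'))) *s
        zmode (e - (l - k') + e') (m + k - int k') (md a (n + int l) b) c)
      = (\<Sum>l<L. \<Sum>i'\<le>e'. of_nat (e' choose i') *s (\<Sum>k'\<le>l. ((of_int m gchoose k') * of_nat (e choose (l - k'))) *s
        (\<Sum>i\<le>e - (l - k'). of_nat (e - (l - k') choose i) *s ?u l (m - int k' + int i + (k + int i')))))"
      unfolding zmode_exponent_add scale_sum_right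
      by (subst (2) sum.swap) (simp add: zmode_def scale_sum_right algebra_simps)
    also have "\<dots> = (\<Sum>l<L. \<Sum>i'\<le>e'. of_nat (e' choose i') *s
        (\<Sum>i\<le>e. of_nat (e choose i) *s (of_int (m + int i) gchoose l) *s ?u l (m + int i - int l + (k + int i'))))"
      by (intro sum.cong[OF HOL.refl])
        (simp only: sum_choose_gchoose[where f = "\<lambda>x. md (md a (n + int l) b) (x + (k + int i')) c" for l i'])
    also have "\<dots> = (\<Sum>i\<le>e. \<Sum>i'\<le>e'. ?C i i' *s (\<Sum>l<L. (of_int (m + int i) gchoose l) *s ?u l (m + int i + (k + int i') - int l)))"
      unfolding scale_sum_right
      by (subst (2) sum.swap, subst sum.swap, subst (2) sum.swap) (simp add: algebra_simps del: of_int_add)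
    also have "\<dots> = (\<Sum>i\<le>e. \<Sum>i'\<le>e'. ?C i i' *s (\<Sum>j<L. ((-1) ^ j * (of_int n gchoose j)) *s
        (md a (m + int i + n - int j) (md b (k + int i' + int j) c)
          - ((-1) powi n) *s md b (n + (k + int i') - int j) (md a (m + int i + int j) c))))"
      using elim by (intro sum.cong[OF HOL.refl]) simp
    also have "\<dots> = (\<Sum>j<L. \<Sum>i\<le>e. \<Sum>i'\<le>e'. ?C i i' *s ((-1) ^ j * (of_int n gchoose j)) *s
        (md a (m + int i + n - int j) (md b (k + int i' + int j) c)
          - ((-1) powi n) *s md b (n + (k + int i') - int j) (md a (m + int i + int j) c)))"
      unfolding scale_sum_right
      by (subst (2) sum.swap, subst sum.swap) (rule HOL.refl)
    also have "\<dots> = (\<Sum>j<L. ((-1) ^ j * (of_int n gchoose j)) *s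
        (zmode e (m + n - int j) a (zmode e' (k + int j) b c)
          - ((-1) powi n) *s zmode e' (n + k - int j) b (zmode e (m + int j) a c)))"
    proof (rule sum.cong[OF HOL.refl])
      fix j
      have "zmode e' (n + k - int j) b (zmode e (m + int j) a c)
        = (\<Sum>i\<le>e. \<Sum>i'\<le>e'. ?C i i' *s md b (n + (k + int i') - int j) (md a (m + int i + int j) c))"
        unfolding zmode_zmode by (subst sum.swap) (simp add: algebra_simps)
      moreover have "zmode e (m + n - int j) a (zmode e' (k + int j) b c)
        = (\<Sum>i\<le>e. \<Sum>i'\<le>e'. ?C i i' *s md a (m + int i + n - int j) (md b (k + int i' + int j) c))"
        unfolding zmode_zmode by (simp add: algebra_simps)
      ultimately show "(\<Sum>i\<le>e. \<Sum>i'\<le>e'. ?C i i' *s ((-1) ^ j * (of_int n gchoose j)) *s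
          (md a (m + int i + n - int j) (md b (k + int i' + int j) c)
            - ((-1) powi n) *s md b (n + (k + int i') - int j) (md a (m + int i + int j) c)))
        = ((-1) ^ j * (of_int n gchoose j)) *s
          (zmode e (m + n - int j) a (zmode e' (k + int j) b c)
          - ((-1) powi n) *s zmode e' (n + k - int j) b (zmode e (m + int j) a c))"
        by (simp add: scale_sum_right scale_right_diff_distrib sum_subtractf mult_ac)
    qed
    finally show ?case .
  qed
qed

text \<open>If \<open>a\<close> has degree \<open>e\<close>, the components \<open>a\<^sub>(\<^sub>n\<^sub>+\<^sub>l\<^sub>) b\<close> of \<open>a * b\<close> or \<open>a \<circ> b\<close> have a degree that drops
  with \<open>l\<close> as the exponent \<open>e - l + e'\<close> does. For the right \<open>e'\<close> the left-hand side is therefore Zhu's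
  product of \<open>a * b\<close> or \<open>a \<circ> b\<close> with \<open>c\<close>.\<close>

lemma eventually_zmode_iterate:
  "\<forall>\<^sub>F L in sequentially.
     (\<Sum>l\<le>e. of_nat (e choose l) *s zmode (e - l + e') k (md a (n + int l) b) c)
   = (\<Sum>j<L. ((-1) ^ j * (of_int n gchoose j)) *s
        (zmode e (n - int j) a (zmode e' (k + int j) b c)
          - ((-1) powi n) *s zmode e' (n + k - int j) b (zmode e (int j) a c)))"
  using eventually_zmode_borcherds[of 0 e e' k a n b c] eventually_gt_at_top[of e]
proof eventually_elim
  case (elim L)
  let ?z = "\<lambda>l. zmode (e - l + e') k (md a (n + int l) b) c"
  have "(\<Sum>l\<le>e. of_nat (e choose l) *s ?z l) = (\<Sum>l<L. of_nat (e choose l) *s ?z l)"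
    by (rule sum.mono_neutral_left) (use elim(2) in \<open>auto simp: binomial_eq_0\<close>)
  also have "\<dots> = (\<Sum>l<L. \<Sum>k'\<le>l. ((of_int 0 gchoose k') * of_nat (e choose (l - k'))) *s
      zmode (e - (l - k') + e') (0 + k - int k') (md a (n + int l) b) c)"
  proof (rule sum.cong[OF HOL.refl])
    fix l
    show "of_nat (e choose l) *s ?z l = (\<Sum>k'\<le>l. ((of_int 0 gchoose k') * of_nat (e choose (l - k'))) *s
      zmode (e - (l - k') + e') (0 + k - int k') (md a (n + int l) b) c)"
      by (subst sum.remove[of _ 0]) (simp_all add: gbinomial_0_left)
  qed
  finally show ?case using elim(1) by simp
qed

text \<open>Integration by parts, as \<open>Y(T a,z)\<close> is the derivative of \<open>Y(a,z)\<close>.\<close>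

lemma zmode_translation:
  "zmode (Suc e) m (translation a) b
     = - (of_int m *s zmode (Suc e) (m - 1) a b + of_nat (Suc e) *s zmode e m a b)"
proof -
  have "(\<Sum>i\<le>Suc e. of_nat (Suc e choose i) *s of_int (- (m + int i)) *s md a (m + int i - 1) b)
    = - (\<Sum>i\<le>Suc e. of_int m *s of_nat (Suc e choose i) *s md a (m - 1 + int i) b)
      - (\<Sum>i\<le>Suc e. of_nat (i * (Suc e choose i)) *s md a (m + int i - 1) b)"
    unfolding sum_negf[symmetric] sum_subtractf[symmetric]
    by (rule sum.cong[OF HOL.refl])
      (simp add: algebra_simps flip: scale_left_distrib scale_left_diff_distrib scale_minus_left)
  also have "(\<Sum>i\<le>Suc e. of_nat (i * (Suc e choose i)) *s md a (m + int i - 1) b)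
     = (\<Sum>i\<le>e. of_nat (Suc i * (Suc e choose Suc i)) *s md a (m + int i) b)"
    by (subst sum.atMost_Suc_shift) (simp add: algebra_simps del: binomial_Suc_Suc)
  also have "\<dots> = of_nat (Suc e) *s zmode e m a b"
    unfolding Suc_times_binomial by (simp only: zmode_def scale_sum_right of_nat_mult scale_scale)
  finally show ?thesis
    by (simp add: zmode_def md_translation scale_sum_right del: sum.atMost_Suc of_int_minus of_int_add binomial_Suc_Suc of_nat_Suc)
qed

section \<open>The \<open>C\<^sub>2\<close>-algebra and the associated graded algebra of the Li filtration\<close>

lemma with_product_image: "algebra_image scale (with_product m) id m"
  by unfold_locales (simp_all add: with_product_def)

definition vcoset :: "'v set \<Rightarrow> 'v \<Rightarrow> 'v set" where
  "vcoset K a = (\<lambda>k. k + a) ` K"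

lemma coset_id: "algebra_image.coset id K a = vcoset K a"
  using algebra_image.coset_def[OF with_product_image] by (simp add: vcoset_def)

lemmas vcoset_add = algebra_image.coset_add[OF with_product_image, unfolded coset_id]
  and vcoset_eqI = algebra_image.coset_eqI[OF with_product_image, unfolded coset_id]
  and vcoset_self = algebra_image.coset_self[OF with_product_image, unfolded coset_id, simplified]
  and a_coset_vcoset = algebra_image.a_coset_image[OF with_product_image, unfolded coset_id, simplified]
  and UN_vcoset = algebra_image.UN_coset[OF with_product_image, unfolded coset_id, simplified]
  and vcoset_mult = algebra_image.coset_mult[OF with_product_image, unfolded coset_id, simplified]
  and vcoset_smult = algebra_image.coset_smult[OF with_product_image, unfolded coset_id, simplified]
  and gr_vcoset_mult = algebra_image.gr_alg_mult[OF with_product_image, unfolded coset_id, simplified]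
  and gr_vcoset_smult = algebra_image.gr_alg_smult[OF with_product_image, unfolded coset_id, simplified]
  and gr_vcoset_add = algebra_image.gr_alg_add[OF with_product_image, unfolded coset_id, simplified]
  and quot_vcoset_carrier = algebra_image.quot_alg_carrier[OF with_product_image, unfolded coset_id, simplified]

lemma vcoset_zero: "vcoset K 0 = K"
  by (simp add: vcoset_def)

lemma vcoset_mem: "x \<in> vcoset K a \<longleftrightarrow> x - a \<in> K"
  by (force simp: vcoset_def)

lemma vcoset_eq_iff: "subspace K \<Longrightarrow> vcoset K a = vcoset K b \<longleftrightarrow> a - b \<in> K"
  using vcoset_eqI vcoset_self[of K a] vcoset_mem[of a K b] by auto

lemma C2_carrier: "carrier C2_algebra = range (vcoset (li_filtration 1))"
  by (simp add: C2_algebra_def quot_vcoset_carrier)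

text \<open>The product on \<open>gr V\<close> does not depend on representatives.\<close>

lemma normal_product_perturb:
  assumes "a \<in> li_filtration p" "b \<in> li_filtration q" "k \<in> li_filtration (Suc p)" "l \<in> li_filtration (Suc q)"
  shows "md (k + a) (-1) (l + b) - md a (-1) b \<in> li_filtration (Suc (p + q))"
proof -
  have "md (k + a) (-1) (l + b) - md a (-1) b = md k (-1) (l + b) + md a (-1) l"
    by (simp add: md_add_left md_add_right)
  moreover have "md k (-1) (l + b) \<in> li_filtration (Suc p + q)"
    by (intro normal_product_li assms subspace_add[OF subspace_li] li_antimono[OF _ assms(4)]) simp
  moreover have "md a (-1) l \<in> li_filtration (p + Suc q)"
    by (intro normal_product_li assms)
  ultimately show ?thesis by (simp add: subspace_add)
qed

lemma C2_ops:
  "vcoset (li_filtration 1) a \<oplus>\<^bsub>C2_algebra\<^esub> vcoset (li_filtration 1) b = vcoset (li_filtration 1) (a + b)"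
  "vcoset (li_filtration 1) a \<otimes>\<^bsub>C2_algebra\<^esub> vcoset (li_filtration 1) b = vcoset (li_filtration 1) (md a (-1) b)"
  "k \<odot>\<^bsub>C2_algebra\<^esub> vcoset (li_filtration 1) a = vcoset (li_filtration 1) (k *s a)"
  "\<one>\<^bsub>C2_algebra\<^esub> = vcoset (li_filtration 1) vac"
proof -
  have "rcoset_mult normal_product (li_filtration 1) (vcoset (li_filtration 1) a) (vcoset (li_filtration 1) b)
     = vcoset (li_filtration 1) (md a (-1) b)"
    by (rule vcoset_mult) (use normal_product_perturb[of a 0 b 0] in simp_all)
  then show "vcoset (li_filtration 1) a \<otimes>\<^bsub>C2_algebra\<^esub> vcoset (li_filtration 1) b = vcoset (li_filtration 1) (md a (-1) b)"
    by (simp add: C2_algebra_def quot_alg_def)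
  have "\<one>\<^bsub>normal_product\<^esub> = vac" by (simp add: with_product_def)
  then show "\<one>\<^bsub>C2_algebra\<^esub> = vcoset (li_filtration 1) vac"
    by (simp add: C2_algebra_def quot_alg_def a_coset_vcoset)
qed (simp_all add: C2_algebra_def quot_alg_def vcoset_add vcoset_smult)

lemma gr_li_mult:
  assumes "\<And>p. x p \<in> li_filtration p" "\<And>p. y p \<in> li_filtration p"
  shows "((\<lambda>p. vcoset (li_filtration (Suc p)) (x p)) \<otimes>\<^bsub>gr_li\<^esub> (\<lambda>p. vcoset (li_filtration (Suc p)) (y p)))
     = (\<lambda>n. vcoset (li_filtration (Suc n)) (\<Sum>p\<le>n. md (x p) (-1) (y (n - p))))"
proof
  fix n
  have "(monoid.mult (gr_alg normal_product li_filtration (\<lambda>n. li_filtration (Suc n)))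
      (\<lambda>p. vcoset (li_filtration (Suc p)) (x p)) (\<lambda>p. vcoset (li_filtration (Suc p)) (y p))) n
    = vcoset (li_filtration (Suc n)) (\<Sum>p\<le>n. md (x p) (-1) (y (n - p)))"
  proof (rule gr_vcoset_mult)
    fix p k1 k2 assume "p \<le> n" "k1 \<in> li_filtration (Suc p)" "k2 \<in> li_filtration (Suc (n - p))"
    then show "md (k1 + x p) (-1) (k2 + y (n - p)) - md (x p) (-1) (y (n - p)) \<in> li_filtration (Suc n)"
      using normal_product_perturb[OF assms(1)[of p] assms(2)[of "n - p"], of k1 k2] by simp
  qed simp
  then show "((\<lambda>p. vcoset (li_filtration (Suc p)) (x p)) \<otimes>\<^bsub>gr_li\<^esub> (\<lambda>p. vcoset (li_filtration (Suc p)) (y p))) n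
     = vcoset (li_filtration (Suc n)) (\<Sum>p\<le>n. md (x p) (-1) (y (n - p)))"
    by (simp add: gr_li_def module.defs)
qed

lemma gr_li_add:
  "((\<lambda>p. vcoset (li_filtration (Suc p)) (x p)) \<oplus>\<^bsub>gr_li\<^esub> (\<lambda>p. vcoset (li_filtration (Suc p)) (y p)))
     = (\<lambda>p. vcoset (li_filtration (Suc p)) (x p + y p))"
  using gr_vcoset_add[of "\<lambda>p. li_filtration (Suc p)" "\<lambda>a b. md a (-1) b" li_filtration x y]
  by (auto simp: gr_li_def module.defs)

lemma gr_li_smult:
  "k \<odot>\<^bsub>gr_li\<^esub> (\<lambda>p. vcoset (li_filtration (Suc p)) (x p)) = (\<lambda>p. vcoset (li_filtration (Suc p)) (k *s x p))"
  using gr_vcoset_smult[of "\<lambda>p. li_filtration (Suc p)" "\<lambda>a b. md a (-1) b" li_filtration k x]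
  by (auto simp: gr_li_def module.defs)

lemma gr_li_one: "\<one>\<^bsub>gr_li\<^esub> = (\<lambda>p. vcoset (li_filtration (Suc p)) (if p = 0 then vac else 0))"
proof -
  have "\<one>\<^bsub>normal_product\<^esub> = vac" by (simp add: with_product_def)
  then show ?thesis
    by (intro ext) (simp add: gr_li_def module.defs gr_alg_def a_coset_vcoset vcoset_zero)
qed

lemma translation_linear: "translation (a + b) = translation a + translation b"
  "translation (c *s a) = c *s translation a" "translation 0 = 0"
  by (simp_all add: translation_def md_add_left md_scale_left)

lemma translation_diff: "translation (a - b) = translation a - translation b"
  by (simp add: translation_def md_diff_left)

lemma gr_li_der:
  "\<partial>\<^bsub>gr_li\<^esub> (\<lambda>p. vcoset (li_filtration (Suc p)) (x p))
     = (\<lambda>p. vcoset (li_filtration (Suc p)) (case p of 0 \<Rightarrow> 0 | Suc q \<Rightarrow> translation (x q)))"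
proof
  fix p
  have "(\<Union>a\<in>vcoset (li_filtration (Suc q)) (x q). li_filtration (Suc (Suc q)) +>\<^bsub>normal_product\<^esub> translation a)
     = vcoset (li_filtration (Suc (Suc q))) (translation (x q))" for q
    by (rule UN_vcoset) (auto simp: a_coset_vcoset translation_linear intro!: vcoset_eqI translation_li)
  then show "(\<partial>\<^bsub>gr_li\<^esub> (\<lambda>p. vcoset (li_filtration (Suc p)) (x p))) p
     = vcoset (li_filtration (Suc p)) (case p of 0 \<Rightarrow> 0 | Suc q \<Rightarrow> translation (x q))"
    by (auto simp: gr_li_def module.defs diff_alg.defs vcoset_zero split: nat.split)
qed

lemma gr_li_carrierI:
  assumes "a \<in> li_filtration i"
  shows "(\<lambda>p. vcoset (li_filtration (Suc p)) (if p = i then a else 0)) \<in> carrier gr_li"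
proof -
  have "finite {p. vcoset (li_filtration (Suc p)) (if p = i then a else 0) \<noteq> li_filtration (Suc p)}"
    by (rule finite_subset[of _ "{i}"]) (auto simp: vcoset_zero)
  moreover have "vcoset (li_filtration (Suc p)) (if p = i then a else 0) \<in> vcoset (li_filtration (Suc p)) ` li_filtration p" for p
    using assms by (intro imageI) (auto simp: subspace_0)
  ultimately show ?thesis
    by (simp add: gr_li_def module.defs gr_alg_def a_coset_vcoset)
qed

end

context graded_vertex_algebra
begin

section \<open>Homogeneous components\<close>

lemma H_add: "H (v + w) = H v + H w" and H_scale: "H (c *s v) = c *s H v"
  using H_linear by (auto simp: Vector_Spaces.linear_iff)

lemma H_sum: "H (sum f S) = (\<Sum>i\<in>S. H (f i))"
  using H_scale[of 0 0]
  by (induction S rule: infinite_finite_induct) (simp_all add: H_add)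

lemma subspace_homogeneous [simp]: "subspace (homogeneous n)"
  by (auto simp: subspace_def homogeneous_def H_add H_scale scale_right_distrib scale_left_commute
      intro: H_scale[of 0 0, simplified])

text \<open>Applying \<open>H - \<mu> m\<close> to a relation removes the vector \<open>f m\<close> from it.\<close>

lemma eigenvectors_independent:
  assumes "finite S" "inj_on \<mu> S" "\<And>i. i \<in> S \<Longrightarrow> H (f i) = \<mu> i *s f i" "sum f S = 0" "i \<in> S"
  shows "f i = 0"
  using assms
proof (induction S arbitrary: f i rule: finite_induct)
  case (insert m S)
  have "(\<Sum>j\<in>S. (\<mu> j - \<mu> m) *s f j) = (\<Sum>j\<in>insert m S. \<mu> j *s f j - \<mu> m *s f j)"
    using insert.hyps by (simp add: scale_left_diff_distrib)
  also have "\<dots> = (\<Sum>j\<in>insert m S. \<mu> j *s f j) - \<mu> m *s sum f (insert m S)"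
    by (simp only: sum_subtractf scale_sum_right)
  also have "(\<Sum>j\<in>insert m S. \<mu> j *s f j) = H (sum f (insert m S))"
    unfolding H_sum by (rule sum.cong) (simp_all add: insert.prems(2))
  also have "\<dots> = 0"
    unfolding insert.prems(3) using H_scale[of 0 0] by simp
  finally have "(\<mu> j - \<mu> m) *s f j = 0" if "j \<in> S" for j
    using insert.IH[of "\<lambda>j. (\<mu> j - \<mu> m) *s f j" j] insert.prems that
    by (simp add: H_scale scale_left_commute)
  then have *: "f j = 0" if "j \<in> S" for j
    using that insert.prems(1) insert.hyps(2) by (auto simp: inj_on_def scale_eq_0_iff)
  then have "f m = 0" using insert by simp
  then show ?case using * insert.prems(4) by auto
qed simp

lemma homogeneous_induct [case_names homogeneous zero add]:
  assumes "\<And>k v. v \<in> homogeneous k \<Longrightarrow> P v" "P 0" "\<And>v w. P v \<Longrightarrow> P w \<Longrightarrow> P (v + w)"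
  shows "P v"
proof -
  have "v \<in> span (\<Union>n. homogeneous n)"
    using H_diagonalizable by (simp add: homogeneous_def)
  then show ?thesis
  proof (induction rule: span_induct_alt)
    case (step c x y)
    then obtain k where "c *s x \<in> homogeneous k"
      by (auto intro: subspace_scale[OF subspace_homogeneous])
    then show ?case using assms(1,3) step by blast
  qed (fact assms(2))
qed

definition decomposes :: "(nat \<Rightarrow> 'v) \<Rightarrow> 'v \<Rightarrow> bool" where
  "decomposes f v \<longleftrightarrow> (\<forall>i. f i \<in> homogeneous i) \<and> finite {i. f i \<noteq> 0} \<and> v = Sum_any f"

lemma decomposes_add:
  assumes f: "decomposes f v" and g: "decomposes g w"
  shows "decomposes (\<lambda>i. f i + g i) (v + w)"
proof -
  have "finite {i. f i + g i \<noteq> 0}"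
    by (rule finite_subset[of _ "{i. f i \<noteq> 0} \<union> {i. g i \<noteq> 0}"])
      (use f g in \<open>auto simp: decomposes_def\<close>)
  then show ?thesis
    using f g by (simp add: decomposes_def Sum_any.distrib subspace_add[OF subspace_homogeneous])
qed

lemma decomposes_scale:
  assumes f: "decomposes f v"
  shows "decomposes (\<lambda>i. c *s f i) (c *s v)"
proof -
  have "Sum_any (\<lambda>i. c *s f i) = (\<Sum>i\<in>{i. f i \<noteq> 0}. c *s f i)"
    by (rule Sum_any.expand_superset) (use f in \<open>auto simp: decomposes_def\<close>)
  also have "\<dots> = c *s Sum_any f"
    by (simp add: Sum_any.expand_set scale_sum_right)
  finally have "c *s v = Sum_any (\<lambda>i. c *s f i)"
    using f by (simp add: decomposes_def)
  moreover have "finite {i. c *s f i \<noteq> 0}"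
    by (rule finite_subset[of _ "{i. f i \<noteq> 0}"]) (use f in \<open>auto simp: decomposes_def\<close>)
  ultimately show ?thesis
    using f by (simp add: decomposes_def subspace_scale[OF subspace_homogeneous])
qed

lemma decomposes_homogeneous: "v \<in> homogeneous k \<Longrightarrow> decomposes (\<lambda>i. if i = k then v else 0) v"
  by (auto simp: decomposes_def subspace_0)

lemma decomposes_unique:
  assumes f: "decomposes f v" and g: "decomposes g v"
  shows "f = g"
proof
  fix n
  let ?h = "\<lambda>i. f i - g i"
  have h: "decomposes ?h 0"
    using decomposes_add[OF f decomposes_scale[OF g, of "-1"]] by (simp add: scale_minus_left)
  have "?h n = 0"
  proof (rule eigenvectors_independent[where S = "insert n {i. ?h i \<noteq> 0}" and \<mu> = of_nat])
    show "sum ?h (insert n {i. ?h i \<noteq> 0}) = 0"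
      using h unfolding decomposes_def
      by (subst Sum_any.expand_superset[symmetric]) auto
  qed (use h in \<open>auto simp: decomposes_def homogeneous_def\<close>)
  then show "f n = g n" by simp
qed

lemma decomposes_exists: "\<exists>f. decomposes f v"
proof (induction v rule: homogeneous_induct)
  case zero
  then show ?case using decomposes_homogeneous[of 0] subspace_0 by auto
next
  case (homogeneous k v)
  then show ?case using decomposes_homogeneous by blast
next
  case (add v w)
  then show ?case using decomposes_add by blast
qed

lemma component_eqI: "decomposes f v \<Longrightarrow> component n v = f n"
proof -
  assume f: "decomposes f v"
  have "(THE f. (\<forall>i. f i \<in> homogeneous i) \<and> finite {i. f i \<noteq> 0} \<and> v = Sum_any f) = f"
    unfolding decomposes_def[symmetric] using f decomposes_unique by blast
  then show ?thesis by (simp add: component_def)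
qed

lemma decomposes_component: "decomposes (\<lambda>n. component n v) v"
proof -
  obtain f where f: "decomposes f v" using decomposes_exists by blast
  then have "(\<lambda>n. component n v) = f" using component_eqI by blast
  then show ?thesis using f by simp
qed

lemma component_in [simp]: "component n v \<in> homogeneous n"
  using decomposes_component by (simp add: decomposes_def)

lemma component_add: "component n (v + w) = component n v + component n w"
  by (rule component_eqI[OF decomposes_add[OF decomposes_component decomposes_component]])

lemma component_scale: "component n (c *s v) = c *s component n v"
  by (rule component_eqI[OF decomposes_scale[OF decomposes_component]])

lemma component_homogeneous: "v \<in> homogeneous k \<Longrightarrow> component n v = (if n = k then v else 0)"
  by (rule component_eqI[OF decomposes_homogeneous])

lemma component_zero [simp]: "component n 0 = 0"
  using component_scale[of n 0 0] by simp

lemma component_uminus: "component n (- v) = - component n v"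
  using component_scale[of n "-1" v] by simp

lemma component_diff: "component n (v - w) = component n v - component n w"
  using component_add[of n v "- w"] by (simp add: component_uminus)

lemma component_sum: "component n (sum f S) = (\<Sum>i\<in>S. component n (f i))"
  by (induction S rule: infinite_finite_induct) (simp_all add: component_add)

lemma component_component: "component n (component k v) = (if n = k then component k v else 0)"
  by (simp add: component_homogeneous)

lemma component_bound:
  obtains L where "\<And>k. k \<ge> L \<Longrightarrow> component k v = 0" "v = (\<Sum>k<L. component k v)"
proof -
  have "finite {i. component i v \<noteq> 0}" using decomposes_component by (simp add: decomposes_def)
  then obtain L where L: "\<And>k. component k v \<noteq> 0 \<Longrightarrow> k < L"
    unfolding finite_nat_set_iff_bounded by auto
  then have z: "\<And>k. k \<ge> L \<Longrightarrow> component k v = 0" by (meson leD)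
  have "v = Sum_any (\<lambda>k. component k v)" using decomposes_component by (simp add: decomposes_def)
  also have "\<dots> = (\<Sum>k<L. component k v)" by (rule Sum_any_eq_sum_lessThan[OF z])
  finally show thesis using z that by blast
qed

lemma in_span_of_components:
  assumes "subspace W" "\<And>k. component k v \<in> W"
  shows "v \<in> W"
proof -
  obtain L where "v = (\<Sum>k<L. component k v)" by (rule component_bound)
  moreover have "(\<Sum>k<L. component k v) \<in> W" by (intro subspace_sum assms)
  ultimately show ?thesis by simp
qed

lemma V_less_iff: "v \<in> V_less n \<longleftrightarrow> (\<forall>k\<ge>n. component k v = 0)"
proof
  assume "v \<in> V_less n"
  then show "\<forall>k\<ge>n. component k v = 0"
    unfolding V_less_def
  proof (rule span_induct)
    show "subspace {v. \<forall>k\<ge>n. component k v = 0}"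
      by (auto simp: subspace_def component_add component_scale)
  qed (auto simp: component_homogeneous)
next
  assume v: "\<forall>k\<ge>n. component k v = 0"
  show "v \<in> V_less n"
  proof (rule in_span_of_components)
    show "component k v \<in> V_less n" for k
    proof (cases "k < n")
      case True
      then show ?thesis unfolding V_less_def by (intro span_base UN_I[of k]) auto
    qed (use v in \<open>simp add: V_less_def span_zero\<close>)
  qed (simp add: V_less_def)
qed

lemma V_le_eq: "V_le n = V_less (Suc n)"
  by (simp add: V_le_def V_less_def lessThan_Suc_atMost)

lemma V_le_iff: "v \<in> V_le n \<longleftrightarrow> (\<forall>k>n. component k v = 0)"
  by (simp add: V_le_eq V_less_iff Suc_le_eq)

lemma subspace_V_less [simp]: "subspace (V_less n)" and subspace_V_le [simp]: "subspace (V_le n)"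
  by (simp_all add: V_less_def V_le_def)

lemma vac_homogeneous: "vac \<in> homogeneous 0"
proof -
  have "H (md vac (-1) vac) - md vac (-1) (H vac) = of_int 0 *s md vac (-1) vac + md (H vac) (-1) vac"
    using H_commutator[of vac "-1" vac] by simp
  then show ?thesis by (simp add: homogeneous_def vac_left vac_right)
qed

lemma H_md:
  assumes "a \<in> homogeneous k" "b \<in> homogeneous l"
  shows "H (md a n b) = of_int (int k + int l - n - 1) *s md a n b"
proof -
  have "H (md a n b) = of_int (- n - 1) *s md a n b + md (of_nat k *s a) n b + md a n (of_nat l *s b)"
    using H_commutator[of a n b] assms by (simp add: homogeneous_def algebra_simps)
  also have "\<dots> = of_int (int k + int l - n - 1) *s md a n b"
    by (simp add: md_scale_left md_scale_right algebra_simps)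
  finally show ?thesis .
qed

lemma md_homogeneous:
  assumes "a \<in> homogeneous k" "b \<in> homogeneous l" "int N = int k + int l - n - 1"
  shows "md a n b \<in> homogeneous N"
  using H_md[OF assms(1,2), of n] by (simp add: homogeneous_def flip: assms(3))

text \<open>The vector would be an eigenvector of \<open>H\<close> for a negative integer, but \<open>H\<close> is diagonalizable with
  eigenvalues in \<open>\<nat>\<close>.\<close>

lemma md_negative_degree:
  assumes "a \<in> homogeneous k" "b \<in> homogeneous l" "int k + int l - n - 1 < 0"
  shows "md a n b = 0"
proof -
  let ?v = "md a n b" and ?m = "int k + int l - n - 1"
  obtain L where L: "?v = (\<Sum>i<L. component i ?v)" by (rule component_bound)
  have "(of_nat i - of_int ?m) *s component i ?v = 0" if "i < L" for i
  proof (rule eigenvectors_independent[where S = "{..<L}" and \<mu> = "of_nat" and f = "\<lambda>i. (of_nat i - of_int ?m) *s component i ?v"])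
    have "(\<Sum>i<L. (of_nat i - of_int ?m) *s component i ?v) = H (\<Sum>i<L. component i ?v) - of_int ?m *s (\<Sum>i<L. component i ?v)"
      using component_in[of _ ?v]
      by (simp add: H_sum homogeneous_def scale_left_diff_distrib sum_subtractf scale_sum_right del: of_int_diff of_int_add)
    also have "\<dots> = 0" unfolding L[symmetric] by (simp only: H_md[OF assms(1,2)] diff_self)
    finally show "(\<Sum>i<L. (of_nat i - of_int ?m) *s component i ?v) = 0" .
    show "H ((of_nat i - of_int ?m) *s component i ?v) = of_nat i *s ((of_nat i - of_int ?m) *s component i ?v)" for i
      using component_in[of i ?v] by (simp add: H_scale homogeneous_def mult.commute del: of_int_diff of_int_add)
  qed (use that in \<open>auto simp: inj_on_def\<close>)
  moreover have "(of_nat i - of_int ?m :: complex) \<noteq> 0" for i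
    using assms(3) by (metis eq_iff_diff_eq_0 of_int_eq_iff of_int_of_nat_eq of_nat_less_0_iff)
  ultimately have "component i ?v = 0" if "i < L" for i
    using that by (metis scale_eq_0_iff)
  then show ?thesis using L by simp
qed

lemma component_md:
  "component N (md a (- int m - 1) b) =
     (if N < m then 0 else \<Sum>k\<le>N - m. md (component k a) (- int m - 1) (component (N - m - k) b))"
proof (induction a rule: homogeneous_induct)
  case (homogeneous i a)
  show ?case
  proof (induction b rule: homogeneous_induct)
    case (homogeneous j b)
    have "md a (- int m - 1) b \<in> homogeneous (i + j + m)"
      by (rule md_homogeneous[OF \<open>a \<in> homogeneous i\<close> homogeneous]) simp
    then have l: "component N (md a (- int m - 1) b) = (if N = i + j + m then md a (- int m - 1) b else 0)"
      by (rule component_homogeneous)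
    have "(\<Sum>k\<le>N - m. md (component k a) (- int m - 1) (component (N - m - k) b))
        = (\<Sum>k\<le>N - m. if k = i then md a (- int m - 1) (component (N - m - i) b) else 0)"
      by (intro sum.cong) (auto simp: component_homogeneous[OF \<open>a \<in> homogeneous i\<close>])
    also have "\<dots> = (if i \<le> N - m \<and> N - m - i = j then md a (- int m - 1) b else 0)"
      by (simp add: component_homogeneous[OF homogeneous])
    finally show ?case unfolding l by auto
  qed (simp_all add: md_add_right component_add sum.distrib)
qed (simp_all add: md_add_left component_add sum.distrib)

lemma component_normal_product:
  "component N (md a (-1) b) = (\<Sum>k\<le>N. md (component k a) (-1) (component (N - k) b))"
  using component_md[of N a 0 b] by simp

text \<open>The formula for the components of \<open>a\<^sub>(\<^sub>-\<^sub>m\<^sub>-\<^sub>1\<^sub>) v\<close> raises both the Li degree and the lowest possible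
  degree by \<open>m\<close>.\<close>

lemma component_monomial_li:
  "component N (monomial xs) \<in> li_filtration (sum_list (map snd xs))"
  "N < sum_list (map snd xs) \<Longrightarrow> component N (monomial xs) = 0"
proof (induction xs arbitrary: N)
  case (Cons x xs)
  obtain a m where x: "x = (a, m)" by force
  {
    case 1
    show ?case unfolding x using md_neg_li[OF Cons.IH(1)]
      by (auto simp: component_md subspace_0 add.commute intro!: li_sum)
  next
    case 2
    then show ?case unfolding x using Cons.IH(2) by (auto simp: component_md intro!: sum.neutral)
  }
qed simp_all

lemma component_li: "v \<in> li_filtration p \<Longrightarrow> component N v \<in> li_filtration p"
  unfolding li_filtration_def[of p]
proof (erule span_induct)
  show "subspace {v. component N v \<in> span {monomial xs |xs. p \<le> sum_list (map snd xs)}}"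
    by (auto simp: subspace_def component_add component_scale span_add span_scale span_zero)
qed (use component_monomial_li(1) in \<open>fold li_filtration_def, blast intro: li_antimono\<close>)

text \<open>The Li filtration is thus finite in each degree, so that descending along it terminates.\<close>

lemma component_li_eq_0: "v \<in> li_filtration p \<Longrightarrow> N < p \<Longrightarrow> component N v = 0"
  unfolding li_filtration_def[of p]
proof (erule span_induct)
  show "subspace {v. component N v = 0}"
    by (auto simp: subspace_def component_add component_scale)
qed (use component_monomial_li(2) in auto)

section \<open>Zhu's products and their leading terms\<close>

lemma eventually_component_zero: "\<forall>\<^sub>F L in sequentially. \<forall>d\<ge>L. component d a = 0"
proof -
  obtain L where "\<And>d. d \<ge> L \<Longrightarrow> component d a = 0" by (rule component_bound) blast
  then have "\<forall>d\<ge>K. component d a = 0" if "K \<ge> L" for K using that by auto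
  then show ?thesis by (rule eventually_sequentiallyI)
qed

lemma eventually_zhu_residue:
  "\<forall>\<^sub>F L in sequentially. zhu_residue k a b = (\<Sum>d<L. zmode d (- int k) (component d a) b)"
  using eventually_component_zero[of a]
proof eventually_elim
  case (elim L)
  have "zhu_residue k a b = Sum_any (\<lambda>d. zmode d (- int k) (component d a) b)"
    by (simp add: zhu_residue_def zmode_def)
  also have "\<dots> = (\<Sum>d<L. zmode d (- int k) (component d a) b)"
    by (rule Sum_any_eq_sum_lessThan) (use elim in auto)
  finally show ?case .
qed

lemma zhu_residue_add_left: "zhu_residue k (a + a') b = zhu_residue k a b + zhu_residue k a' b"
proof -
  have "\<forall>\<^sub>F L in sequentially. zhu_residue k (a + a') b = zhu_residue k a b + zhu_residue k a' b"
    using eventually_zhu_residue[of k a b] eventually_zhu_residue[of k a' b] eventually_zhu_residue[of k "a + a'" b]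
    by eventually_elim (simp add: component_add zmode_add_left sum.distrib)
  then show ?thesis by simp
qed

lemma zhu_residue_scale_left: "zhu_residue k (c *s a) b = c *s zhu_residue k a b"
proof -
  have "\<forall>\<^sub>F L in sequentially. zhu_residue k (c *s a) b = c *s zhu_residue k a b"
    using eventually_zhu_residue[of k a b] eventually_zhu_residue[of k "c *s a" b]
    by eventually_elim (simp add: component_scale zmode_scale_left scale_sum_right)
  then show ?thesis by simp
qed

lemma zhu_residue_add_right: "zhu_residue k a (b + b') = zhu_residue k a b + zhu_residue k a b'"
proof -
  have "\<forall>\<^sub>F L in sequentially. zhu_residue k a (b + b') = zhu_residue k a b + zhu_residue k a b'"
    using eventually_zhu_residue[of k a b] eventually_zhu_residue[of k a b'] eventually_zhu_residue[of k a "b + b'"]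
    by eventually_elim (simp add: zmode_add_right sum.distrib)
  then show ?thesis by simp
qed

lemma zhu_residue_scale_right: "zhu_residue k a (c *s b) = c *s zhu_residue k a b"
proof -
  have "\<forall>\<^sub>F L in sequentially. zhu_residue k a (c *s b) = c *s zhu_residue k a b"
    using eventually_zhu_residue[of k a b] eventually_zhu_residue[of k a "c *s b"]
    by eventually_elim (simp add: zmode_scale_right scale_sum_right)
  then show ?thesis by simp
qed

lemma zhu_residue_zero [simp]: "zhu_residue k 0 b = 0" "zhu_residue k a 0 = 0"
  using zhu_residue_scale_left[of k 0 0 b] zhu_residue_scale_right[of k a 0 0] by simp_all

lemma zhu_residue_homogeneous:
  assumes "a \<in> homogeneous d"
  shows "zhu_residue k a b = zmode d (- int k) a b"
proof -
  have "\<forall>\<^sub>F L in sequentially. zhu_residue k a b = zmode d (- int k) a b"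
    using eventually_zhu_residue[of k a b] eventually_gt_at_top[of d]
  proof eventually_elim
    case (elim L)
    have "(\<Sum>i<L. zmode i (- int k) (component i a) b) = (\<Sum>i<L. if i = d then zmode d (- int k) a b else 0)"
      by (rule sum.cong) (auto simp: component_homogeneous[OF assms])
    then show ?case using elim by simp
  qed
  then show ?thesis by simp
qed

lemmas zhu_product_homogeneous = zhu_residue_homogeneous[of _ _ 1, folded zhu_product_def, simplified]
lemmas zhu_circle_homogeneous = zhu_residue_homogeneous[of _ _ 2, folded zhu_circle_def, simplified]

lemma zhu_bilinear [simp]:
  "zhu_product 0 b = 0" "zhu_product a 0 = 0" "zhu_circle 0 b = 0" "zhu_circle a 0 = 0"
  by (simp_all add: zhu_product_def zhu_circle_def)

lemma zhu_bilinear_simps: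
  "zhu_product (a + a') b = zhu_product a b + zhu_product a' b"
  "zhu_product a (b + b') = zhu_product a b + zhu_product a b'"
  "zhu_product (c *s a) b = c *s zhu_product a b"
  "zhu_product a (c *s b) = c *s zhu_product a b"
  "zhu_circle (a + a') b = zhu_circle a b + zhu_circle a' b"
  "zhu_circle a (b + b') = zhu_circle a b + zhu_circle a b'"
  "zhu_circle (c *s a) b = c *s zhu_circle a b"
  "zhu_circle a (c *s b) = c *s zhu_circle a b"
  by (simp_all add: zhu_product_def zhu_circle_def zhu_residue_add_left zhu_residue_add_right
      zhu_residue_scale_left zhu_residue_scale_right)

lemma zhu_minus:
  "zhu_product (- a) b = - zhu_product a b" "zhu_product a (- b) = - zhu_product a b"
  "zhu_circle (- a) b = - zhu_circle a b" "zhu_circle a (- b) = - zhu_circle a b"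
  using zhu_bilinear_simps(3,4,7,8)[where c = "-1"] by simp_all

lemma zhu_diff:
  "zhu_product (a - a') b = zhu_product a b - zhu_product a' b"
  "zhu_product a (b - b') = zhu_product a b - zhu_product a b'"
  "zhu_circle (a - a') b = zhu_circle a b - zhu_circle a' b"
  "zhu_circle a (b - b') = zhu_circle a b - zhu_circle a b'"
  using zhu_bilinear_simps(1)[of a "- a'" b] zhu_bilinear_simps(2)[of a b "- b'"]
    zhu_bilinear_simps(5)[of a "- a'" b] zhu_bilinear_simps(6)[of a b "- b'"]
  by (simp_all add: zhu_minus)

lemma zhu_sum:
  "zhu_product (sum f S) b = (\<Sum>i\<in>S. zhu_product (f i) b)"
  "zhu_product a (sum f S) = (\<Sum>i\<in>S. zhu_product a (f i))"
  "zhu_circle (sum f S) b = (\<Sum>i\<in>S. zhu_circle (f i) b)"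
  "zhu_circle a (sum f S) = (\<Sum>i\<in>S. zhu_circle a (f i))"
  by (induction S rule: infinite_finite_induct) (simp_all add: zhu_bilinear_simps)

text \<open>Only components of highest degree matter for \<open>gr A(V)\<close>, so the Li degree is prescribed for these
  alone.\<close>

definition leading_filtration :: "nat \<Rightarrow> nat \<Rightarrow> 'v set" where
  "leading_filtration p N = {v \<in> V_le N. component N v \<in> li_filtration p}"

definition bigraded :: "nat \<Rightarrow> nat \<Rightarrow> 'v set" where
  "bigraded p N = homogeneous N \<inter> li_filtration p"

lemma subspace_leading_filtration [simp]: "subspace (leading_filtration p N)"
  by (rule subspaceI) (auto simp: leading_filtration_def component_add component_scale V_le_iff
      intro: subspace_0[OF subspace_li] subspace_add[OF subspace_li] li_scale)

lemma V_less_leading_filtration: "v \<in> V_less N \<Longrightarrow> v \<in> leading_filtration p N"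
  by (simp add: leading_filtration_def V_less_iff V_le_iff subspace_0)

lemma V_less_mono: "v \<in> V_less m \<Longrightarrow> m \<le> n \<Longrightarrow> v \<in> V_less n"
  by (auto simp: V_less_iff)

lemma homogeneous_V_less: "v \<in> homogeneous k \<Longrightarrow> k < n \<Longrightarrow> v \<in> V_less n"
  by (simp add: V_less_iff component_homogeneous)

lemma bigraded_leading_filtration: "v \<in> bigraded p N \<Longrightarrow> v \<in> leading_filtration p N"
  by (auto simp: leading_filtration_def bigraded_def V_le_iff component_homogeneous[of v N])

lemma leading_filtration_component: "v \<in> leading_filtration p N \<Longrightarrow> component N v \<in> bigraded p N"
  by (simp add: leading_filtration_def bigraded_def)

lemma leading_filtration_lower: "v \<in> leading_filtration p N \<Longrightarrow> v - component N v \<in> V_less N"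
  by (auto simp: leading_filtration_def V_le_iff V_less_iff component_diff component_component)

lemma V_less_induct [consumes 1, case_names homogeneous zero add]:
  assumes "v \<in> V_less M"
    and "\<And>l w. l < M \<Longrightarrow> w \<in> homogeneous l \<Longrightarrow> P w"
    and "P 0" "\<And>v w. P v \<Longrightarrow> P w \<Longrightarrow> P (v + w)"
  shows "P v"
proof -
  have "v \<in> span (\<Union>j\<in>{..<M}. homogeneous j)" using assms(1) by (simp add: V_less_def)
  then show ?thesis
  proof (induction rule: span_induct_alt)
    case (step c x y)
    then obtain l where "l < M" "c *s x \<in> homogeneous l"
      by (auto intro: subspace_scale[OF subspace_homogeneous])
    then show ?case using assms(2,4) step by blast
  qed (fact assms(3))
qed

lemma leading_filtration_cases:
  assumes "v \<in> leading_filtration p N"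
  obtains u w where "v = u + w" "u \<in> bigraded p N" "w \<in> V_less N"
  by (rule that[of "component N v" "v - component N v"])
    (use leading_filtration_component[OF assms] leading_filtration_lower[OF assms] in auto)

lemma bigraded_eq_0: "v \<in> bigraded p N \<Longrightarrow> N < p \<Longrightarrow> v = 0"
  using component_li_eq_0[of v p N] by (auto simp: bigraded_def component_homogeneous[of v N])

text \<open>Only the constant term of the weight \<open>(1 + z)\<^sup>e\<close> contributes to the highest degree.\<close>

lemma zmode_leading:
  assumes a: "a \<in> homogeneous k" and b: "b \<in> homogeneous l" and N: "int N = int k + int l - m - 1"
  shows "zmode e m a b - md a m b \<in> V_less N"
proof -
  have "zmode e m a b - md a m b = (\<Sum>i\<in>{..e} - {0}. of_nat (e choose i) *s md a (m + int i) b)"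
    unfolding zmode_def by (subst sum.remove[of _ 0]) simp_all
  also have "\<dots> \<in> V_less N"
  proof (intro subspace_sum subspace_V_less subspace_scale)
    fix i assume "i \<in> {..e} - {0}"
    then have i: "i > 0" by simp
    show "md a (m + int i) b \<in> V_less N"
    proof (cases "i \<le> N")
      case True
      have "md a (m + int i) b \<in> homogeneous (N - i)"
        by (rule md_homogeneous[OF a b]) (use True N in auto)
      then show ?thesis by (rule homogeneous_V_less) (use i True in auto)
    next
      case False
      have "md a (m + int i) b = 0"
        by (rule md_negative_degree[OF a b]) (use False N in auto)
      then show ?thesis by (simp add: subspace_0)
    qed
  qed
  finally show ?thesis .
qed

lemma zmode_negative_degree:
  assumes "a \<in> homogeneous k" "b \<in> homogeneous l" "int k + int l - m - 1 < 0"
  shows "zmode e m a b = 0"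
  unfolding zmode_def by (rule sum.neutral) (use assms in \<open>auto intro: md_negative_degree\<close>)

lemma zmode_V_less:
  assumes a: "a \<in> homogeneous k" and b: "b \<in> homogeneous l" and N: "int k + int l - m \<le> int N"
  shows "zmode e m a b \<in> V_less N"
proof (cases "int k + int l - m - 1 < 0")
  case True
  then show ?thesis using zmode_negative_degree[OF a b] by (simp add: subspace_0)
next
  case False
  define M where "M = nat (int k + int l - m - 1)"
  have M: "int M = int k + int l - m - 1" using False by (simp add: M_def)
  have "md a m b \<in> V_less N"
    by (rule homogeneous_V_less[OF md_homogeneous[OF a b M]]) (use M N in auto)
  moreover have "zmode e m a b - md a m b \<in> V_less N"
    by (rule V_less_mono[OF zmode_leading[OF a b M]]) (use M N in auto)
  ultimately show ?thesis using subspace_add[OF subspace_V_less] by fastforce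
qed

lemma zmode_leading_filtration:
  assumes a: "a \<in> bigraded i k" and b: "b \<in> bigraded j l" and N: "int N = int k + int l - m - 1"
    and r: "int r \<le> int i + int j - m - (if m < 0 then 1 else 0) \<or> r = 0"
  shows "zmode e m a b \<in> leading_filtration r N"
proof -
  have ah: "a \<in> homogeneous k" and bh: "b \<in> homogeneous l" using a b by (auto simp: bigraded_def)
  have "md a m b \<in> bigraded r N"
    unfolding bigraded_def using md_homogeneous[OF ah bh N] md_li[of a i b j r m] a b r
    by (auto simp: bigraded_def)
  then have "md a m b + (zmode e m a b - md a m b) \<in> leading_filtration r N"
    by (intro subspace_add subspace_leading_filtration bigraded_leading_filtration
        V_less_leading_filtration zmode_leading[OF ah bh N])
  then show ?thesis by simp
qed

section \<open>The span of the circle products, filtered by degree and Li degree\<close>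

text \<open>The strict inequality spares a subtraction: this is \<open>O\<^sub>N\<^sub>-\<^sub>1\<close>, and it is zero for \<open>N = 0\<close>.\<close>

definition zhu_below :: "nat \<Rightarrow> 'v set" where
  "zhu_below N = span {zhu_circle a b | a b. \<exists>k l. a \<in> homogeneous k \<and> b \<in> homogeneous l \<and> k + l + 1 < N}"

text \<open>The leading term \<open>a\<^sub>(\<^sub>-\<^sub>2\<^sub>) b\<close> of a generator has degree \<open>k + l + 1\<close> and Li degree \<open>i + j + 1\<close>. Modulo
  \<open>zhu_below N\<close> the circle products behave as if they were equal to their leading terms.\<close>

definition zhu_filtration :: "nat \<Rightarrow> nat \<Rightarrow> 'v set" where
  "zhu_filtration p N = span (zhu_below N \<union>
     {zhu_circle a b | a b. \<exists>i j k l. a \<in> bigraded i k \<and> b \<in> bigraded j l \<and> k + l + 1 = N \<and> p \<le> i + j + 1})"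

lemma subspace_zhu_below [simp]: "subspace (zhu_below N)"
  and subspace_zhu_filtration [simp]: "subspace (zhu_filtration p N)"
  by (simp_all add: zhu_below_def zhu_filtration_def)

lemma zhu_circle_below:
  "a \<in> homogeneous k \<Longrightarrow> b \<in> homogeneous l \<Longrightarrow> k + l + 1 < N \<Longrightarrow> zhu_circle a b \<in> zhu_below N"
  unfolding zhu_below_def by (rule span_base) blast

lemma zhu_below_filtration: "x \<in> zhu_below N \<Longrightarrow> x \<in> zhu_filtration p N"
  unfolding zhu_filtration_def by (simp add: span_base)

lemma zhu_circle_filtration:
  "a \<in> bigraded i k \<Longrightarrow> b \<in> bigraded j l \<Longrightarrow> N = k + l + 1 \<Longrightarrow> p \<le> i + j + 1 \<Longrightarrow> zhu_circle a b \<in> zhu_filtration p N"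
  unfolding zhu_filtration_def by (rule span_base) blast

lemma zhu_filtration_induct [consumes 1, case_names below circle add]:
  assumes "x \<in> zhu_filtration p N"
    and "\<And>x. x \<in> zhu_below N \<Longrightarrow> P x"
    and "\<And>a b i j k l. a \<in> bigraded i k \<Longrightarrow> b \<in> bigraded j l \<Longrightarrow> N = k + l + 1 \<Longrightarrow> p \<le> i + j + 1 \<Longrightarrow>
      P (zhu_circle a b)"
    and "\<And>x y. P x \<Longrightarrow> P y \<Longrightarrow> P (x + y)"
  shows "P x"
  using assms(1) unfolding zhu_filtration_def
proof (induction rule: span_induct_alt)
  case base
  show ?case by (rule assms(2)) (simp add: subspace_0)
next
  case (step c x y)
  have "P (c *s x)"
    using step(1)
  proof
    assume "x \<in> zhu_below N"
    then show ?thesis by (intro assms(2) subspace_scale subspace_zhu_below)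
  next
    assume "x \<in> {zhu_circle a b | a b. \<exists>i j k l. a \<in> bigraded i k \<and> b \<in> bigraded j l \<and> k + l + 1 = N \<and> p \<le> i + j + 1}"
    then obtain a b i j k l where *: "x = zhu_circle a b" "a \<in> bigraded i k" "b \<in> bigraded j l" "k + l + 1 = N" "p \<le> i + j + 1"
      by blast
    then have "c *s a \<in> bigraded i k"
      by (auto simp: bigraded_def intro: subspace_scale[OF subspace_homogeneous] li_scale)
    then have "P (zhu_circle (c *s a) b)" by (rule assms(3)) (use * in auto)
    then show ?thesis by (simp add: * zhu_bilinear_simps)
  qed
  then show ?case using assms(4) step by blast
qed

lemma zhu_filtration_antimono: "p \<le> q \<Longrightarrow> x \<in> zhu_filtration q N \<Longrightarrow> x \<in> zhu_filtration p N"
proof -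
  assume "p \<le> q" "x \<in> zhu_filtration q N"
  from this(2) show "x \<in> zhu_filtration p N"
  proof (induction rule: zhu_filtration_induct)
    case (circle a b i j k l)
    then show ?case using \<open>p \<le> q\<close> by (intro zhu_circle_filtration[of a i k b j l]) auto
  qed (simp_all add: zhu_below_filtration subspace_add)
qed

lemma zhu_below_induct [consumes 1, case_names circle zero add]:
  assumes "x \<in> zhu_below N"
    and "\<And>a b k l. a \<in> homogeneous k \<Longrightarrow> b \<in> homogeneous l \<Longrightarrow> k + l + 1 < N \<Longrightarrow> P (zhu_circle a b)"
    and "P 0" "\<And>x y. P x \<Longrightarrow> P y \<Longrightarrow> P (x + y)"
  shows "P x"
  using assms(1) unfolding zhu_below_def
proof (induction rule: span_induct_alt)
  case (step c x y)
  then obtain a b k l where *: "x = zhu_circle a b" "a \<in> homogeneous k" "b \<in> homogeneous l" "k + l + 1 < N"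
    by blast
  then have "P (zhu_circle (c *s a) b)"
    by (intro assms(2)) (auto intro: subspace_scale[OF subspace_homogeneous])
  then show ?case using assms(4) step * by (simp add: zhu_bilinear_simps)
qed (fact assms(3))

lemma zhu_below_mono: "x \<in> zhu_below M \<Longrightarrow> M \<le> N \<Longrightarrow> x \<in> zhu_below N"
proof (induction rule: zhu_below_induct)
  case (circle a b k l)
  then show ?case by (intro zhu_circle_below[of a k b l]) simp_all
qed (simp_all add: subspace_0 subspace_add)

lemma zhu_filtration_1: "zhu_filtration 1 N = zhu_below (Suc N)"
proof
  show "zhu_filtration 1 N \<subseteq> zhu_below (Suc N)"
  proof
    fix x assume "x \<in> zhu_filtration 1 N"
    then show "x \<in> zhu_below (Suc N)"
    proof (induction rule: zhu_filtration_induct)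
      case (below x)
      then show ?case by (rule zhu_below_mono) simp
    next
      case (circle a b i j k l)
      then show ?case by (intro zhu_circle_below[of a k b l]) (simp_all add: bigraded_def)
    qed (simp add: subspace_add)
  qed
  show "zhu_below (Suc N) \<subseteq> zhu_filtration 1 N"
  proof
    fix x assume "x \<in> zhu_below (Suc N)"
    then show "x \<in> zhu_filtration 1 N"
    proof (induction rule: zhu_below_induct)
      case (circle a b k l)
      then show ?case
      proof (cases "k + l + 1 = N")
        case True
        then show ?thesis by (intro zhu_circle_filtration[of a 0 k b 0 l]) (use circle in \<open>auto simp: bigraded_def\<close>)
      next
        case False
        then show ?thesis by (intro zhu_below_filtration zhu_circle_below) (use circle in auto)
      qed
    qed (simp_all add: subspace_add subspace_0)
  qed
qed

lemma zhu_filtration_subset_below: "x \<in> zhu_filtration p M \<Longrightarrow> M < N \<Longrightarrow> x \<in> zhu_below N"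
proof (induction rule: zhu_filtration_induct)
  case (below x)
  then show ?case by (intro zhu_below_mono[of x M N]) simp_all
next
  case (circle a b i j k l)
  then show ?case by (intro zhu_circle_below[of a k b l]) (simp_all add: bigraded_def)
qed (simp add: subspace_add)

text \<open>By \<open>component_li_eq_0\<close>, one factor of each generator of degree \<open>N\<close> vanishes.\<close>

lemma zhu_filtration_large:
  assumes "x \<in> zhu_filtration p N" "N < p"
  shows "x \<in> zhu_below N"
  using assms(1)
proof (induction rule: zhu_filtration_induct)
  case (circle a b i j k l)
  then have "k < i \<or> l < j" using assms(2) by linarith
  then have "a = 0 \<or> b = 0" using bigraded_eq_0 circle by blast
  then show ?case by (auto simp: subspace_0)
qed (simp_all add: subspace_add)

section \<open>Identities between Zhu's products to leading order\<close>

lemma bigraded_homogeneous: "a \<in> bigraded i k \<Longrightarrow> a \<in> homogeneous k"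
  by (simp add: bigraded_def)

lemma homogeneous_bigraded: "a \<in> homogeneous k \<Longrightarrow> a \<in> bigraded 0 k"
  by (simp add: bigraded_def)

lemma subspace_bigraded [simp]: "subspace (bigraded i k)"
  unfolding bigraded_def by (intro subspace_inter subspace_homogeneous subspace_li)

lemma md_bigraded:
  assumes "a \<in> bigraded i k" "b \<in> bigraded j l" "int N = int k + int l - n - 1"
    and "int r \<le> int i + int j - n - (if n < 0 then 1 else 0) \<or> r = 0"
  shows "md a n b \<in> bigraded r N"
  using assms md_homogeneous[of a k b l N n] md_li[of a i b j r n] by (auto simp: bigraded_def)

lemma normal_product_bigraded:
  "a \<in> bigraded i k \<Longrightarrow> b \<in> bigraded j l \<Longrightarrow> md a (-1) b \<in> bigraded (i + j) (k + l)"
  by (rule md_bigraded) auto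

lemma vac_bigraded: "vac \<in> bigraded 0 0"
  using vac_homogeneous by (simp add: bigraded_def)

lemma translation_bigraded: "a \<in> bigraded i k \<Longrightarrow> translation a \<in> bigraded (Suc i) (Suc k)"
  unfolding translation_def by (rule md_bigraded[OF _ vac_bigraded]) auto

text \<open>Integration by parts trades an order of the pole for a translation, which raises the degree and the
  Li degree by one. The correction terms that come from the weight have a pole of smaller order,
  hence lower degree.\<close>

lemma zmode_filtration_aux:
  "a \<in> bigraded i k \<Longrightarrow> b \<in> bigraded j l \<Longrightarrow>
     zmode k (- 2 - int t) a b \<in> zhu_filtration (i + j + 1 + t) (k + l + 1 + t)"
proof (induction t arbitrary: a i k)
  case 0
  then show ?case
    using zhu_circle_filtration[of a i k b j l "k + l + 1" "i + j + 1"]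
    by (simp add: zhu_circle_homogeneous[OF bigraded_homogeneous[of a i k]])
next
  case (Suc t)
  let ?W = "zhu_filtration (i + j + 1 + Suc t) (k + l + 1 + Suc t)"
  let ?z = "zmode k (- 2 - int t) a b" and ?y = "zmode k (- 2 - int (Suc t)) a b"
  have z: "?z \<in> ?W"
    by (intro zhu_below_filtration zhu_filtration_subset_below[OF Suc.IH[OF Suc.prems]]) simp
  have "zmode (Suc k) (- 2 - int t) (translation a) b
      \<in> zhu_filtration (Suc i + j + 1 + t) (Suc k + l + 1 + t)"
    by (rule Suc.IH[OF translation_bigraded[OF Suc.prems(1)] Suc.prems(2)])
  then have T: "zmode (Suc k) (- 2 - int t) (translation a) b \<in> ?W" by simp
  have "zmode (Suc k) (- 2 - int t - 1) a b = ?y + ?z"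
  proof -
    have "- 2 - int t - 1 = - 2 - int (Suc t)" "- 2 - int (Suc t) + 1 = - 2 - int t" by simp_all
    then show ?thesis by (simp only: zmode_Suc)
  qed
  then have "zmode (Suc k) (- 2 - int t) (translation a) b
      = - (of_int (- 2 - int t) *s (?y + ?z) + of_nat (Suc k) *s ?z)"
    by (simp only: zmode_translation)
  also have "of_int (- 2 - int t) = - (of_nat (t + 2) :: complex)" by simp
  finally have "zmode (Suc k) (- 2 - int t) (translation a) b
      = of_nat (t + 2) *s (?y + ?z) - of_nat (Suc k) *s ?z"
    by (simp only: scale_minus_left minus_add_distrib minus_minus) simp
  then have "of_nat (t + 2) *s ?y = zmode (Suc k) (- 2 - int t) (translation a) b
      + of_nat (Suc k) *s ?z - of_nat (t + 2) *s ?z"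
    by (simp add: scale_right_distrib del: of_nat_add of_nat_Suc)
  also have "\<dots> \<in> ?W"
    by (intro subspace_diff subspace_add subspace_scale subspace_zhu_filtration z T)
  finally have "inverse (of_nat (t + 2)) *s of_nat (t + 2) *s ?y \<in> ?W"
    by (rule subspace_scale[OF subspace_zhu_filtration])
  moreover have "inverse (of_nat (t + 2)) * of_nat (t + 2) = (1 :: complex)"
    by (rule left_inverse, unfold of_nat_eq_0_iff) simp
  ultimately show ?case by (simp del: of_nat_add of_nat_Suc)
qed

text \<open>A surplus factor \<open>(1 + z)\<^sup>s\<close> lowers the order of the pole by up to \<open>s\<close>; the bound \<open>s \<le> t\<close> keeps it at
  least two, so that all residues stay in \<open>O(V)\<close>.\<close>

lemma zmode_filtration_bigraded:
  "a \<in> bigraded i k \<Longrightarrow> b \<in> bigraded j l \<Longrightarrow> s \<le> t \<Longrightarrow>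
     zmode (k + s) (- 2 - int t) a b \<in> zhu_filtration (i + j + 1 + t) (k + l + 1 + t)"
proof (induction s arbitrary: t)
  case 0
  then show ?case using zmode_filtration_aux[of a i k b j l t] by simp
next
  case (Suc s)
  then obtain t' where t': "t = Suc t'" by (cases t) auto
  have "- 2 - int t + 1 = - 2 - int t'" by (simp add: t')
  then have "zmode (k + Suc s) (- 2 - int t) a b
      = zmode (k + s) (- 2 - int t) a b + zmode (k + s) (- 2 - int t') a b"
    by (simp only: add_Suc_right zmode_Suc)
  moreover have "zmode (k + s) (- 2 - int t') a b \<in> zhu_filtration (i + j + 1 + t) (k + l + 1 + t)"
    by (intro zhu_below_filtration zhu_filtration_subset_below[OF Suc.IH]) (use Suc.prems t' in auto)
  ultimately show ?case
    using Suc.IH[of t] Suc.prems by (simp add: subspace_add)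
qed

lemma zmode_below:
  assumes a: "a \<in> homogeneous k" and x: "x \<in> V_less M" and s: "s \<le> t"
  shows "zmode (k + s) (- 2 - int t) a x \<in> zhu_below (k + M + 1 + t)"
  using x
proof (induction rule: V_less_induct)
  case (homogeneous l b)
  then show ?case
    using zhu_filtration_subset_below[OF zmode_filtration_bigraded[OF homogeneous_bigraded[OF a]
        homogeneous_bigraded[of b l] s]] by simp
qed (simp_all add: subspace_0 zmode_add_right subspace_add)

lemma zmode_filtration:
  assumes a: "a \<in> bigraded i k" and x: "x \<in> leading_filtration q M" and s: "s \<le> t"
    and p: "p \<le> i + q + 1 + t" and N: "N = k + M + 1 + t"
  shows "zmode (k + s) (- 2 - int t) a x \<in> zhu_filtration p N"
proof -
  obtain u w where u: "x = u + w" "u \<in> bigraded q M" "w \<in> V_less M"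
    using leading_filtration_cases[OF x] .
  have "zmode (k + s) (- 2 - int t) a u \<in> zhu_filtration p N"
    using zhu_filtration_antimono[OF p] zmode_filtration_bigraded[OF a u(2) s] N by simp
  moreover have "zmode (k + s) (- 2 - int t) a w \<in> zhu_filtration p N"
    unfolding N by (rule zhu_below_filtration[OF zmode_below[OF bigraded_homogeneous[OF a] u(3) s]])
  ultimately show ?thesis unfolding u(1) zmode_add_right by (rule subspace_add[OF subspace_zhu_filtration])
qed

lemma zhu_circle_V_less:
  assumes "a \<in> homogeneous k" "x \<in> V_less M" "k + M + 1 \<le> N"
  shows "zhu_circle a x \<in> zhu_below N"
  using zhu_below_mono[OF zmode_below[OF assms(1,2), of 0 0]] assms(1,3)
  by (simp add: zhu_circle_homogeneous)

lemma zhu_product_leading: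
  assumes "u \<in> homogeneous n" "v \<in> homogeneous m"
  shows "zhu_product u v - md u (-1) v \<in> V_less (n + m)"
  using zmode_leading[OF assms, of "n + m" "-1" n] by (simp add: zhu_product_homogeneous[OF assms(1)])

text \<open>The commutator of \<open>u *\<close> and \<open>a \<circ>\<close> consists of residues of \<open>Y(u\<^sub>(\<^sub>l\<^sub>) a, z) b\<close> with a pole of order at
  most \<open>l + 3\<close>. Only the pole of this order reaches the top degree, and there the mode \<open>l \<ge> 0\<close> gains
  one Li degree. What remains is \<open>a \<circ> (u * b)\<close>.\<close>

lemma zhu_product_circle:
  assumes u: "u \<in> bigraded r n" and a: "a \<in> bigraded i k" and b: "b \<in> bigraded j l"
  shows "zhu_product u (zhu_circle a b) - zhu_circle a (md u (-1) b)
    \<in> zhu_filtration (r + i + j + 2) (n + k + l + 1)"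
proof -
  let ?W = "zhu_filtration (r + i + j + 2) (n + k + l + 1)"
  have uh: "u \<in> homogeneous n" and ah: "a \<in> homogeneous k" and bh: "b \<in> homogeneous l"
    using u a b by (simp_all add: bigraded_def)
  have "\<forall>\<^sub>F L in sequentially. zhu_product u (zhu_circle a b) - zhu_circle a (zhu_product u b) \<in> ?W"
    using eventually_zmode_borcherds[of "-1" n k "-2" u 0 a b] eventually_gt_at_top[of 0]
  proof eventually_elim
    case (elim L)
    have "zhu_product u (zhu_circle a b) - zhu_circle a (zhu_product u b)
      = (\<Sum>j<L. ((-1) ^ j * (of_int 0 gchoose j)) *s
        (zmode n (- 1 + 0 - int j) u (zmode k (- 2 + int j) a b)
          - ((-1) powi 0) *s zmode k (0 + - 2 - int j) a (zmode n (- 1 + int j) u b)))"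
      unfolding sum_lessThan_gchoose_zero[OF elim(2)]
      by (simp add: zhu_product_homogeneous[OF uh] zhu_circle_homogeneous[OF ah])
    also have "\<dots> = (\<Sum>l'<L. \<Sum>k'\<le>l'. ((of_int (- 1) gchoose k') * of_nat (n choose (l' - k'))) *s
        zmode (n - (l' - k') + k) (- 1 + - 2 - int k') (md u (0 + int l') a) b)"
      using elim(1) by simp
    also have "\<dots> \<in> ?W"
    proof (intro subspace_sum subspace_zhu_filtration)
      fix l' k' :: nat assume "k' \<in> {..l'}"
      then have k': "k' \<le> l'" by simp
      let ?v = "md u (int l') a"
      have "zmode (n - (l' - k') + k) (- 3 - int k') ?v b \<in> ?W" if "l' - k' \<le> n"
      proof (cases "l' < n + k")
        case True
        define D where "D = n + k - l' - 1"
        have D: "int D = int n + int k - int l' - 1" using True by (simp add: D_def)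
        have v: "?v \<in> bigraded (r + i - l') D"
          by (rule md_bigraded[OF u a D]) auto
        have e: "n - (l' - k') + k = D + (k' + 1)" "- 3 - int k' = - 2 - int (k' + 1)"
          using that k' True by (auto simp: D_def)
        have z: "zmode (D + (k' + 1)) (- 2 - int (k' + 1)) ?v b
          \<in> zhu_filtration (r + i - l' + j + 1 + (k' + 1)) (D + l + 1 + (k' + 1))"
          by (rule zmode_filtration_bigraded[OF v b order_refl])
        show ?thesis
        proof (cases "k' = l'")
          case True
          have "D + l + 1 + (k' + 1) = n + k + l + 1" using True \<open>l' < n + k\<close> by (simp add: D_def)
          moreover have "r + i + j + 2 \<le> r + i - l' + j + 1 + (k' + 1)" using True by simp
          ultimately show ?thesis unfolding e using zhu_filtration_antimono z by metis
        next
          case False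
          then have "D + l + 1 + (k' + 1) < n + k + l + 1" using k' \<open>l' < n + k\<close> by (simp add: D_def)
          then show ?thesis unfolding e by (intro zhu_below_filtration zhu_filtration_subset_below[OF z])
        qed
      next
        case False
        have "?v = 0" by (rule md_negative_degree[OF uh ah]) (use False in auto)
        then show ?thesis by (simp add: subspace_0)
      qed
      then show "((of_int (- 1) gchoose k') * of_nat (n choose (l' - k'))) *s
        zmode (n - (l' - k') + k) (- 1 + - 2 - int k') (md u (0 + int l') a) b \<in> ?W"
        by (cases "l' - k' \<le> n") (simp_all add: subspace_scale subspace_0 binomial_eq_0)
    qed
    finally show ?case .
  qed
  then have 1: "zhu_product u (zhu_circle a b) - zhu_circle a (zhu_product u b) \<in> ?W" by simp
  have 2: "zhu_circle a (zhu_product u b) - zhu_circle a (md u (-1) b) \<in> ?W"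
    unfolding zhu_diff[symmetric]
    by (rule zhu_below_filtration, rule zhu_circle_V_less[OF ah zhu_product_leading[OF uh bh]]) simp
  show ?thesis using subspace_add[OF subspace_zhu_filtration 1 2] by simp
qed

lemma zmode_leading_filtration_cases:
  assumes a: "a \<in> bigraded i k" and b: "b \<in> bigraded j l"
  obtains N where "int N = int k + int l - m - 1"
      "\<And>r. int r \<le> int i + int j - m - (if m < 0 then 1 else 0) \<or> r = 0 \<Longrightarrow> zmode e m a b \<in> leading_filtration r N"
  | "zmode e m a b = 0"
proof (cases "int k + int l - m - 1 < 0")
  case True
  show ?thesis
    by (rule that(2)) (rule zmode_negative_degree[OF bigraded_homogeneous[OF a] bigraded_homogeneous[OF b] True])
next
  case False
  then have "int (nat (int k + int l - m - 1)) = int k + int l - m - 1" by simp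
  then show ?thesis using zmode_leading_filtration[OF a b] that(1) by blast
qed

text \<open>In the iterate formula for \<open>(a \<circ> b) * u\<close> every term but \<open>a \<circ> (b\<^sub>(\<^sub>-\<^sub>1\<^sub>) u)\<close> has lower degree or contains
  a mode of index at least \<open>0\<close>. Together with \<open>zhu_product_circle\<close> this gives the symmetry
  \<open>\<iota>(x) y = \<iota>(y) x\<close>.\<close>

lemma zhu_circle_product:
  assumes a: "a \<in> bigraded i k" and b: "b \<in> bigraded j l" and u: "u \<in> bigraded r n"
  shows "zhu_product (zhu_circle a b) u - zhu_circle a (md b (-1) u)
    \<in> zhu_filtration (i + j + r + 2) (k + l + n + 1)"
proof -
  let ?W = "zhu_filtration (i + j + r + 2) (k + l + n + 1)"
  have uh: "u \<in> homogeneous n" and ah: "a \<in> homogeneous k" and bh: "b \<in> homogeneous l"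
    using u a b by (simp_all add: bigraded_def)
  have "\<forall>\<^sub>F L in sequentially. zhu_product (zhu_circle a b) u - zhu_circle a (md b (-1) u) \<in> ?W"
    using eventually_zmode_iterate[of k "Suc l" "-1" a "-2" b u] eventually_gt_at_top[of 0]
  proof eventually_elim
    case (elim L)
    have "zhu_product (zhu_circle a b) u = (\<Sum>l'\<le>k. of_nat (k choose l') *s zhu_product (md a (- 2 + int l') b) u)"
      by (simp add: zhu_circle_homogeneous[OF ah] zmode_def zhu_sum zhu_bilinear_simps)
    also have "\<dots> = (\<Sum>l'\<le>k. of_nat (k choose l') *s zmode (k - l' + Suc l) (- 1) (md a (- 2 + int l') b) u)"
    proof (rule sum.cong[OF HOL.refl])
      fix l' assume "l' \<in> {..k}"
      then have "md a (- 2 + int l') b \<in> homogeneous (k - l' + Suc l)"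
        by (intro md_homogeneous[OF ah bh]) auto
      then show "of_nat (k choose l') *s zhu_product (md a (- 2 + int l') b) u
        = of_nat (k choose l') *s zmode (k - l' + Suc l) (- 1) (md a (- 2 + int l') b) u"
        by (simp add: zhu_product_homogeneous)
    qed
    also have "\<dots> = (\<Sum>j'<L. ((-1) ^ j' * (of_int (- 2) gchoose j')) *s
        (zmode k (- 2 - int j') a (zmode (Suc l) (- 1 + int j') b u)
          - ((-1) powi (- 2)) *s zmode (Suc l) (- 2 + - 1 - int j') b (zmode k (int j') a u)))"
      by (rule elim(1))
    also have "\<dots> = (\<Sum>j'<L. of_nat (j' + 1) *s
        (zmode k (- 2 - int j') a (zmode (Suc l) (- 1 + int j') b u)
          - zmode (Suc l) (- 3 - int j') b (zmode k (int j') a u)))"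
      using gchoose_minus_two by (simp add: power_int_def)
    also have "\<dots> = zmode k (- 2) a (zmode (Suc l) (- 1) b u)
          - zmode (Suc l) (- 3) b (zmode k 0 a u)
        + (\<Sum>j'\<in>{..<L}-{0}. of_nat (j' + 1) *s
        (zmode k (- 2 - int j') a (zmode (Suc l) (- 1 + int j') b u)
          - zmode (Suc l) (- 3 - int j') b (zmode k (int j') a u)))"
      using elim(2) by (subst sum.remove[of _ 0]) simp_all
    finally have eq: "zhu_product (zhu_circle a b) u - zhu_circle a (md b (-1) u)
      = zmode k (- 2) a (zmode (Suc l) (- 1) b u - md b (-1) u)
          - zmode (Suc l) (- 3) b (zmode k 0 a u)
        + (\<Sum>j'\<in>{..<L}-{0}. of_nat (j' + 1) *s
        (zmode k (- 2 - int j') a (zmode (Suc l) (- 1 + int j') b u)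
          - zmode (Suc l) (- 3 - int j') b (zmode k (int j') a u)))"
      by (simp add: zhu_circle_homogeneous[OF ah] zmode_diff_right del: of_nat_add)
    \<comment> \<open>the weight exceeds the degree of \<open>b\<close> by one, which the pole of order at least three allows\<close>
    have B: "zmode (Suc l) (- 3 - int j') b (zmode k (int j') a u) \<in> ?W" for j'
    proof (rule zmode_leading_filtration_cases[OF a u, of "int j'" k])
      fix N assume N: "int N = int k + int n - int j' - 1"
        and x: "\<And>q. int q \<le> int i + int r - int j' - (if int j' < 0 then 1 else 0) \<or> q = 0 \<Longrightarrow>
          zmode k (int j') a u \<in> leading_filtration q N"
      have "zmode k (int j') a u \<in> leading_filtration (i + r - j') N" by (rule x) auto
      then have "zmode (l + 1) (- 2 - int (Suc j')) b (zmode k (int j') a u) \<in> ?W"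
        by (rule zmode_filtration[OF b]) (use N in auto)
      moreover have "zmode (l + 1) (- 2 - int (Suc j')) = zmode (Suc l) (- 3 - int j')"
        by (rule arg_cong2[where f = zmode]) simp_all
      ultimately show ?thesis by simp
    qed (simp add: subspace_0)
    have B0: "zmode (Suc l) (- 3) b (zmode k 0 a u) \<in> ?W"
      using B[of 0] by simp
    have A: "zmode k (- 2 - int j') a (zmode (Suc l) (- 1 + int j') b u) \<in> ?W" if "j' > 0" for j'
    proof (rule zmode_leading_filtration_cases[OF b u, of "- 1 + int j'" "Suc l"])
      fix N assume N: "int N = int l + int n - (- 1 + int j') - 1"
        and x: "\<And>q. int q \<le> int j + int r - (- 1 + int j') - (if - 1 + int j' < 0 then 1 else 0) \<or> q = 0 \<Longrightarrow>
          zmode (Suc l) (- 1 + int j') b u \<in> leading_filtration q N"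
      \<comment> \<open>the mode \<open>j' - 1 \<ge> 0\<close> gains one Li degree\<close>
      have "zmode (Suc l) (- 1 + int j') b u \<in> leading_filtration (j + r + 1 - j') N"
        by (rule x) (use that in auto)
      then have "zmode (k + 0) (- 2 - int j') a (zmode (Suc l) (- 1 + int j') b u) \<in> ?W"
        by (rule zmode_filtration[OF a]) (use N in auto)
      then show ?thesis by simp
    qed (simp add: subspace_0)
    have "zmode (Suc l) (- 1) b u - md b (-1) u \<in> V_less (l + n)"
      by (rule zmode_leading[OF bh uh]) simp
    then have "zmode (k + 0) (- 2 - int 0) a (zmode (Suc l) (- 1) b u - md b (-1) u) \<in> zhu_below (k + (l + n) + 1 + 0)"
      by (rule zmode_below[OF ah]) simp
    then have "zmode k (- 2) a (zmode (Suc l) (- 1) b u - md b (-1) u) \<in> ?W"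
      by (intro zhu_below_filtration) (simp add: add.assoc)
    then show ?case
      unfolding eq
      by (intro subspace_add subspace_diff subspace_sum subspace_scale subspace_zhu_filtration A B B0) auto
  qed
  then show ?thesis by simp
qed

lemma zhu_circle_vac_below: "x \<in> V_less N \<Longrightarrow> zhu_circle x vac \<in> zhu_below (Suc N)"
proof (induction rule: V_less_induct)
  case (homogeneous d w)
  then show ?case using zhu_circle_below[OF homogeneous(2) vac_homogeneous] by simp
qed (simp_all add: subspace_0 zhu_bilinear_simps subspace_add)

lemma zhu_product_vac_right: "a \<in> homogeneous k \<Longrightarrow> zhu_product a vac = a"
proof -
  assume a: "a \<in> homogeneous k"
  have "zmode k (-1) a vac = (\<Sum>i\<in>{..k}. if i = 0 then a else 0)"
    unfolding zmode_def by (rule sum.cong) (auto simp: vac_right vac_right_nonneg)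
  then show ?thesis by (simp add: zhu_product_homogeneous[OF a])
qed

text \<open>The Leibniz rule for \<open>D a = a \<circ> 1\<close>. The iterate formula for \<open>(a * b) \<circ> 1\<close> has only the two terms
  \<open>a * (b \<circ> 1)\<close> and \<open>a \<circ> b\<close>, since modes of index at least \<open>0\<close> annihilate the vacuum, and
  \<open>a * (b \<circ> 1)\<close> is \<open>b \<circ> a\<close> to leading order by \<open>zhu_product_circle\<close>.\<close>

lemma zhu_circle_leibniz:
  assumes a: "a \<in> bigraded i k" and b: "b \<in> bigraded j l"
  shows "zhu_circle (md a (-1) b) vac - zhu_circle a b - zhu_circle b a
    \<in> zhu_filtration (i + j + 2) (k + l + 1)"
proof -
  let ?W = "zhu_filtration (i + j + 2) (k + l + 1)"
  have ah: "a \<in> homogeneous k" and bh: "b \<in> homogeneous l"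
    using a b by (simp_all add: bigraded_def)
  have "\<forall>\<^sub>F L in sequentially. zhu_circle (md a (-1) b) vac - zhu_circle a b - zhu_circle b a \<in> ?W"
    using eventually_zmode_iterate[of k l "-2" a "-1" b vac] eventually_gt_at_top[of 1]
  proof eventually_elim
    case (elim L)
    have zero: "zmode e (int m) c vac = 0" for e m c
      unfolding zmode_def by (rule sum.neutral) (simp add: vac_right_nonneg)
    have "zhu_circle (zhu_product a b) vac = (\<Sum>l'\<le>k. of_nat (k choose l') *s zhu_circle (md a (- 1 + int l') b) vac)"
      by (simp add: zhu_product_homogeneous[OF ah] zmode_def zhu_sum zhu_bilinear_simps)
    also have "\<dots> = (\<Sum>l'\<le>k. of_nat (k choose l') *s zmode (k - l' + l) (- 2) (md a (- 1 + int l') b) vac)"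
    proof (rule sum.cong[OF HOL.refl])
      fix l' assume "l' \<in> {..k}"
      then have "md a (- 1 + int l') b \<in> homogeneous (k - l' + l)"
        by (intro md_homogeneous[OF ah bh]) auto
      then show "of_nat (k choose l') *s zhu_circle (md a (- 1 + int l') b) vac
        = of_nat (k choose l') *s zmode (k - l' + l) (- 2) (md a (- 1 + int l') b) vac"
        by (simp add: zhu_circle_homogeneous)
    qed
    also have "\<dots> = (\<Sum>j'<L. ((-1) ^ j' * (of_int (- 1) gchoose j')) *s
        (zmode k (- 1 - int j') a (zmode l (- 2 + int j') b vac)
          - ((-1) powi (- 1)) *s zmode l (- 1 + - 2 - int j') b (zmode k (int j') a vac)))"
      by (rule elim(1))
    also have "\<dots> = (\<Sum>j'<L. zmode k (- 1 - int j') a (zmode l (- 2 + int j') b vac))"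
      using gchoose_minus_one by (simp add: zero)
    also have "\<dots> = (\<Sum>j'\<in>{0, 1}. zmode k (- 1 - int j') a (zmode l (- 2 + int j') b vac))"
    proof (rule sum.mono_neutral_right)
      show "\<forall>j'\<in>{..<L} - {0, 1}. zmode k (- 1 - int j') a (zmode l (- 2 + int j') b vac) = 0"
      proof
        fix j' assume "j' \<in> {..<L} - {0, 1}"
        then have "- 2 + int j' = int (j' - 2)" by auto
        then show "zmode k (- 1 - int j') a (zmode l (- 2 + int j') b vac) = 0" by (simp only: zero zmode_zero)
      qed
    qed (use elim(2) in auto)
    also have "\<dots> = zhu_product a (zhu_circle b vac) + zhu_circle a b"
      using zhu_product_vac_right[OF bh]
      by (simp add: zhu_product_homogeneous[OF ah] zhu_circle_homogeneous[OF ah]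
          zhu_product_homogeneous[OF bh] zhu_circle_homogeneous[OF bh])
    finally have eq: "zhu_circle (md a (-1) b) vac - zhu_circle a b - zhu_circle b a
      = (zhu_product a (zhu_circle b vac) - zhu_circle b (md a (-1) vac)) - zhu_circle (zhu_product a b - md a (-1) b) vac"
      by (simp add: vac_right zhu_diff)
    have "zhu_product a (zhu_circle b vac) - zhu_circle b (md a (-1) vac) \<in> ?W"
      using zhu_product_circle[OF a b vac_bigraded] by (simp add: add_ac)
    moreover have "zhu_circle (zhu_product a b - md a (-1) b) vac \<in> ?W"
      using zhu_below_filtration[OF zhu_circle_vac_below[OF zhu_product_leading[OF ah bh]]] by simp
    ultimately show ?case unfolding eq by (rule subspace_diff[OF subspace_zhu_filtration])
  qed
  then show ?thesis by simp
qed

lemma V_less_exists: "\<exists>N. v \<in> V_less N"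
  by (rule component_bound[of v]) (auto simp: V_less_iff)

lemma zhu_product_V_less:
  assumes "x \<in> V_less N" "y \<in> V_less K" "N + K \<le> Suc M"
  shows "zhu_product x y \<in> V_less M"
  using assms(1)
proof (induction rule: V_less_induct)
  case (homogeneous n x)
  note x = this
  show ?case using assms(2)
  proof (induction rule: V_less_induct)
    case (homogeneous l y)
    have "zmode n (-1) x y \<in> V_less M"
      by (rule zmode_V_less[OF x(2) homogeneous(2)]) (use x(1) homogeneous(1) assms(3) in auto)
    then show ?case by (simp add: zhu_product_homogeneous[OF x(2)])
  qed (simp_all add: subspace_0 zhu_bilinear_simps subspace_add)
qed (simp_all add: subspace_0 zhu_bilinear_simps subspace_add)

lemma leading_filtration_V_less: "x \<in> leading_filtration p N \<Longrightarrow> x \<in> V_less (Suc N)"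
  by (simp add: leading_filtration_def V_le_eq)

lemma zhu_product_leading_component:
  assumes x: "x \<in> leading_filtration p N" and y: "y \<in> leading_filtration q K"
  shows "zhu_product x y - md (component N x) (-1) (component K y) \<in> V_less (N + K)"
proof -
  let ?u = "component N x" and ?v = "component K y"
  have "zhu_product x y - md ?u (-1) ?v
      = (zhu_product ?u ?v - md ?u (-1) ?v) + zhu_product (x - ?u) y + zhu_product ?u (y - ?v)"
    by (simp add: zhu_diff)
  also have "\<dots> \<in> V_less (N + K)"
  proof (intro subspace_add subspace_V_less)
    show "zhu_product ?u ?v - md ?u (-1) ?v \<in> V_less (N + K)"
      by (rule zhu_product_leading) simp_all
    show "zhu_product (x - ?u) y \<in> V_less (N + K)"
      by (rule zhu_product_V_less[OF leading_filtration_lower[OF x] leading_filtration_V_less[OF y]]) simp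
    show "zhu_product ?u (y - ?v) \<in> V_less (N + K)"
      by (rule zhu_product_V_less[OF homogeneous_V_less[of _ N "Suc N"] leading_filtration_lower[OF y]]) simp_all
  qed
  finally show ?thesis .
qed

lemma component_zhu_product:
  assumes "x \<in> leading_filtration p N" "y \<in> leading_filtration q K"
  shows "component (N + K) (zhu_product x y) = md (component N x) (-1) (component K y)"
proof -
  have "component (N + K) (md (component N x) (-1) (component K y)) = md (component N x) (-1) (component K y)"
    by (subst component_homogeneous[OF md_homogeneous[of _ N _ K "N + K"]]) simp_all
  then show ?thesis
    using zhu_product_leading_component[OF assms] by (auto simp: V_less_iff component_diff)
qed

lemma zhu_product_leading_filtration:
  assumes x: "x \<in> leading_filtration p N" and y: "y \<in> leading_filtration q K"
  shows "zhu_product x y \<in> leading_filtration (p + q) (N + K)"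
proof -
  have "md (component N x) (-1) (component K y) \<in> bigraded (p + q) (N + K)"
    by (rule normal_product_bigraded) (use x y leading_filtration_component in auto)
  then have "md (component N x) (-1) (component K y)
      + (zhu_product x y - md (component N x) (-1) (component K y)) \<in> leading_filtration (p + q) (N + K)"
    by (intro subspace_add subspace_leading_filtration bigraded_leading_filtration
        V_less_leading_filtration zhu_product_leading_component[OF x y])
  then show ?thesis by simp
qed

lemma leading_filtration_antimono: "p \<le> q \<Longrightarrow> x \<in> leading_filtration q N \<Longrightarrow> x \<in> leading_filtration p N"
  by (auto simp: leading_filtration_def intro: li_antimono)

lemma zhu_below_V_less: "x \<in> zhu_below N \<Longrightarrow> x \<in> V_less N"
proof (induction rule: zhu_below_induct)
  case (circle a b k l)
  have "zmode k (- 2) a b \<in> V_less N" by (rule zmode_V_less[OF circle(1,2)]) (use circle in auto)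
  then show ?case by (simp add: zhu_circle_homogeneous[OF circle(1)])
qed (simp_all add: subspace_0 subspace_add)

lemma zhu_filtration_leading: "x \<in> zhu_filtration p N \<Longrightarrow> x \<in> leading_filtration p N"
proof (induction rule: zhu_filtration_induct)
  case (below x)
  then show ?case by (intro V_less_leading_filtration zhu_below_V_less)
next
  case (circle a b i j k l)
  have "zmode k (- 2) a b \<in> leading_filtration (i + j + 1) N"
    by (rule zmode_leading_filtration[OF circle(1,2)]) (use circle in auto)
  then show ?case using circle leading_filtration_antimono
    by (simp add: zhu_circle_homogeneous[OF bigraded_homogeneous[OF circle(1)]])
qed (simp add: subspace_add)

lemma zhu_product_below:
  assumes "x \<in> V_less N" "y \<in> zhu_below K" "N + K \<le> Suc M"
  shows "zhu_product x y \<in> zhu_below M" "zhu_product y x \<in> zhu_below M"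
proof -
  have "zhu_product x y \<in> zhu_below M \<and> zhu_product y x \<in> zhu_below M"
    using assms(1)
  proof (induction rule: V_less_induct)
    case (homogeneous n x)
    note x = this
    show ?case using assms(2)
    proof (induction rule: zhu_below_induct)
      case (circle a b k l)
      note bg = homogeneous_bigraded[OF x(2)] homogeneous_bigraded[OF circle(1)] homogeneous_bigraded[OF circle(2)]
      have le: "n + k + l + 1 < M" using x(1) circle(3) assms(3) by simp
      have 1: "zhu_product x (zhu_circle a b) - zhu_circle a (md x (-1) b) \<in> zhu_below M"
        by (rule zhu_filtration_subset_below[OF zhu_product_circle[OF bg]]) (use le in simp)
      have 2: "zhu_product (zhu_circle a b) x - zhu_circle a (md b (-1) x) \<in> zhu_below M"
        by (rule zhu_filtration_subset_below[OF zhu_circle_product[OF bg(2,3,1)]]) (use le in simp)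
      have 3: "zhu_circle a (md x (-1) b) \<in> zhu_below M"
        by (rule zhu_circle_below[OF circle(1) md_homogeneous[OF x(2) circle(2), of "n + l"]]) (use le in auto)
      have 4: "zhu_circle a (md b (-1) x) \<in> zhu_below M"
        by (rule zhu_circle_below[OF circle(1) md_homogeneous[OF circle(2) x(2), of "n + l"]]) (use le in auto)
      show ?case
        using subspace_add[OF subspace_zhu_below 1 3] subspace_add[OF subspace_zhu_below 2 4] by simp
    qed (simp_all add: subspace_0 zhu_bilinear_simps subspace_add)
  qed (simp_all add: subspace_0 zhu_bilinear_simps subspace_add)
  then show "zhu_product x y \<in> zhu_below M" "zhu_product y x \<in> zhu_below M" by simp_all
qed

lemma zhu_circle_below_Suc:
  "a \<in> bigraded i k \<Longrightarrow> b \<in> bigraded j l \<Longrightarrow> zhu_circle a b \<in> zhu_below (Suc (k + l + 1))"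
  by (rule zhu_circle_below[OF bigraded_homogeneous bigraded_homogeneous]) auto

text \<open>The product with an element of lower degree stays below the degree \<open>M\<close>, so \<open>x\<close> acts through its
  leading component.\<close>

lemma zhu_product_circle_leading:
  assumes x: "x \<in> leading_filtration p N" and a: "a \<in> bigraded i k" and b: "b \<in> bigraded j l"
    and M: "M = N + k + l + 1" and s: "s \<le> p + i + j + 2"
  shows "zhu_product x (zhu_circle a b) - zhu_circle a (md (component N x) (-1) b) \<in> zhu_filtration s M"
    and "zhu_product (zhu_circle a b) x - zhu_circle a (md b (-1) (component N x)) \<in> zhu_filtration s M"
proof -
  let ?u = "component N x"
  have low: "zhu_product (x - ?u) (zhu_circle a b) \<in> zhu_below M" "zhu_product (zhu_circle a b) (x - ?u) \<in> zhu_below M"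
    by (rule zhu_product_below[OF leading_filtration_lower[OF x] zhu_circle_below_Suc[OF a b]], use M in simp)+
  have u: "?u \<in> bigraded p N" by (rule leading_filtration_component[OF x])
  have 1: "zhu_product ?u (zhu_circle a b) - zhu_circle a (md ?u (-1) b) \<in> zhu_filtration s M"
    using zhu_filtration_antimono[OF s zhu_product_circle[OF u a b]] M by simp
  have "zhu_product (zhu_circle a b) ?u - zhu_circle a (md b (-1) ?u) \<in> zhu_filtration (i + j + p + 2) (k + l + N + 1)"
    by (rule zhu_circle_product[OF a b u])
  then have 2: "zhu_product (zhu_circle a b) ?u - zhu_circle a (md b (-1) ?u) \<in> zhu_filtration s M"
    using s M by (auto simp: add_ac intro: zhu_filtration_antimono)
  show "zhu_product x (zhu_circle a b) - zhu_circle a (md ?u (-1) b) \<in> zhu_filtration s M"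
    using subspace_add[OF subspace_zhu_filtration 1 zhu_below_filtration[OF low(1)]] by (simp add: zhu_diff)
  show "zhu_product (zhu_circle a b) x - zhu_circle a (md b (-1) ?u) \<in> zhu_filtration s M"
    using subspace_add[OF subspace_zhu_filtration 2 zhu_below_filtration[OF low(2)]] by (simp add: zhu_diff)
qed

lemma zhu_product_filtration:
  assumes x: "x \<in> leading_filtration p N" and y: "y \<in> zhu_filtration q K"
  shows "zhu_product x y \<in> zhu_filtration (p + q) (N + K)"
  using y
proof (induction rule: zhu_filtration_induct)
  case (below y)
  then show ?case
    by (intro zhu_below_filtration zhu_product_below(1)[OF leading_filtration_V_less[OF x] below]) simp_all
next
  case (circle a b i j k l)
  have 1: "zhu_product x (zhu_circle a b) - zhu_circle a (md (component N x) (-1) b) \<in> zhu_filtration (p + q) (N + K)"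
    by (rule zhu_product_circle_leading[OF x circle(1,2)]) (use circle in auto)
  have 2: "zhu_circle a (md (component N x) (-1) b) \<in> zhu_filtration (p + q) (N + K)"
    by (rule zhu_circle_filtration[OF circle(1) normal_product_bigraded[OF leading_filtration_component[OF x] circle(2)]])
      (use circle in auto)
  show ?case using subspace_add[OF subspace_zhu_filtration 1 2] by simp
qed (simp add: zhu_bilinear_simps subspace_add)

text \<open>To leading order the two products are \<open>a \<circ> (b\<^sub>(\<^sub>-\<^sub>1\<^sub>) u)\<close> and \<open>a \<circ> (u\<^sub>(\<^sub>-\<^sub>1\<^sub>) b)\<close>, and the normally ordered
  product is commutative up to one Li degree.\<close>

lemma zhu_filtration_commute:
  assumes y: "y \<in> zhu_filtration q K" and x: "x \<in> leading_filtration p N"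
  shows "zhu_product y x - zhu_product x y \<in> zhu_filtration (Suc (p + q)) (N + K)"
  using y
proof (induction rule: zhu_filtration_induct)
  case (below y)
  then show ?case
    by (intro zhu_below_filtration subspace_diff subspace_zhu_below
        zhu_product_below[OF leading_filtration_V_less[OF x] below]) simp_all
next
  case (circle a b i j k l)
  let ?W = "zhu_filtration (Suc (p + q)) (N + K)" and ?u = "component N x"
  have u: "?u \<in> bigraded p N" by (rule leading_filtration_component[OF x])
  have 1: "zhu_product (zhu_circle a b) x - zhu_circle a (md b (-1) ?u) \<in> ?W"
    by (rule zhu_product_circle_leading[OF x circle(1,2)]) (use circle in auto)
  have 2: "zhu_product x (zhu_circle a b) - zhu_circle a (md ?u (-1) b) \<in> ?W"
    by (rule zhu_product_circle_leading[OF x circle(1,2)]) (use circle in auto)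
  have "md b (-1) ?u - md ?u (-1) b \<in> bigraded (Suc (j + p)) (l + N)"
  proof -
    have "md b (-1) ?u \<in> homogeneous (l + N)" "md ?u (-1) b \<in> homogeneous (l + N)"
      using normal_product_bigraded[OF circle(2) u] normal_product_bigraded[OF u circle(2)]
      by (simp_all add: bigraded_def add.commute)
    then show ?thesis
      using normal_product_commute_li[of b j ?u p] circle(2) u
      by (auto simp: bigraded_def intro: subspace_diff[OF subspace_homogeneous])
  qed
  then have 3: "zhu_circle a (md b (-1) ?u - md ?u (-1) b) \<in> ?W"
    by (rule zhu_circle_filtration[OF circle(1)]) (use circle in auto)
  have eq: "zhu_product (zhu_circle a b) x - zhu_product x (zhu_circle a b)
    = (zhu_product (zhu_circle a b) x - zhu_circle a (md b (-1) ?u))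
      - (zhu_product x (zhu_circle a b) - zhu_circle a (md ?u (-1) b))
      + zhu_circle a (md b (-1) ?u - md ?u (-1) b)"
    by (simp add: zhu_diff)
  show ?case
    unfolding eq by (rule subspace_add[OF subspace_zhu_filtration subspace_diff[OF subspace_zhu_filtration 1 2] 3])
next
  case (add y y')
  have "zhu_product (y + y') x - zhu_product x (y + y')
    = (zhu_product y x - zhu_product x y) + (zhu_product y' x - zhu_product x y')"
    by (simp add: zhu_bilinear_simps)
  then show ?case using subspace_add[OF subspace_zhu_filtration add] by simp
qed

text \<open>On a generator \<open>a \<circ> b\<close> both sides act on \<open>b\<close> by normally ordered products, which are
  associative up to one Li degree.\<close>

lemma zhu_filtration_assoc:
  assumes x: "x \<in> leading_filtration p N" and y: "y \<in> leading_filtration q K" and z: "z \<in> zhu_filtration r M"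
  shows "zhu_product (zhu_product x y) z - zhu_product x (zhu_product y z)
    \<in> zhu_filtration (Suc (p + q + r)) (N + K + M)"
  using z
proof (induction rule: zhu_filtration_induct)
  case (below z)
  have "zhu_product (zhu_product x y) z \<in> zhu_below (N + K + M)"
    by (rule zhu_product_below(1)[OF leading_filtration_V_less[OF zhu_product_leading_filtration[OF x y]] below]) simp
  moreover have "zhu_product x (zhu_product y z) \<in> zhu_below (N + K + M)"
    by (rule zhu_product_below(1)[OF leading_filtration_V_less[OF x]
        zhu_product_below(1)[OF leading_filtration_V_less[OF y] below, of "K + M"]]) simp_all
  ultimately show ?case by (intro zhu_below_filtration subspace_diff subspace_zhu_below)
next
  case (circle a b i j k l)
  let ?W = "zhu_filtration (Suc (p + q + r)) (N + K + M)"
  let ?u = "component N x" and ?v = "component K y" and ?c = "zhu_circle a b"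
  have u: "?u \<in> bigraded p N" and v: "?v \<in> bigraded q K"
    by (rule leading_filtration_component[OF x], rule leading_filtration_component[OF y])
  have 1: "zhu_product (zhu_product x y) ?c - zhu_circle a (md (md ?u (-1) ?v) (-1) b) \<in> ?W"
    using zhu_product_circle_leading(1)[OF zhu_product_leading_filtration[OF x y] circle(1,2), of "N + K + M" "Suc (p + q + r)"]
      circle by (simp add: component_zhu_product[OF x y])
  have vb: "md ?v (-1) b \<in> bigraded (q + j) (K + l)"
    by (rule normal_product_bigraded[OF v circle(2)])
  have 2: "zhu_product x (zhu_circle a (md ?v (-1) b)) - zhu_circle a (md ?u (-1) (md ?v (-1) b)) \<in> ?W"
    by (rule zhu_product_circle_leading(1)[OF x circle(1) vb]) (use circle in auto)
  have "zhu_product y ?c - zhu_circle a (md ?v (-1) b) \<in> zhu_filtration (Suc (q + r)) (K + M)"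
    by (rule zhu_product_circle_leading(1)[OF y circle(1,2)]) (use circle in auto)
  from zhu_product_filtration[OF x this]
  have 3: "zhu_product x (zhu_product y ?c - zhu_circle a (md ?v (-1) b)) \<in> ?W"
    by (simp add: add_ac)
  have "md (md ?u (-1) ?v) (-1) b - md ?u (-1) (md ?v (-1) b) \<in> bigraded (Suc (p + q + j)) (N + K + l)"
    using normal_product_bigraded[OF normal_product_bigraded[OF u v] circle(2)]
      normal_product_bigraded[OF u vb] normal_product_assoc_li[of ?u p ?v q b j] u v circle(2)
    by (auto simp: bigraded_def add_ac intro: subspace_diff[OF subspace_homogeneous])
  then have 4: "zhu_circle a (md (md ?u (-1) ?v) (-1) b - md ?u (-1) (md ?v (-1) b)) \<in> ?W"
    by (rule zhu_circle_filtration[OF circle(1)]) (use circle in auto)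
  have "zhu_product (zhu_product x y) ?c - zhu_product x (zhu_product y ?c)
    = (zhu_product (zhu_product x y) ?c - zhu_circle a (md (md ?u (-1) ?v) (-1) b))
      + zhu_circle a (md (md ?u (-1) ?v) (-1) b - md ?u (-1) (md ?v (-1) b))
      - (zhu_product x (zhu_circle a (md ?v (-1) b)) - zhu_circle a (md ?u (-1) (md ?v (-1) b)))
      - zhu_product x (zhu_product y ?c - zhu_circle a (md ?v (-1) b))"
    by (simp add: zhu_diff)
  also have "\<dots> \<in> ?W"
    by (intro subspace_add subspace_diff subspace_zhu_filtration 1 2 3 4)
  finally show ?case .
next
  case (add z z')
  have "zhu_product (zhu_product x y) (z + z') - zhu_product x (zhu_product y (z + z'))
    = (zhu_product (zhu_product x y) z - zhu_product x (zhu_product y z))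
    + (zhu_product (zhu_product x y) z' - zhu_product x (zhu_product y z'))"
    by (simp add: zhu_bilinear_simps)
  then show ?case using subspace_add[OF subspace_zhu_filtration add] by simp
qed

lemma zhu_circle_vac_filtration:
  assumes x: "x \<in> leading_filtration p N"
  shows "zhu_circle x vac \<in> zhu_filtration (Suc p) (Suc N)"
proof -
  obtain u w where u: "x = u + w" "u \<in> bigraded p N" "w \<in> V_less N"
    using leading_filtration_cases[OF x] .
  have "zhu_circle u vac \<in> zhu_filtration (Suc p) (Suc N)"
    by (rule zhu_circle_filtration[OF u(2) vac_bigraded]) simp_all
  then show ?thesis
    unfolding u(1) zhu_bilinear_simps
    using subspace_add[OF subspace_zhu_filtration _ zhu_below_filtration[OF zhu_circle_vac_below[OF u(3)]]]
    by blast
qed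

text \<open>By \<open>zhu_product_circle\<close>, \<open>x * (y \<circ> 1)\<close> is \<open>v \<circ> u\<close> to leading order, where \<open>u\<close> and \<open>v\<close> are the leading
  components of \<open>x\<close> and \<open>y\<close>; so the claim reduces to \<open>zhu_circle_leibniz\<close>.\<close>

lemma zhu_circle_vac_leibniz:
  assumes x: "x \<in> leading_filtration p N" and y: "y \<in> leading_filtration q K"
  shows "zhu_circle (zhu_product x y) vac - (zhu_product (zhu_circle x vac) y + zhu_product x (zhu_circle y vac))
    \<in> zhu_filtration (Suc (Suc (p + q))) (Suc (N + K))"
proof -
  let ?W = "zhu_filtration (Suc (Suc (p + q))) (Suc (N + K))"
  have half: "zhu_product x (zhu_circle y vac) - zhu_circle (component K y) (component N x)
      \<in> zhu_filtration (Suc (Suc (p + q))) (Suc (N + K))"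
    if x: "x \<in> leading_filtration p N" and y: "y \<in> leading_filtration q K" for x y p q N K
  proof -
    have 1: "zhu_product x (zhu_circle (component K y) vac)
        - zhu_circle (component K y) (md (component N x) (-1) vac) \<in> zhu_filtration (Suc (Suc (p + q))) (Suc (N + K))"
      by (rule zhu_product_circle_leading(1)[OF x leading_filtration_component[OF y] vac_bigraded]) auto
    have 2: "zhu_product x (zhu_circle (y - component K y) vac) \<in> zhu_below (Suc (N + K))"
      by (rule zhu_product_below(1)[OF leading_filtration_V_less[OF x]
          zhu_circle_vac_below[OF leading_filtration_lower[OF y]]]) simp
    show ?thesis
      using subspace_add[OF subspace_zhu_filtration 1 zhu_below_filtration[OF 2]]
      by (simp add: zhu_diff vac_right)
  qed
  let ?u = "component N x" and ?v = "component K y"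
  have 1: "zhu_product x (zhu_circle y vac) - zhu_circle ?v ?u \<in> ?W" by (rule half[OF x y])
  have 2: "zhu_product y (zhu_circle x vac) - zhu_circle ?u ?v \<in> ?W"
    using half[OF y x] by (simp add: add.commute)
  have 3: "zhu_product (zhu_circle x vac) y - zhu_product y (zhu_circle x vac) \<in> ?W"
    using zhu_filtration_commute[OF zhu_circle_vac_filtration[OF x] y] by (simp add: add.commute)
  have 4: "zhu_circle (md ?u (-1) ?v) vac - zhu_circle ?u ?v - zhu_circle ?v ?u \<in> ?W"
    using zhu_circle_leibniz[OF leading_filtration_component[OF x] leading_filtration_component[OF y]] by simp
  have 5: "zhu_circle (zhu_product x y - md ?u (-1) ?v) vac \<in> ?W"
    by (rule zhu_below_filtration[OF zhu_circle_vac_below[OF zhu_product_leading_component[OF x y]]])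
  have "zhu_circle (zhu_product x y) vac - (zhu_product (zhu_circle x vac) y + zhu_product x (zhu_circle y vac))
    = zhu_circle (zhu_product x y - md ?u (-1) ?v) vac
      + (zhu_circle (md ?u (-1) ?v) vac - zhu_circle ?u ?v - zhu_circle ?v ?u)
      - (zhu_product x (zhu_circle y vac) - zhu_circle ?v ?u)
      - (zhu_product y (zhu_circle x vac) - zhu_circle ?u ?v)
      - (zhu_product (zhu_circle x vac) y - zhu_product y (zhu_circle x vac))"
    by (simp add: zhu_diff)
  also have "\<dots> \<in> ?W"
    by (intro subspace_add subspace_diff subspace_zhu_filtration 1 2 3 4 5)
  finally show ?thesis .
qed

section \<open>A commutative differential algebra of leading terms\<close>

text \<open>The component of degree \<open>N\<close> and Li degree \<open>p\<close> of \<open>R\<^sub>V \<oplus> X\<close> is the quotient of \<open>rees p N\<close> by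
  \<open>rees_ideal p N\<close>: for \<open>p = 0\<close> it is the component of degree \<open>N\<close> of \<open>R\<^sub>V\<close>, for \<open>p > 0\<close> it is \<open>G\<^sup>p / G\<^sup>p\<^sup>+\<^sup>1\<close>.
  Zhu's product and \<open>x \<mapsto> x \<circ> 1\<close> turn the quotient into a commutative differential algebra.\<close>

definition rees :: "nat \<Rightarrow> nat \<Rightarrow> 'v set" where
  "rees p N = (if p = 0 then leading_filtration 0 N else zhu_filtration p N)"

definition rees_ideal :: "nat \<Rightarrow> nat \<Rightarrow> 'v set" where
  "rees_ideal p N = (if p = 0 then leading_filtration 1 N else zhu_filtration (Suc p) N)"

lemma subspace_rees [simp]: "subspace (rees p N)" "subspace (rees_ideal p N)"
  by (simp_all add: rees_def rees_ideal_def)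

lemma rees_leading: "x \<in> rees p N \<Longrightarrow> x \<in> leading_filtration p N"
  by (auto simp: rees_def zhu_filtration_leading split: if_splits)

lemma rees_ideal_leading: "x \<in> rees_ideal p N \<Longrightarrow> x \<in> leading_filtration (Suc p) N"
  by (auto simp: rees_ideal_def zhu_filtration_leading split: if_splits)

lemma rees_ideal_rees: "x \<in> rees_ideal p N \<Longrightarrow> x \<in> rees p N"
  using leading_filtration_antimono[of 0 1 x N] zhu_filtration_antimono[of p "Suc p" x N]
  by (auto simp: rees_def rees_ideal_def split: if_splits)

lemma zhu_filtration_rees_ideal: "x \<in> zhu_filtration (Suc p) N \<Longrightarrow> x \<in> rees_ideal p N"
  using zhu_filtration_leading[of x "Suc p" N] by (auto simp: rees_ideal_def)

lemma rees_commute: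
  assumes x: "x \<in> rees p N" and y: "y \<in> rees q K"
  shows "zhu_product x y - zhu_product y x \<in> rees_ideal (p + q) (N + K)"
proof -
  have pos: "zhu_product y x - zhu_product x y \<in> rees_ideal (p + q) (N + K)"
    if "x \<in> rees p N" "y \<in> rees q K" "q > 0" for x y p q N K
    using zhu_filtration_commute[of y q K x p N] that
    by (intro zhu_filtration_rees_ideal) (auto simp: rees_leading rees_def split: if_splits)
  consider "q > 0" | "p > 0" | "p = 0" "q = 0" by blast
  then show ?thesis
  proof cases
    case 1
    have "- (zhu_product y x - zhu_product x y) \<in> rees_ideal (p + q) (N + K)"
      by (rule subspace_neg[OF subspace_rees(2) pos[OF x y 1]])
    then show ?thesis by simp
  next
    case 2
    then show ?thesis using pos[OF y x] by (simp add: add.commute)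
  next
    case 3
    note xy = rees_leading[OF x] rees_leading[OF y]
    have "zhu_product x y - zhu_product y x \<in> leading_filtration 0 (N + K)"
      using zhu_product_leading_filtration[OF xy] zhu_product_leading_filtration[OF xy(2,1)] 3
      by (simp add: subspace_diff add.commute)
    moreover have "component (N + K) (zhu_product x y - zhu_product y x)
        = md (component N x) (-1) (component K y) - md (component K y) (-1) (component N x)"
      using component_zhu_product[OF xy] component_zhu_product[OF xy(2,1)]
      by (simp add: component_diff add.commute)
    moreover have "\<dots> \<in> li_filtration 1"
      using normal_product_commute_li[of _ 0 _ 0] by simp
    ultimately show ?thesis using 3 by (simp add: rees_ideal_def leading_filtration_def)
  qed
qed

lemma rees_product:
  assumes x: "x \<in> rees p N" and y: "y \<in> rees q K"
  shows "zhu_product x y \<in> rees (p + q) (N + K)"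
proof -
  have pos: "zhu_product x y \<in> rees (p + q) (N + K)"
    if "x \<in> rees p N" "y \<in> rees q K" "q > 0" for x y p q N K
    using zhu_product_filtration[OF rees_leading[OF that(1)], of y q K] that
    by (simp add: rees_def)
  consider "q > 0" | "p > 0" | "p = 0" "q = 0" by blast
  then show ?thesis
  proof cases
    case 1
    then show ?thesis using pos[OF x y] by simp
  next
    case 2
    have "zhu_product y x \<in> rees (p + q) (N + K)"
      using pos[OF y x 2] by (simp add: add.commute)
    from subspace_add[OF subspace_rees(1) this rees_ideal_rees[OF rees_commute[OF x y]]]
    show ?thesis by simp
  next
    case 3
    then show ?thesis using zhu_product_leading_filtration[OF rees_leading[OF x] rees_leading[OF y]]
      by (simp add: rees_def)
  qed
qed

lemma rees_ideal_product:
  assumes x: "x \<in> rees_ideal p N" and y: "y \<in> rees q K"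
  shows "zhu_product x y \<in> rees_ideal (p + q) (N + K)"
proof -
  consider "q > 0" | "q = 0" "p > 0" | "p = 0" "q = 0" by blast
  then show ?thesis
  proof cases
    case 1
    then show ?thesis
      using zhu_product_filtration[OF rees_ideal_leading[OF x], of y q K] y
      by (intro zhu_filtration_rees_ideal) (simp add: rees_def)
  next
    case 2
    then have x': "x \<in> zhu_filtration (Suc p) N" and y': "y \<in> leading_filtration 0 K"
      using x y by (simp_all add: rees_def rees_ideal_def)
    have "zhu_product x y - zhu_product y x \<in> zhu_filtration (Suc p) (N + K)"
      using zhu_filtration_antimono[OF _ zhu_filtration_commute[OF x' y'], of "Suc p"] by (simp add: add.commute)
    moreover have "zhu_product y x \<in> zhu_filtration (Suc p) (N + K)"
      using zhu_product_filtration[OF y' x'] by (simp add: add.commute)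
    ultimately have "zhu_product x y - zhu_product y x + zhu_product y x \<in> zhu_filtration (Suc p) (N + K)"
      by (rule subspace_add[OF subspace_zhu_filtration])
    then show ?thesis using 2 by (simp add: rees_ideal_def)
  next
    case 3
    then show ?thesis using zhu_product_leading_filtration[OF rees_ideal_leading[OF x] rees_leading[OF y]]
      by (simp add: rees_ideal_def)
  qed
qed

lemma rees_ideal_product':
  assumes x: "x \<in> rees p N" and y: "y \<in> rees_ideal q K"
  shows "zhu_product x y \<in> rees_ideal (p + q) (N + K)"
proof -
  have "zhu_product y x \<in> rees_ideal (p + q) (N + K)"
    using rees_ideal_product[OF y x] by (simp add: add.commute)
  from subspace_add[OF subspace_rees(2) this rees_commute[OF x rees_ideal_rees[OF y]]]
  show ?thesis by simp
qed

text \<open>If a factor has positive Li degree, commutativity moves it to the third place, where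
  \<open>zhu_filtration_assoc\<close> applies. Otherwise the claim is associativity of \<open>R\<^sub>V\<close>.\<close>

lemma rees_assoc:
  assumes x: "x \<in> rees p N" and y: "y \<in> rees q K" and z: "z \<in> rees r M"
  shows "zhu_product (zhu_product x y) z - zhu_product x (zhu_product y z) \<in> rees_ideal (p + q + r) (N + K + M)"
proof -
  let ?I = "rees_ideal (p + q + r) (N + K + M)"
  have pos: "zhu_product (zhu_product x y) z - zhu_product x (zhu_product y z) \<in> rees_ideal (p + q + r) (N + K + M)"
    if "x \<in> rees p N" "y \<in> rees q K" "z \<in> rees r M" "r > 0" for x y z p q r N K M
    using zhu_filtration_assoc[OF rees_leading[OF that(1)] rees_leading[OF that(2)], of z r M] that
    by (intro zhu_filtration_rees_ideal) (simp add: rees_def)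
  have left: "zhu_product (zhu_product x y - zhu_product y x) z \<in> rees_ideal (p + q + r) (N + K + M)"
    if "x \<in> rees p N" "y \<in> rees q K" "z \<in> rees r M" for x y z p q r N K M
    by (rule rees_ideal_product[OF rees_commute[OF that(1,2)] that(3)])
  have out: "zhu_product (zhu_product x y) z - zhu_product z (zhu_product x y) \<in> rees_ideal (p + q + r) (N + K + M)"
    if "x \<in> rees p N" "y \<in> rees q K" "z \<in> rees r M" for x y z p q r N K M
    by (rule rees_commute[OF rees_product[OF that(1,2)] that(3)])
  have right: "zhu_product x (zhu_product y z - zhu_product z y) \<in> rees_ideal (p + q + r) (N + K + M)"
    if "x \<in> rees p N" "y \<in> rees q K" "z \<in> rees r M" for x y z p q r N K M
    using rees_ideal_product'[OF that(1) rees_commute[OF that(2,3)]] by (simp add: add_ac)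
  note S_add = subspace_add[OF subspace_rees(2)[of "p + q + r" "N + K + M"]]
    and S_diff = subspace_diff[OF subspace_rees(2)[of "p + q + r" "N + K + M"]]
  consider "r > 0" | "q > 0" | "p > 0" | "p = 0" "q = 0" "r = 0" by blast
  then show ?thesis
  proof cases
    case 1
    show ?thesis by (rule pos[OF x y z 1])
  next
    case 2
    have "zhu_product (zhu_product x y) z - zhu_product x (zhu_product y z)
      = (zhu_product (zhu_product x y) z - zhu_product z (zhu_product x y))
        - (zhu_product (zhu_product z x) y - zhu_product z (zhu_product x y))
        + zhu_product (zhu_product z x - zhu_product x z) y
        + (zhu_product (zhu_product x z) y - zhu_product x (zhu_product z y))
        + zhu_product x (zhu_product z y - zhu_product y z)"
      by (simp add: zhu_diff)
    also have "\<dots> \<in> ?I"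
      using pos[OF z x y 2] left[OF z x y] pos[OF x z y 2] right[OF x z y]
      by (intro S_add[OF S_add[OF S_add[OF S_diff[OF out[OF x y z]]]]]) (simp_all only: add_ac)
    finally show ?thesis .
  next
    case 3
    have "zhu_product (zhu_product x y) z - zhu_product x (zhu_product y z)
      = (zhu_product (zhu_product x y) z - zhu_product z (zhu_product x y))
        + zhu_product z (zhu_product x y - zhu_product y x)
        - (zhu_product (zhu_product z y) x - zhu_product z (zhu_product y x))
        + zhu_product (zhu_product z y - zhu_product y z) x
        + (zhu_product (zhu_product y z) x - zhu_product x (zhu_product y z))"
      by (simp add: zhu_diff)
    also have "\<dots> \<in> ?I"
      using right[OF z x y] pos[OF z y x 3] left[OF z y x] out[OF y z x]
      by (intro S_add[OF S_add[OF S_diff[OF S_add[OF out[OF x y z]]]]]) (simp_all only: add_ac)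
    finally show ?thesis .
  next
    case 4
    note xyz = rees_leading[OF x] rees_leading[OF y] rees_leading[OF z]
    note xy = zhu_product_leading_filtration[OF xyz(1,2)] and yz = zhu_product_leading_filtration[OF xyz(2,3)]
    have "zhu_product (zhu_product x y) z - zhu_product x (zhu_product y z) \<in> leading_filtration 0 (N + K + M)"
      using zhu_product_leading_filtration[OF xy xyz(3)] zhu_product_leading_filtration[OF xyz(1) yz] 4
      by (simp add: subspace_diff add_ac)
    moreover have "component (N + K + M) (zhu_product (zhu_product x y) z - zhu_product x (zhu_product y z))
        = md (md (component N x) (-1) (component K y)) (-1) (component M z)
          - md (component N x) (-1) (md (component K y) (-1) (component M z))"
      using component_zhu_product[OF xy xyz(3)] component_zhu_product[OF xyz(1) yz]
        component_zhu_product[OF xyz(1,2)] component_zhu_product[OF xyz(2,3)]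
      by (simp add: component_diff add.assoc)
    moreover have "\<dots> \<in> li_filtration 1"
      using normal_product_assoc_li[of _ 0 _ 0 _ 0] by simp
    ultimately show ?thesis using 4 by (simp add: rees_ideal_def leading_filtration_def)
  qed
qed

lemma rees_derivation:
  "x \<in> rees p N \<Longrightarrow> zhu_circle x vac \<in> rees (Suc p) (Suc N)"
  "x \<in> rees_ideal p N \<Longrightarrow> zhu_circle x vac \<in> rees_ideal (Suc p) (Suc N)"
  using zhu_circle_vac_filtration[OF rees_leading, of x p N] zhu_circle_vac_filtration[OF rees_ideal_leading, of x p N]
  by (simp_all add: rees_def rees_ideal_def)

lemma rees_leibniz:
  assumes "x \<in> rees p N" "y \<in> rees q K"
  shows "zhu_circle (zhu_product x y) vac - (zhu_product (zhu_circle x vac) y + zhu_product x (zhu_circle y vac))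
    \<in> rees_ideal (Suc (p + q)) (Suc (N + K))"
  by (rule zhu_filtration_rees_ideal, rule zhu_circle_vac_leibniz) (use assms rees_leading in auto)

section \<open>Jet expressions evaluated in leading terms\<close>

definition representative :: "'v set \<Rightarrow> 'v" where
  "representative x = (SOME a. a \<in> x)"

text \<open>The value of a jet expression in \<open>R\<^sub>V \<oplus> X\<close>, represented by a family of vectors with index \<open>(p, N)\<close>.
  On the families themselves the product is neither associative nor commutative; they need to be
  compared modulo \<open>rees_ideal\<close> only. The derivation raises both indices, as \<open>a \<circ> 1 = T a + deg a a\<close>
  has leading term \<open>T a\<close>.\<close>

primrec rees_eval :: "'v set jet_term \<Rightarrow> nat \<Rightarrow> nat \<Rightarrow> 'v" where
  "rees_eval (Gen x) = (\<lambda>p N. if p = 0 then component N (representative x) else 0)"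
| "rees_eval (Const c) = (\<lambda>p N. if p = 0 \<and> N = 0 then c *s vac else 0)"
| "rees_eval (Add s t) = (\<lambda>p N. rees_eval s p N + rees_eval t p N)"
| "rees_eval (Mul s t) = (\<lambda>p N. \<Sum>q\<le>p. \<Sum>K\<le>N.
     zhu_product (rees_eval s q K) (rees_eval t (p - q) (N - K)))"
| "rees_eval (Der s) = (\<lambda>p N. case p of 0 \<Rightarrow> 0 | Suc q \<Rightarrow> (case N of 0 \<Rightarrow> 0 | Suc K \<Rightarrow>
     zhu_circle (rees_eval s q K) vac))"

lemma representative_vcoset: "subspace K \<Longrightarrow> representative (vcoset K a) - a \<in> K"
  unfolding representative_def vcoset_mem[symmetric] by (rule someI) (rule vcoset_self)

lemma vac_rees: "c *s vac \<in> rees 0 0"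
  using bigraded_leading_filtration[OF subspace_scale[OF subspace_bigraded vac_bigraded]] by (simp add: rees_def)

lemma rees_eval_rees: "rees_eval t p N \<in> rees p N"
proof (induction t arbitrary: p N)
  case (Gen x)
  show ?case
    by (auto simp: rees_def subspace_0 intro!: bigraded_leading_filtration homogeneous_bigraded)
next
  case (Const c)
  show ?case using vac_rees by (simp add: subspace_0)
next
  case (Add s t)
  then show ?case by (simp add: subspace_add)
next
  case (Mul s t)
  have "zhu_product (rees_eval s q K) (rees_eval t (p - q) (N - K)) \<in> rees p N" if "q \<le> p" "K \<le> N" for q K
    using rees_product[OF Mul.IH(1)[of q K] Mul.IH(2)[of "p - q" "N - K"]] that by simp
  then show ?case by (auto intro!: subspace_sum)
next
  case (Der s)
  then show ?case by (auto simp: subspace_0 rees_derivation split: nat.split)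
qed

lemma zhu_product_vac_left: "zhu_product vac b = b"
  by (simp add: zhu_product_homogeneous[OF vac_homogeneous] vac_left)

lemma rees_eval_const_mult: "rees_eval (Mul (Const c) s) p N = c *s rees_eval s p N"
proof -
  have "rees_eval (Mul (Const c) s) p N
      = (\<Sum>q\<le>p. \<Sum>K\<le>N. if q = 0 then (if K = 0 then c *s rees_eval s p N else 0) else 0)"
    unfolding rees_eval.simps
    by (intro sum.cong HOL.refl) (auto simp: zhu_bilinear_simps zhu_product_vac_left)
  also have "\<dots> = (\<Sum>q\<le>p. if q = 0 then (\<Sum>K\<le>N. if K = 0 then c *s rees_eval s p N else 0) else 0)"
    by (intro sum.cong HOL.refl) auto
  finally show ?thesis by simp
qed

lemma sum_triangle_reindex:
  "(\<Sum>j\<le>k. \<Sum>i\<le>j. f i (j - i) (k - j)) = (\<Sum>j\<le>k. \<Sum>i\<le>k - j. f j i (k - j - i))"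
  for f :: "nat \<Rightarrow> nat \<Rightarrow> nat \<Rightarrow> 'a::comm_monoid_add"
  unfolding sum.Sigma[OF finite_atMost ballI[OF finite_atMost]]
  by (rule sum.reindex_bij_witness[of _ "\<lambda>(j, i). (j + i, j)" "\<lambda>(j, i). (i, j - i)"]) auto

lemma convolution_assoc:
  fixes f :: "nat \<Rightarrow> nat \<Rightarrow> nat \<Rightarrow> nat \<Rightarrow> nat \<Rightarrow> nat \<Rightarrow> 'a::comm_monoid_add"
  shows "(\<Sum>q\<le>p. \<Sum>K\<le>N. \<Sum>q'\<le>q. \<Sum>K'\<le>K. f q' K' (q - q') (K - K') (p - q) (N - K))
    = (\<Sum>q\<le>p. \<Sum>K\<le>N. \<Sum>q'\<le>p - q. \<Sum>K'\<le>N - K. f q K q' K' (p - q - q') (N - K - K'))"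
proof -
  have "(\<Sum>q\<le>p. \<Sum>K\<le>N. \<Sum>q'\<le>q. \<Sum>K'\<le>K. f q' K' (q - q') (K - K') (p - q) (N - K))
      = (\<Sum>q\<le>p. \<Sum>q'\<le>q. \<Sum>K\<le>N. \<Sum>K'\<le>K. f q' K' (q - q') (K - K') (p - q) (N - K))"
    by (rule sum.cong[OF HOL.refl]) (rule sum.swap)
  also have "\<dots> = (\<Sum>q\<le>p. \<Sum>q'\<le>q. \<Sum>K\<le>N. \<Sum>K'\<le>N - K. f q' K (q - q') K' (p - q) (N - K - K'))"
    by (rule sum.cong[OF HOL.refl], rule sum.cong[OF HOL.refl], rule sum_triangle_reindex)
  also have "\<dots> = (\<Sum>q\<le>p. \<Sum>q'\<le>p - q. \<Sum>K\<le>N. \<Sum>K'\<le>N - K. f q K q' K' (p - q - q') (N - K - K'))"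
    by (rule sum_triangle_reindex[where f = "\<lambda>x y z. \<Sum>K\<le>N. \<Sum>K'\<le>N - K. f x K y K' z (N - K - K')"])
  also have "\<dots> = (\<Sum>q\<le>p. \<Sum>K\<le>N. \<Sum>q'\<le>p - q. \<Sum>K'\<le>N - K. f q K q' K' (p - q - q') (N - K - K'))"
    by (rule sum.cong[OF HOL.refl]) (rule sum.swap)
  finally show ?thesis .
qed

lemma convolution_commute:
  fixes f :: "nat \<Rightarrow> nat \<Rightarrow> nat \<Rightarrow> nat \<Rightarrow> 'a::comm_monoid_add"
  shows "(\<Sum>q\<le>p. \<Sum>K\<le>N. f q K (p - q) (N - K)) = (\<Sum>q\<le>p. \<Sum>K\<le>N. f (p - q) (N - K) q K)"
proof -
  have 1: "(\<Sum>q\<le>p. g q (p - q)) = (\<Sum>q\<le>p. g (p - q) q)" for p and g :: "nat \<Rightarrow> nat \<Rightarrow> 'a"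
    by (rule sum.reindex_bij_witness[of _ "\<lambda>i. p - i" "\<lambda>i. p - i"]) auto
  have "(\<Sum>q\<le>p. \<Sum>K\<le>N. f q K (p - q) (N - K)) = (\<Sum>q\<le>p. \<Sum>K\<le>N. f (p - q) K q (N - K))"
    by (rule 1[where g = "\<lambda>x y. \<Sum>K\<le>N. f x K y (N - K)"])
  also have "\<dots> = (\<Sum>q\<le>p. \<Sum>K\<le>N. f (p - q) (N - K) q K)"
    by (rule sum.cong[OF HOL.refl], rule 1)
  finally show ?thesis .
qed

definition rees_cong :: "(nat \<Rightarrow> nat \<Rightarrow> 'v) \<Rightarrow> (nat \<Rightarrow> nat \<Rightarrow> 'v) \<Rightarrow> bool" where
  "rees_cong f g \<longleftrightarrow> (\<forall>p N. f p N - g p N \<in> rees_ideal p N)"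

lemma rees_cong_refl: "f = g \<Longrightarrow> rees_cong f g"
  by (simp add: rees_cong_def subspace_0)

lemma rees_cong_sym:
  assumes "rees_cong f g"
  shows "rees_cong g f"
  unfolding rees_cong_def
proof (intro allI)
  fix p N
  have "- (f p N - g p N) \<in> rees_ideal p N"
    using assms by (intro subspace_neg subspace_rees) (simp add: rees_cong_def)
  then show "g p N - f p N \<in> rees_ideal p N" by simp
qed

lemma rees_cong_trans:
  assumes "rees_cong f g" "rees_cong g h"
  shows "rees_cong f h"
  unfolding rees_cong_def
proof (intro allI)
  fix p N
  have "(f p N - g p N) + (g p N - h p N) \<in> rees_ideal p N"
    using assms by (intro subspace_add subspace_rees) (simp_all add: rees_cong_def)
  then show "f p N - h p N \<in> rees_ideal p N" by simp
qed

lemma rees_cong_add: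
  assumes "rees_cong f f'" "rees_cong g g'"
  shows "rees_cong (\<lambda>p N. f p N + g p N) (\<lambda>p N. f' p N + g' p N)"
  unfolding rees_cong_def
proof (intro allI)
  fix p N
  have "(f p N - f' p N) + (g p N - g' p N) \<in> rees_ideal p N"
    using assms by (intro subspace_add subspace_rees) (simp_all add: rees_cong_def)
  then show "f p N + g p N - (f' p N + g' p N) \<in> rees_ideal p N" by (simp add: add_diff_add)
qed

lemma rees_cong_sum2:
  assumes "\<And>q K. q \<le> p \<Longrightarrow> K \<le> N \<Longrightarrow> f q K - g q K \<in> rees_ideal p N"
  shows "(\<Sum>q\<le>p. \<Sum>K\<le>N. f q K) - (\<Sum>q\<le>p. \<Sum>K\<le>N. g q K) \<in> rees_ideal p N"
  unfolding sum_subtractf[symmetric] by (intro subspace_sum subspace_rees) (use assms in auto)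

lemma rees_eval_mul_cong:
  assumes "rees_cong (rees_eval s) (rees_eval s')" "rees_cong (rees_eval t) (rees_eval t')"
  shows "rees_cong (rees_eval (Mul s t)) (rees_eval (Mul s' t'))"
  unfolding rees_cong_def rees_eval.simps
proof (intro allI rees_cong_sum2)
  fix p N q K :: nat
  assume le: "q \<le> p" "K \<le> N"
  have 1: "zhu_product (rees_eval s q K - rees_eval s' q K) (rees_eval t (p - q) (N - K)) \<in> rees_ideal p N"
    using rees_ideal_product[OF _ rees_eval_rees, of _ q K t "p - q" "N - K"] assms(1) le
    by (simp add: rees_cong_def)
  have 2: "zhu_product (rees_eval s' q K) (rees_eval t (p - q) (N - K) - rees_eval t' (p - q) (N - K)) \<in> rees_ideal p N"
    using rees_ideal_product'[OF rees_eval_rees, of _ "p - q" "N - K" s' q K] assms(2) le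
    by (simp add: rees_cong_def)
  show "zhu_product (rees_eval s q K) (rees_eval t (p - q) (N - K))
      - zhu_product (rees_eval s' q K) (rees_eval t' (p - q) (N - K)) \<in> rees_ideal p N"
    using subspace_add[OF subspace_rees(2) 1 2] by (simp add: zhu_diff)
qed

lemma rees_eval_mul_assoc: "rees_cong (rees_eval (Mul (Mul s t) u)) (rees_eval (Mul s (Mul t u)))"
  unfolding rees_cong_def
proof (intro allI)
  fix p N
  let ?f = "\<lambda>q1 K1 q2 K2 q3 K3. zhu_product (zhu_product (rees_eval s q1 K1) (rees_eval t q2 K2)) (rees_eval u q3 K3)"
  let ?g = "\<lambda>q1 K1 q2 K2 q3 K3. zhu_product (rees_eval s q1 K1) (zhu_product (rees_eval t q2 K2) (rees_eval u q3 K3))"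
  have l: "rees_eval (Mul (Mul s t) u) p N
    = (\<Sum>q\<le>p. \<Sum>K\<le>N. \<Sum>q'\<le>p - q. \<Sum>K'\<le>N - K. ?f q K q' K' (p - q - q') (N - K - K'))"
    unfolding rees_eval.simps zhu_sum by (rule convolution_assoc[where f = ?f])
  have r: "rees_eval (Mul s (Mul t u)) p N
    = (\<Sum>q\<le>p. \<Sum>K\<le>N. \<Sum>q'\<le>p - q. \<Sum>K'\<le>N - K. ?g q K q' K' (p - q - q') (N - K - K'))"
    by (simp only: rees_eval.simps zhu_sum)
  show "rees_eval (Mul (Mul s t) u) p N - rees_eval (Mul s (Mul t u)) p N \<in> rees_ideal p N"
    unfolding l r sum_subtractf[symmetric]
  proof (intro subspace_sum subspace_rees)
    fix q K q' K' :: nat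
    assume "q \<in> {..p}" "K \<in> {..N}" "q' \<in> {..p - q}" "K' \<in> {..N - K}"
    then have "q + q' + (p - q - q') = p" "K + K' + (N - K - K') = N" by auto
    then show "?f q K q' K' (p - q - q') (N - K - K') - ?g q K q' K' (p - q - q') (N - K - K') \<in> rees_ideal p N"
      using rees_assoc[OF rees_eval_rees rees_eval_rees rees_eval_rees,
          of s q K t q' K' u "p - q - q'" "N - K - K'"] by simp
  qed
qed

lemma rees_eval_mul_commute: "rees_cong (rees_eval (Mul s t)) (rees_eval (Mul t s))"
  unfolding rees_cong_def
proof (intro allI)
  fix p N
  have r: "rees_eval (Mul t s) p N = (\<Sum>q\<le>p. \<Sum>K\<le>N. zhu_product (rees_eval t (p - q) (N - K)) (rees_eval s q K))"
    unfolding rees_eval.simps by (rule convolution_commute)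
  show "rees_eval (Mul s t) p N - rees_eval (Mul t s) p N \<in> rees_ideal p N"
    unfolding r unfolding rees_eval.simps
  proof (rule rees_cong_sum2)
    fix q K assume "q \<le> p" "K \<le> N"
    then show "zhu_product (rees_eval s q K) (rees_eval t (p - q) (N - K))
        - zhu_product (rees_eval t (p - q) (N - K)) (rees_eval s q K) \<in> rees_ideal p N"
      using rees_commute[OF rees_eval_rees rees_eval_rees, of s q K t "p - q" "N - K"] by simp
  qed
qed

lemma rees_eval_der_mul:
  "rees_cong (rees_eval (Der (Mul s t))) (rees_eval (Add (Mul (Der s) t) (Mul s (Der t))))"
  unfolding rees_cong_def
proof (intro allI)
  fix p N
  let ?d = "\<lambda>x. zhu_circle x vac"
  show "rees_eval (Der (Mul s t)) p N - rees_eval (Add (Mul (Der s) t) (Mul s (Der t))) p N \<in> rees_ideal p N"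
  proof (cases "\<exists>p' N'. p = Suc p' \<and> N = Suc N'")
    case False
    then have "p = 0 \<or> N = 0" by (metis not0_implies_Suc)
    then have "rees_eval (Der s) q K = 0 \<or> q \<noteq> 0 \<and> K \<noteq> 0" for s q K by (auto split: nat.split)
    then have z: "rees_eval (Der s) q K = 0" if "q \<le> p" "K \<le> N" for s q K
      using \<open>p = 0 \<or> N = 0\<close> that by (metis le_zero_eq)
    have "rees_eval (Mul (Der s) t) p N = 0"
      unfolding rees_eval.simps(4) by (intro sum.neutral ballI) (simp add: z del: rees_eval.simps)
    moreover have "rees_eval (Mul s (Der t)) p N = 0"
      unfolding rees_eval.simps(4) by (intro sum.neutral ballI) (simp add: z del: rees_eval.simps)
    moreover have "rees_eval (Der (Mul s t)) p N = 0"
      by (rule z) simp_all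
    ultimately show ?thesis unfolding rees_eval.simps(3) by (simp add: subspace_0 del: rees_eval.simps)
  next
    case True
    then obtain p' N' where p: "p = Suc p'" "N = Suc N'" by blast
    have l: "rees_eval (Der (Mul s t)) p N
        = (\<Sum>q\<le>p'. \<Sum>K\<le>N'. ?d (zhu_product (rees_eval s q K) (rees_eval t (p' - q) (N' - K))))"
      by (simp add: p zhu_sum)
    have a: "rees_eval (Mul (Der s) t) p N
        = (\<Sum>q\<le>p'. \<Sum>K\<le>N'. zhu_product (?d (rees_eval s q K)) (rees_eval t (p' - q) (N' - K)))"
      by (simp add: p sum.atMost_Suc_shift del: sum.atMost_Suc)
    have b: "rees_eval (Mul s (Der t)) p N
        = (\<Sum>q\<le>p'. \<Sum>K\<le>N'. zhu_product (rees_eval s q K) (?d (rees_eval t (p' - q) (N' - K))))"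
      by (simp add: p Suc_diff_le)
    have r: "rees_eval (Add (Mul (Der s) t) (Mul s (Der t))) p N
      = (\<Sum>q\<le>p'. \<Sum>K\<le>N'. zhu_product (?d (rees_eval s q K)) (rees_eval t (p' - q) (N' - K))
          + zhu_product (rees_eval s q K) (?d (rees_eval t (p' - q) (N' - K))))"
      unfolding rees_eval.simps(3) a b by (simp add: sum.distrib)
    show ?thesis
      unfolding l r sum_subtractf[symmetric]
    proof (intro subspace_sum subspace_rees)
      fix q K assume "q \<in> {..p'}" "K \<in> {..N'}"
      then show "?d (zhu_product (rees_eval s q K) (rees_eval t (p' - q) (N' - K)))
        - (zhu_product (?d (rees_eval s q K)) (rees_eval t (p' - q) (N' - K))
          + zhu_product (rees_eval s q K) (?d (rees_eval t (p' - q) (N' - K)))) \<in> rees_ideal p N"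
        using rees_leibniz[OF rees_eval_rees rees_eval_rees, of s q K t "p' - q" "N' - K"] p by simp
    qed
  qed
qed

lemma component_rees_ideal_0: "v \<in> li_filtration 1 \<Longrightarrow> component N v \<in> rees_ideal 0 N"
  by (simp add: rees_ideal_def component_li bigraded_leading_filtration bigraded_def)

lemma rees_eval_gen_cong:
  assumes "\<And>N. component N (representative x) - f 0 N \<in> rees_ideal 0 N" "\<And>p N. p > 0 \<Longrightarrow> f p N = 0"
  shows "rees_cong (rees_eval (Gen x)) f"
  using assms by (simp add: rees_cong_def subspace_0)

lemma C2_representative:
  assumes "x \<in> carrier C2_algebra"
  shows "x = vcoset (li_filtration 1) (representative x)"
proof -
  obtain a where x: "x = vcoset (li_filtration 1) a" using assms by (auto simp: C2_carrier)
  show ?thesis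
    unfolding x by (rule vcoset_eqI[OF subspace_li representative_vcoset[OF subspace_li], symmetric])
qed

text \<open>This is the homomorphism from the jet algebra to \<open>R\<^sub>V \<oplus> X\<close>: each rule of \<open>jet_eq\<close> is an
  axiom of commutative differential algebras, or says that \<open>R\<^sub>V\<close> is mapped homomorphically.\<close>

lemma jet_eq_rees_cong:
  assumes "jet_eq C2_algebra s t"
  shows "rees_cong (rees_eval s) (rees_eval t)"
  using assms
proof (induction rule: jet_eq.induct)
  case (sym s t)
  then show ?case using rees_cong_sym by blast
next
  case (trans s t u)
  then show ?case by (blast intro: rees_cong_trans)
next
  case (cong_add s s' t t')
  then show ?case using rees_cong_add by simp
next
  case (cong_mul s s' t t')
  then show ?case using rees_eval_mul_cong by blast
next
  case (cong_der s s')
  have "zhu_circle (rees_eval s q K) vac - zhu_circle (rees_eval s' q K) vac \<in> rees_ideal (Suc q) (Suc K)" for q K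
    using rees_derivation(2)[of "rees_eval s q K - rees_eval s' q K" q K] cong_der
    by (simp add: rees_cong_def zhu_diff)
  then show ?case by (auto simp: rees_cong_def subspace_0 split: nat.split)
next
  case (add_neg s)
  have "rees_eval (Mul (Const (- 1)) s) p N + rees_eval s p N = 0" for p N
    by (simp add: rees_eval_const_mult del: rees_eval.simps)
  then show ?case by (intro rees_cong_refl ext) simp
next
  case (mul_assoc s t u)
  show ?case by (rule rees_eval_mul_assoc)
next
  case (mul_comm s t)
  show ?case by (rule rees_eval_mul_commute)
next
  case (mul_one s)
  show ?case by (intro rees_cong_refl ext) (simp add: rees_eval_const_mult del: rees_eval.simps)
next
  case (const_mul a b)
  show ?case
    by (intro rees_cong_refl ext, unfold rees_eval_const_mult) simp
next
  case (der_mul s t)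
  show ?case by (rule rees_eval_der_mul)
next
  case (der_const a)
  have "zhu_circle vac vac = 0" by (simp add: zhu_circle_homogeneous[OF vac_homogeneous] vac_left)
  then show ?case
    by (intro rees_cong_refl ext) (auto simp: zhu_bilinear_simps split: nat.split)
next
  case (gen_add x y)
  let ?r = representative
  have "vcoset (li_filtration 1) (?r x + ?r y) = x \<oplus>\<^bsub>C2_algebra\<^esub> y"
    using C2_representative[OF gen_add(1)] C2_representative[OF gen_add(2)] C2_ops(1)[of "?r x" "?r y"] by simp
  then have "?r (x \<oplus>\<^bsub>C2_algebra\<^esub> y) - (?r x + ?r y) \<in> li_filtration 1"
    using representative_vcoset[of "li_filtration 1" "?r x + ?r y"] by simp
  from component_rees_ideal_0[OF this] show ?case
    by (intro rees_eval_gen_cong) (simp_all add: component_diff component_add)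
next
  case (gen_mul x y)
  let ?r = representative
  have "vcoset (li_filtration 1) (md (?r x) (-1) (?r y)) = x \<otimes>\<^bsub>C2_algebra\<^esub> y"
    using C2_representative[OF gen_mul(1)] C2_representative[OF gen_mul(2)] C2_ops(2)[of "?r x" "?r y"] by simp
  then have d: "?r (x \<otimes>\<^bsub>C2_algebra\<^esub> y) - md (?r x) (-1) (?r y) \<in> li_filtration 1"
    using representative_vcoset[of "li_filtration 1" "md (?r x) (-1) (?r y)"] by simp
  show ?case
  proof (rule rees_eval_gen_cong)
    fix N
    let ?z = "\<lambda>K. zhu_product (component K (?r x)) (component (N - K) (?r y))"
    have lf: "component K v \<in> leading_filtration 0 K" for K v
      by (intro bigraded_leading_filtration homogeneous_bigraded component_in)
    have z: "?z K \<in> leading_filtration 0 N"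
        "component N (?z K) = md (component K (?r x)) (-1) (component (N - K) (?r y))" if "K \<le> N" for K
      using zhu_product_leading_filtration[OF lf[of K "?r x"] lf[of "N - K" "?r y"]]
        component_zhu_product[OF lf[of K "?r x"] lf[of "N - K" "?r y"]] that
      by (simp_all add: component_component)
    have "component N (?r (x \<otimes>\<^bsub>C2_algebra\<^esub> y)) - (\<Sum>K\<le>N. ?z K) \<in> leading_filtration 0 N"
      by (intro subspace_diff subspace_sum subspace_leading_filtration lf z) simp
    moreover have "(\<Sum>K\<le>N. component N (?z K)) = (\<Sum>K\<le>N. md (component K (?r x)) (-1) (component (N - K) (?r y)))"
      by (rule sum.cong[OF HOL.refl]) (rule z(2), simp)
    then have "component N (component N (?r (x \<otimes>\<^bsub>C2_algebra\<^esub> y)) - (\<Sum>K\<le>N. ?z K))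
        = component N (?r (x \<otimes>\<^bsub>C2_algebra\<^esub> y) - md (?r x) (-1) (?r y))"
      by (simp add: component_diff component_component component_sum component_normal_product)
    ultimately show "component N (?r (x \<otimes>\<^bsub>C2_algebra\<^esub> y)) - rees_eval (Mul (Gen x) (Gen y)) 0 N \<in> rees_ideal 0 N"
      using component_li[OF d] by (simp add: rees_ideal_def leading_filtration_def)
  next
    fix p N :: nat assume "p > 0"
    then show "rees_eval (Mul (Gen x) (Gen y)) p N = 0" by (auto intro!: sum.neutral)
  qed
next
  case (gen_smult x a)
  let ?r = representative
  have "vcoset (li_filtration 1) (a *s ?r x) = a \<odot>\<^bsub>C2_algebra\<^esub> x"
    using C2_representative[OF gen_smult(1)] C2_ops(3)[of a "?r x"] by simp
  then have "?r (a \<odot>\<^bsub>C2_algebra\<^esub> x) - a *s ?r x \<in> li_filtration 1"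
    using representative_vcoset[of "li_filtration 1" "a *s ?r x"] by simp
  from component_rees_ideal_0[OF this] show ?case
    by (intro rees_eval_gen_cong; unfold rees_eval_const_mult) (simp_all add: component_diff component_scale)
next
  case gen_one
  have one: "representative \<one>\<^bsub>C2_algebra\<^esub> - vac \<in> li_filtration 1"
    using representative_vcoset[of "li_filtration 1" vac] by (simp add: C2_ops)
  have "component N (representative \<one>\<^bsub>C2_algebra\<^esub>) - rees_eval (Const 1) 0 N \<in> rees_ideal 0 N" for N
    using component_rees_ideal_0[OF one, of N]
    by (cases "N = 0") (simp_all add: component_diff component_homogeneous[OF vac_homogeneous])
  then show ?case by (intro rees_eval_gen_cong) simp_all
qed (auto intro!: rees_cong_refl ext simp: algebra_simps zhu_bilinear_simps sum.distrib split: nat.split)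

text \<open>The vectors \<open>w p\<close> represent the components of an element of \<open>gr V\<close>, and the family \<open>f\<close> represents
  the same element degree by degree. Only the component of degree \<open>N\<close> of \<open>f p N\<close> is compared with
  \<open>w p\<close>: this is the map \<open>(r, x) \<mapsto> r + \<iota>(x)\<close>, which takes leading components.\<close>

definition li_symbols :: "(nat \<Rightarrow> 'v) \<Rightarrow> (nat \<Rightarrow> nat \<Rightarrow> 'v) \<Rightarrow> bool" where
  "li_symbols w f \<longleftrightarrow> (\<forall>p. w p \<in> li_filtration p) \<and>
     (\<forall>p N. component N (w p) - component N (f p N) \<in> li_filtration (Suc p))"

abbreviation li_family :: "(nat \<Rightarrow> 'v) \<Rightarrow> nat \<Rightarrow> 'v set" where
  "li_family w \<equiv> \<lambda>p. vcoset (li_filtration (Suc p)) (w p)"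

lemma component_translation:
  "component 0 (translation w) = 0" "component (Suc N) (translation w) = translation (component N w)"
proof -
  show "component 0 (translation w) = 0"
    using component_md[of 0 w 1 vac] by (simp add: translation_def)
  have "component (Suc N) (translation w) = (\<Sum>k\<le>N. md (component k w) (-2) (component (N - k) vac))"
    using component_md[of "Suc N" w 1 vac] by (simp add: translation_def)
  also have "\<dots> = (\<Sum>k\<le>N. if k = N then translation (component N w) else 0)"
    by (rule sum.cong[OF HOL.refl]) (auto simp: component_homogeneous[OF vac_homogeneous] translation_def)
  finally show "component (Suc N) (translation w) = translation (component N w)" by simp
qed

lemma component_zhu_circle_vac:
  assumes "x \<in> leading_filtration p N"
  shows "component (Suc N) (zhu_circle x vac) = translation (component N x)"
proof -
  let ?u = "component N x"
  have "zmode N (- 2) ?u vac - md ?u (- 2) vac \<in> V_less (Suc N)"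
    by (rule zmode_leading[OF component_in vac_homogeneous]) simp
  moreover have "zhu_circle (x - ?u) vac \<in> V_less (Suc N)"
    by (rule zhu_below_V_less[OF zhu_circle_vac_below[OF leading_filtration_lower[OF assms]]])
  ultimately have "(zmode N (- 2) ?u vac - md ?u (- 2) vac) + zhu_circle (x - ?u) vac \<in> V_less (Suc N)"
    by (rule subspace_add[OF subspace_V_less])
  moreover have "zhu_circle ?u vac = zmode N (- 2) ?u vac"
    by (rule zhu_circle_homogeneous[OF component_in])
  ultimately have "zhu_circle x vac - translation ?u \<in> V_less (Suc N)"
    by (simp add: zhu_diff translation_def)
  then show ?thesis
    by (simp add: V_less_iff component_diff component_translation component_component)
qed

lemma li_component_rees_eval: "component N (rees_eval t p N) \<in> li_filtration p"
  using rees_leading[OF rees_eval_rees, of t p N] by (simp add: leading_filtration_def)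

lemma li_symbols_mult:
  assumes w: "li_symbols w (rees_eval s)" and w': "li_symbols w' (rees_eval t)"
  shows "li_symbols (\<lambda>n. \<Sum>p\<le>n. md (w p) (-1) (w' (n - p))) (rees_eval (Mul s t))"
  unfolding li_symbols_def
proof (intro conjI allI)
  fix p
  show "(\<Sum>q\<le>p. md (w q) (-1) (w' (p - q))) \<in> li_filtration p"
  proof (intro li_sum)
    fix q assume "q \<in> {..p}"
    then show "md (w q) (-1) (w' (p - q)) \<in> li_filtration p"
      using normal_product_li[of "w q" q "w' (p - q)" "p - q"] w w' by (simp add: li_symbols_def)
  qed
  fix N
  have "component N (\<Sum>q\<le>p. md (w q) (-1) (w' (p - q))) - component N (rees_eval (Mul s t) p N)
    = (\<Sum>q\<le>p. \<Sum>K\<le>N. md (component K (w q)) (-1) (component (N - K) (w' (p - q)))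
        - component N (zhu_product (rees_eval s q K) (rees_eval t (p - q) (N - K))))"
    by (simp add: component_sum component_normal_product sum_subtractf)
  also have "\<dots> \<in> li_filtration (Suc p)"
  proof (intro li_sum)
    fix q K assume "q \<in> {..p}" "K \<in> {..N}"
    then have le: "q \<le> p" "K \<le> N" by simp_all
    let ?a = "component K (w q)" and ?b = "component (N - K) (w' (p - q))"
    let ?a' = "component K (rees_eval s q K)" and ?b' = "component (N - K) (rees_eval t (p - q) (N - K))"
    have c: "component N (zhu_product (rees_eval s q K) (rees_eval t (p - q) (N - K))) = md ?a' (-1) ?b'"
      using component_zhu_product[OF rees_leading[OF rees_eval_rees[of s q K]]
          rees_leading[OF rees_eval_rees[of t "p - q" "N - K"]]] le by simp
    have "md (?a - ?a') (-1) ?b \<in> li_filtration (Suc p)"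
      using normal_product_li[of "?a - ?a'" "Suc q" ?b "p - q"] w w' le component_li
      by (simp add: li_symbols_def)
    moreover have "md ?a' (-1) (?b - ?b') \<in> li_filtration (Suc p)"
      using normal_product_li[OF li_component_rees_eval[of K s q], of "?b - ?b'" "Suc (p - q)"] w' le
      by (simp add: li_symbols_def)
    ultimately have "md (?a - ?a') (-1) ?b + md ?a' (-1) (?b - ?b') \<in> li_filtration (Suc p)"
      by (rule subspace_add[OF subspace_li])
    then show "md ?a (-1) ?b - component N (zhu_product (rees_eval s q K) (rees_eval t (p - q) (N - K)))
        \<in> li_filtration (Suc p)"
      unfolding c by (simp add: md_diff_left md_diff_right)
  qed
  finally show "component N (\<Sum>q\<le>p. md (w q) (-1) (w' (p - q))) - component N (rees_eval (Mul s t) p N)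
    \<in> li_filtration (Suc p)" .
qed

text \<open>The map \<open>(r, x) \<mapsto> r + \<iota>(x)\<close> carries the value of a jet expression in \<open>R\<^sub>V \<oplus> X\<close> to its value in \<open>gr V\<close>, because
  leading components turn Zhu's product into the normally ordered product and \<open>x \<circ> 1\<close> into \<open>T x\<close>.\<close>

lemma jet_eval_symbols:
  assumes "t \<in> jet_terms C2_algebra"
  shows "\<exists>w. jet_eval gr_li C2_incl t = li_family w \<and> li_symbols w (rees_eval t)"
  using assms
proof (induction t)
  case (Gen x)
  let ?w = "\<lambda>p::nat. if p = 0 then representative x else 0"
  have "C2_incl x = li_family ?w"
    using C2_representative[of x] Gen by (intro ext) (simp add: C2_incl_def vcoset_zero)
  moreover have "li_symbols ?w (rees_eval (Gen x))"
    by (auto simp: li_symbols_def subspace_0 component_component)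
  ultimately show ?case unfolding jet_eval.simps by (intro exI[of _ ?w] conjI)
next
  case (Const c)
  let ?w = "\<lambda>p::nat. c *s (if p = 0 then vac else 0)"
  have "jet_eval gr_li C2_incl (Const c) = li_family ?w"
    by (simp add: gr_li_one gr_li_smult)
  moreover have "li_symbols ?w (rees_eval (Const c))"
    by (auto simp: li_symbols_def subspace_0 component_scale component_homogeneous[OF vac_homogeneous])
  ultimately show ?case by (intro exI[of _ ?w] conjI)
next
  case (Add s t)
  then have "s \<in> jet_terms C2_algebra" "t \<in> jet_terms C2_algebra" by simp_all
  then obtain w w' where w: "jet_eval gr_li C2_incl s = li_family w" "li_symbols w (rees_eval s)"
      "jet_eval gr_li C2_incl t = li_family w'" "li_symbols w' (rees_eval t)"
    using Add.IH by fast
  have "jet_eval gr_li C2_incl (Add s t) = li_family (\<lambda>p. w p + w' p)"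
    by (simp add: w gr_li_add)
  moreover have "li_symbols (\<lambda>p. w p + w' p) (rees_eval (Add s t))"
    unfolding li_symbols_def
  proof (intro conjI allI)
    show "w p + w' p \<in> li_filtration p" for p
      using w(2,4) by (simp add: li_symbols_def subspace_add)
    show "component N (w p + w' p) - component N (rees_eval (Add s t) p N) \<in> li_filtration (Suc p)" for p N
    proof -
      have "(component N (w p) - component N (rees_eval s p N)) + (component N (w' p) - component N (rees_eval t p N))
          \<in> li_filtration (Suc p)"
        using w(2,4) by (intro subspace_add subspace_li) (simp_all add: li_symbols_def)
      then show ?thesis by (simp add: component_add add_diff_add)
    qed
  qed
  ultimately show ?case by (intro exI[of _ "\<lambda>p. w p + w' p"] conjI)
next
  case (Mul s t)
  then have "s \<in> jet_terms C2_algebra" "t \<in> jet_terms C2_algebra" by simp_all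
  then obtain w w' where w: "jet_eval gr_li C2_incl s = li_family w" "li_symbols w (rees_eval s)"
      "jet_eval gr_li C2_incl t = li_family w'" "li_symbols w' (rees_eval t)"
    using Mul.IH by fast
  have "jet_eval gr_li C2_incl (Mul s t) = li_family (\<lambda>n. \<Sum>p\<le>n. md (w p) (-1) (w' (n - p)))"
    using w by (simp add: gr_li_mult li_symbols_def)
  then show ?case
    using li_symbols_mult[OF w(2,4)] by (intro exI[of _ "\<lambda>n. \<Sum>p\<le>n. md (w p) (-1) (w' (n - p))"] conjI)
next
  case (Der s)
  then have "s \<in> jet_terms C2_algebra" by simp
  then obtain w where w: "jet_eval gr_li C2_incl s = li_family w" "li_symbols w (rees_eval s)"
    using Der.IH by fast
  let ?w = "\<lambda>p. case p of 0 \<Rightarrow> 0 | Suc q \<Rightarrow> translation (w q)"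
  have "jet_eval gr_li C2_incl (Der s) = li_family ?w"
    by (simp add: w(1) gr_li_der)
  moreover have "li_symbols ?w (rees_eval (Der s))"
    unfolding li_symbols_def
  proof (intro conjI allI)
    show "?w p \<in> li_filtration p" for p
      using w(2) by (auto simp: li_symbols_def subspace_0 translation_li split: nat.split)
    show "component N (?w p) - component N (rees_eval (Der s) p N) \<in> li_filtration (Suc p)" for p N
    proof (cases "\<exists>q K. p = Suc q \<and> N = Suc K")
      case True
      then obtain q K where p: "p = Suc q" "N = Suc K" by blast
      have "translation (component K (w q) - component K (rees_eval s q K)) \<in> li_filtration (Suc (Suc q))"
        using w(2) by (intro translation_li) (simp add: li_symbols_def)
      then show ?thesis
        using component_zhu_circle_vac[OF rees_leading[OF rees_eval_rees[of s q K]]]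
        by (simp add: p component_translation translation_diff)
    next
      case False
      then show ?thesis by (auto simp: component_translation subspace_0 split: nat.split)
    qed
  qed
  ultimately show ?case by (intro exI[of _ ?w] conjI)
qed

section \<open>Classical freeness makes the filtration strict\<close>

lemma jet_eq_C2_terms: "jet_eq C2_algebra s t \<Longrightarrow> s \<in> jet_terms C2_algebra \<and> t \<in> jet_terms C2_algebra"
proof (induction rule: jet_eq.induct)
  case (gen_add x y)
  then show ?case by (auto simp: C2_carrier C2_ops simp del: One_nat_def)
next
  case (gen_mul x y)
  then show ?case by (auto simp: C2_carrier C2_ops simp del: One_nat_def)
next
  case (gen_smult x a)
  then show ?case by (auto simp: C2_carrier C2_ops simp del: One_nat_def)
next
  case gen_one
  then show ?case by (auto simp: C2_carrier C2_ops simp del: One_nat_def)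
qed simp_all

text \<open>Congruent families have the same symbols. So the well-definedness of the map from the jet
  algebra to \<open>gr V\<close> follows without first making \<open>gr V\<close> a differential algebra.\<close>

lemma jet_eq_jet_eval:
  assumes "jet_eq C2_algebra s t"
  shows "jet_eval gr_li C2_incl s = jet_eval gr_li C2_incl t"
proof -
  have st: "s \<in> jet_terms C2_algebra" "t \<in> jet_terms C2_algebra"
    using jet_eq_C2_terms[OF assms] by simp_all
  obtain w where w: "jet_eval gr_li C2_incl s = li_family w" "li_symbols w (rees_eval s)"
    using jet_eval_symbols[OF st(1)] by fast
  obtain w' where w': "jet_eval gr_li C2_incl t = li_family w'" "li_symbols w' (rees_eval t)"
    using jet_eval_symbols[OF st(2)] by fast
  have "component N (w p - w' p) \<in> li_filtration (Suc p)" for p N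
  proof -
    have "rees_eval s p N - rees_eval t p N \<in> leading_filtration (Suc p) N"
      using jet_eq_rees_cong[OF assms] by (intro rees_ideal_leading) (simp add: rees_cong_def)
    then have c: "component N (rees_eval s p N) - component N (rees_eval t p N) \<in> li_filtration (Suc p)"
      by (simp add: leading_filtration_def component_diff)
    have 1: "component N (w p) - component N (rees_eval s p N) \<in> li_filtration (Suc p)"
      and 2: "component N (w' p) - component N (rees_eval t p N) \<in> li_filtration (Suc p)"
      using w(2) w'(2) by (simp_all add: li_symbols_def)
    show ?thesis using li_diff[OF subspace_add[OF subspace_li 1 c] 2] by (simp add: component_diff)
  qed
  then have "w p - w' p \<in> li_filtration (Suc p)" for p
    by (rule in_span_of_components[OF subspace_li])
  then show ?thesis unfolding w(1) w'(1) by (intro ext vcoset_eqI subspace_li)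
qed

lemma jet_class_C2: "t \<in> jet_terms C2_algebra \<Longrightarrow> jet_lift gr_li C2_incl (jet_rel C2_algebra `` {t}) = jet_eval gr_li C2_incl t"
proof -
  assume t: "t \<in> jet_terms C2_algebra"
  have "jet_eval gr_li C2_incl ` (jet_rel C2_algebra `` {t}) = {jet_eval gr_li C2_incl t}"
  proof (intro equalityI subsetI)
    fix f assume "f \<in> jet_eval gr_li C2_incl ` (jet_rel C2_algebra `` {t})"
    then obtain s where "jet_eq C2_algebra t s" "f = jet_eval gr_li C2_incl s" by (auto simp: jet_rel_def)
    then show "f \<in> {jet_eval gr_li C2_incl t}" using jet_eq_jet_eval[of t s] by simp
  next
    fix f assume "f \<in> {jet_eval gr_li C2_incl t}"
    moreover have "t \<in> jet_rel C2_algebra `` {t}" using jet_eq.refl[OF t] by (simp add: jet_rel_def)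
    ultimately show "f \<in> jet_eval gr_li C2_incl ` (jet_rel C2_algebra `` {t})" by simp
  qed
  then show ?thesis by (simp add: jet_lift_def)
qed

lemma free_bij:
  "classically_free \<Longrightarrow> bij_betw (jet_lift gr_li C2_incl) (jet_terms C2_algebra // jet_rel C2_algebra) (carrier gr_li)"
  by (simp add: classically_free_def diff_alg_iso_def jet_def)

lemma free_surj:
  assumes "classically_free" "f \<in> carrier gr_li"
  obtains t where "t \<in> jet_terms C2_algebra" "jet_eval gr_li C2_incl t = f"
proof -
  obtain P where P: "P \<in> jet_terms C2_algebra // jet_rel C2_algebra" "f = jet_lift gr_li C2_incl P"
    using assms(2) unfolding bij_betw_imp_surj_on[OF free_bij[OF assms(1)], symmetric] by (rule imageE)
  obtain t where t: "P = jet_rel C2_algebra `` {t}" "t \<in> jet_terms C2_algebra"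
    using P(1) by (rule quotientE)
  show ?thesis by (rule that[OF t(2)]) (simp only: P(2) t(1) jet_class_C2[OF t(2)])
qed

lemma free_inj:
  assumes "classically_free" "s \<in> jet_terms C2_algebra" "t \<in> jet_terms C2_algebra"
    and "jet_eval gr_li C2_incl s = jet_eval gr_li C2_incl t"
  shows "jet_eq C2_algebra s t"
proof -
  have "jet_lift gr_li C2_incl (jet_rel C2_algebra `` {s}) = jet_lift gr_li C2_incl (jet_rel C2_algebra `` {t})"
    by (simp only: jet_class_C2 assms(2-4))
  then have "jet_rel C2_algebra `` {s} = jet_rel C2_algebra `` {t}"
    by (rule inj_onD[OF bij_betw_imp_inj_on[OF free_bij[OF assms(1)]]]) (intro quotientI assms)+
  moreover have "t \<in> jet_rel C2_algebra `` {t}" using jet_eq.refl[OF assms(3)] by (simp add: jet_rel_def)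
  ultimately have "t \<in> jet_rel C2_algebra `` {s}" by simp
  then show ?thesis by (simp add: jet_rel_def)
qed

definition single :: "nat \<Rightarrow> nat \<Rightarrow> 'v \<Rightarrow> nat \<Rightarrow> nat \<Rightarrow> 'v" where
  "single p N x = (\<lambda>p' N'. if p' = p \<and> N' = N then x else 0)"

text \<open>The expression is found by surjectivity of the map to \<open>gr V\<close>, so it is known modulo elements with
  a small symbol only, and not modulo \<open>rees_ideal\<close>.\<close>

lemma symbol_term:
  assumes "classically_free" and a: "a \<in> bigraded i k"
  obtains t where "t \<in> jet_terms C2_algebra"
    "\<And>q K. rees_eval t q K - single i k a q K \<in> leading_filtration (Suc q) K"
proof -
  let ?w = "\<lambda>p. if p = i then a else 0"
  have "li_family ?w \<in> carrier gr_li"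
    by (rule gr_li_carrierI) (use a in \<open>simp add: bigraded_def\<close>)
  then obtain t where t: "t \<in> jet_terms C2_algebra" "jet_eval gr_li C2_incl t = li_family ?w"
    by (rule free_surj[OF assms(1)])
  obtain w where w: "jet_eval gr_li C2_incl t = li_family w" "li_symbols w (rees_eval t)"
    using jet_eval_symbols[OF t(1)] by fast
  have d: "w q - ?w q \<in> li_filtration (Suc q)" for q
  proof -
    have "li_family w q = li_family ?w q" using w(1) t(2) by metis
    then show ?thesis by (simp add: vcoset_eq_iff)
  qed
  have s: "component K (single i k a q K) = component K (?w q)" for q K
    using a by (auto simp: single_def bigraded_def component_homogeneous[of a k])
  have "rees_eval t q K - single i k a q K \<in> leading_filtration (Suc q) K" for q K
  proof -
    have "rees_eval t q K \<in> V_le K" using rees_leading[OF rees_eval_rees[of t q K]] by (simp add: leading_filtration_def)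
    moreover have "single i k a q K \<in> V_le K"
      using bigraded_leading_filtration[OF a] by (auto simp: single_def leading_filtration_def subspace_0)
    ultimately have v: "rees_eval t q K - single i k a q K \<in> V_le K" by (simp add: subspace_diff)
    have "component K (w q) - component K (rees_eval t q K) \<in> li_filtration (Suc q)"
      using w(2) by (simp add: li_symbols_def)
    from li_diff[OF component_li[OF d[of q], of K] this]
    have "component K (rees_eval t q K - single i k a q K) \<in> li_filtration (Suc q)"
      by (simp add: component_diff s)
    with v show ?thesis by (simp add: leading_filtration_def)
  qed
  with t(1) that show thesis by blast
qed

text \<open>An element of \<open>gr V\<close> acts on \<open>X\<close> through its symbol. Hence the value of \<open>t\<close> is needed only to the
  precision of \<open>symbol_term\<close>.\<close>

lemma rees_eval_mul_single:
  assumes y: "\<And>q K. rees_eval t q K - single j l b q K \<in> leading_filtration (Suc q) K"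
    and b: "b \<in> bigraded j l"
    and z: "rees_cong (rees_eval u) (single i k c)" and c: "c \<in> zhu_filtration i k"
    and u0: "\<And>K. rees_eval u 0 K = 0" and i: "i > 0"
  shows "rees_cong (rees_eval (Mul t u)) (single (j + i) (l + k) (zhu_product b c))"
  unfolding rees_cong_def
proof (intro allI)
  fix p N
  have "single (j + i) (l + k) (zhu_product b c) p N
      = (\<Sum>q\<le>p. \<Sum>K\<le>N. zhu_product (single j l b q K) (single i k c (p - q) (N - K)))"
  proof -
    have "(\<Sum>q\<le>p. \<Sum>K\<le>N. zhu_product (single j l b q K) (single i k c (p - q) (N - K)))
      = (\<Sum>q\<le>p. \<Sum>K\<le>N. if q = j then (if K = l then zhu_product b (single i k c (p - j) (N - l)) else 0) else 0)"
      by (intro sum.cong[OF HOL.refl]) (auto simp: single_def)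
    also have "\<dots> = (\<Sum>q\<le>p. if q = j then (\<Sum>K\<le>N. if K = l then zhu_product b (single i k c (p - j) (N - l)) else 0) else 0)"
      by (intro sum.cong[OF HOL.refl]) auto
    also have "\<dots> = (if j \<le> p \<and> l \<le> N then zhu_product b (single i k c (p - j) (N - l)) else 0)"
      by simp
    also have "\<dots> = single (j + i) (l + k) (zhu_product b c) p N"
      by (auto simp: single_def)
    finally show ?thesis by simp
  qed
  moreover have "rees_eval (Mul t u) p N
      - (\<Sum>q\<le>p. \<Sum>K\<le>N. zhu_product (single j l b q K) (single i k c (p - q) (N - K))) \<in> rees_ideal p N"
    unfolding rees_eval.simps
  proof (rule rees_cong_sum2)
    fix q K assume le: "q \<le> p" "K \<le> N"
    let ?y = "rees_eval t q K" and ?y' = "single j l b q K"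
    let ?z = "rees_eval u (p - q) (N - K)" and ?z' = "single i k c (p - q) (N - K)"
    show "zhu_product ?y ?z - zhu_product ?y' ?z' \<in> rees_ideal p N"
    proof (cases "q = p")
      case True
      then show ?thesis using u0 i by (simp add: single_def subspace_0)
    next
      case False
      then have pos: "p - q > 0" using le by simp
      have z1: "?z \<in> zhu_filtration (p - q) (N - K)"
        using rees_eval_rees[of u "p - q" "N - K"] pos by (simp add: rees_def)
      have z2: "?z - ?z' \<in> zhu_filtration (Suc (p - q)) (N - K)"
      proof -
        have "?z - ?z' \<in> rees_ideal (p - q) (N - K)" using z by (simp add: rees_cong_def)
        then show ?thesis using pos by (simp add: rees_ideal_def)
      qed
      have y': "?y' \<in> leading_filtration q K"
        using bigraded_leading_filtration[OF b] by (auto simp: single_def subspace_0)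
      have 1: "zhu_product (?y - ?y') ?z \<in> zhu_filtration (Suc p) N"
        using zhu_product_filtration[OF y[of q K] z1] le by simp
      have 2: "zhu_product ?y' (?z - ?z') \<in> zhu_filtration (Suc p) N"
        using zhu_product_filtration[OF y' z2] le by simp
      show ?thesis
        using zhu_filtration_rees_ideal[OF subspace_add[OF subspace_zhu_filtration 1 2]] by (simp add: zhu_diff)
    qed
  qed
  ultimately show "rees_eval (Mul t u) p N - single (j + i) (l + k) (zhu_product b c) p N \<in> rees_ideal p N"
    by simp
qed

text \<open>If \<open>s\<close> and \<open>t\<close> are jet expressions for \<open>a\<close> and \<open>b\<close>, the value of \<open>t \<partial>s\<close> is \<open>b * (a \<circ> 1)\<close>, which is
  \<open>a \<circ> b\<close> to leading order. So the homomorphism from the jet algebra to \<open>R\<^sub>V \<oplus> X\<close> reaches every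
  generator of \<open>X\<close>.\<close>

lemma zhu_filtration_realized:
  assumes free: "classically_free" and x: "x \<in> zhu_filtration p N" and p: "p > 0"
  shows "\<exists>t\<in>jet_terms C2_algebra. rees_cong (rees_eval t) (single p N x)"
proof -
  have zero: "\<exists>t\<in>jet_terms C2_algebra. rees_cong (rees_eval t) (single p N x)" if "x \<in> rees_ideal p N" for x
  proof (rule bexI)
    show "rees_cong (rees_eval (Const 0)) (single p N x)"
      using subspace_neg[OF subspace_rees(2) that] by (auto simp: rees_cong_def single_def subspace_0)
  qed simp
  show ?thesis
    using x
  proof (induction rule: zhu_filtration_induct)
    case (below x)
    then show ?case by (intro zero zhu_filtration_rees_ideal zhu_below_filtration)
  next
    case (circle a b i j k l)
    show ?case
    proof (cases "p = i + j + 1")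
      case False
      then show ?thesis
        by (intro zero zhu_filtration_rees_ideal zhu_circle_filtration[OF circle(1,2)]) (use circle in auto)
    next
      case True
      obtain s where s: "s \<in> jet_terms C2_algebra"
          "\<And>q K. rees_eval s q K - single i k a q K \<in> leading_filtration (Suc q) K"
        using symbol_term[OF free circle(1)] by blast
      obtain t where t: "t \<in> jet_terms C2_algebra"
          "\<And>q K. rees_eval t q K - single j l b q K \<in> leading_filtration (Suc q) K"
        using symbol_term[OF free circle(2)] by blast
      have z: "rees_cong (rees_eval (Der s)) (single (Suc i) (Suc k) (zhu_circle a vac))"
        unfolding rees_cong_def
      proof (intro allI)
        fix q K
        show "rees_eval (Der s) q K - single (Suc i) (Suc k) (zhu_circle a vac) q K \<in> rees_ideal q K"
        proof (cases "\<exists>q' K'. q = Suc q' \<and> K = Suc K'")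
          case True
          then obtain q' K' where qK: "q = Suc q'" "K = Suc K'" by blast
          have "zhu_circle (rees_eval s q' K' - single i k a q' K') vac \<in> zhu_filtration (Suc (Suc q')) (Suc K')"
            by (rule zhu_circle_vac_filtration[OF s(2)])
          moreover have "single (Suc i) (Suc k) (zhu_circle a vac) q K = zhu_circle (single i k a q' K') vac"
            by (simp add: qK single_def)
          ultimately show ?thesis by (simp add: qK zhu_diff rees_ideal_def)
        next
          case False
          then show ?thesis by (auto simp: single_def subspace_0 split: nat.split)
        qed
      qed
      have "zhu_circle a vac \<in> zhu_filtration (Suc i) (Suc k)"
        by (rule zhu_circle_vac_filtration[OF bigraded_leading_filtration[OF circle(1)]])
      then have m: "rees_cong (rees_eval (Mul t (Der s))) (single (j + Suc i) (l + Suc k) (zhu_product b (zhu_circle a vac)))"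
        by (intro rees_eval_mul_single t(2) circle(2) z) simp_all
      have "zhu_product b (zhu_circle a vac) - zhu_circle a (md b (-1) vac) \<in> zhu_filtration (j + i + 0 + 2) (l + k + 0 + 1)"
        by (rule zhu_product_circle[OF circle(2,1) vac_bigraded])
      then have "zhu_product b (zhu_circle a vac) - zhu_circle a b \<in> rees_ideal p N"
        using True circle by (intro zhu_filtration_rees_ideal) (simp add: vac_right add_ac)
      then have "rees_cong (single p N (zhu_product b (zhu_circle a vac))) (single p N (zhu_circle a b))"
        by (auto simp: rees_cong_def single_def subspace_0)
      moreover have "j + Suc i = p" "l + Suc k = N" using True circle by simp_all
      ultimately have "rees_cong (rees_eval (Mul t (Der s))) (single p N (zhu_circle a b))"
        using rees_cong_trans[OF m] by simp
      then show ?thesis using s(1) t(1) by (intro bexI[of _ "Mul t (Der s)"]) simp_all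
    qed
  next
    case (add x y)
    then obtain s t where "s \<in> jet_terms C2_algebra" "rees_cong (rees_eval s) (single p N x)"
      "t \<in> jet_terms C2_algebra" "rees_cong (rees_eval t) (single p N y)" by blast
    moreover have "single p N (x + y) = (\<lambda>p' N'. single p N x p' N' + single p N y p' N')"
      by (intro ext) (simp add: single_def)
    ultimately have "rees_cong (rees_eval (Add s t)) (single p N (x + y))" "Add s t \<in> jet_terms C2_algebra"
      using rees_cong_add by simp_all
    then show ?case by blast
  qed
qed

text \<open>A jet expression for \<open>x\<close> has value zero in \<open>gr V\<close>, because the symbol of \<open>x\<close> vanishes. Classical
  freeness makes the expression zero in the jet algebra, so that its value in \<open>R\<^sub>V \<oplus> X\<close>, which is
  the class of \<open>x\<close>, vanishes too.\<close>

lemma zhu_filtration_strict: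
  assumes free: "classically_free" and p: "p > 0" and x: "x \<in> zhu_filtration p N"
    and lead: "component N x \<in> li_filtration (Suc p)"
  shows "x \<in> zhu_filtration (Suc p) N"
proof -
  obtain t where t: "t \<in> jet_terms C2_algebra" "rees_cong (rees_eval t) (single p N x)"
    using zhu_filtration_realized[OF free x p] by blast
  obtain w where w: "jet_eval gr_li C2_incl t = li_family w" "li_symbols w (rees_eval t)"
    using jet_eval_symbols[OF t(1)] by fast
  have "component K (w q) \<in> li_filtration (Suc q)" for q K
  proof -
    have "rees_eval t q K - single p N x q K \<in> leading_filtration (Suc q) K"
      using t(2) by (intro rees_ideal_leading) (simp add: rees_cong_def)
    then have 1: "component K (rees_eval t q K) - component K (single p N x q K) \<in> li_filtration (Suc q)"
      by (simp add: leading_filtration_def component_diff)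
    have 2: "component K (single p N x q K) \<in> li_filtration (Suc q)"
      using lead by (auto simp: single_def subspace_0)
    have 3: "component K (w q) - component K (rees_eval t q K) \<in> li_filtration (Suc q)"
      using w(2) by (simp add: li_symbols_def)
    show ?thesis using subspace_add[OF subspace_li 3 subspace_add[OF subspace_li 1 2]] by simp
  qed
  then have "w q \<in> li_filtration (Suc q)" for q by (rule in_span_of_components[OF subspace_li])
  then have "li_family w = li_family (\<lambda>_. 0)" by (intro ext vcoset_eqI subspace_li) simp
  also have "\<dots> = jet_eval gr_li C2_incl (Const 0)" by (simp add: gr_li_one gr_li_smult)
  finally have "jet_eval gr_li C2_incl t = jet_eval gr_li C2_incl (Const 0)" using w(1) by simp
  then have "jet_eq C2_algebra t (Const 0)" by (rule free_inj[OF free t(1), rotated]) simp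
  from jet_eq_rees_cong[OF this] have "rees_eval t p N - rees_eval (Const 0) p N \<in> rees_ideal p N"
    unfolding rees_cong_def by blast
  then have 1: "rees_eval t p N \<in> zhu_filtration (Suc p) N" using p by (simp add: rees_ideal_def)
  have 2: "rees_eval t p N - x \<in> zhu_filtration (Suc p) N"
  proof -
    have "rees_eval t p N - single p N x p N \<in> rees_ideal p N" using t(2) unfolding rees_cong_def by blast
    then show ?thesis using p by (simp add: rees_ideal_def single_def)
  qed
  show ?thesis using subspace_diff[OF subspace_zhu_filtration 1 2] by simp
qed

lemma zhu_below_strict:
  assumes free: "classically_free" and x: "x \<in> zhu_below (Suc N)" and lead: "component N x = 0"
  shows "x \<in> zhu_below N"
proof -
  have "x \<in> zhu_filtration (Suc p) N" for p
  proof (induction p)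
    case 0
    then show ?case using x zhu_filtration_1[of N] by simp
  next
    case (Suc p)
    show ?case by (rule zhu_filtration_strict[OF free _ Suc]) (simp_all add: lead subspace_0)
  qed
  then show ?thesis using zhu_filtration_large[of x "Suc N" N] by simp
qed

lemma zhu_below_V_le:
  assumes free: "classically_free" and "x \<in> zhu_below M" and x: "x \<in> V_le N"
  shows "x \<in> zhu_below (Suc N)"
  using assms(2)
proof (induction M)
  case 0
  then show ?case by (rule zhu_below_mono) simp
next
  case (Suc M)
  show ?case
  proof (cases "M \<le> N")
    case True
    then show ?thesis using zhu_below_mono[OF Suc.prems] by simp
  next
    case False
    then have "component M x = 0" using x by (simp add: V_le_iff)
    then show ?thesis using Suc.IH zhu_below_strict[OF free Suc.prems] by blast
  qed
qed

section \<open>The graded algebra of Zhu's algebra\<close>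

lemma zhu_below_ideal: "x \<in> zhu_below N \<Longrightarrow> x \<in> zhu_ideal"
  unfolding zhu_below_def zhu_ideal_def by (erule rev_subsetD, rule span_mono) auto

lemma zhu_ideal_below: "x \<in> zhu_ideal \<Longrightarrow> \<exists>N. x \<in> zhu_below N"
proof -
  have sum_below: "\<exists>N. x + y \<in> zhu_below N" if "\<exists>N. x \<in> zhu_below N" "\<exists>N. y \<in> zhu_below N" for x y
  proof -
    from that obtain N M where "x \<in> zhu_below N" "y \<in> zhu_below M" by blast
    then have "x \<in> zhu_below (max N M)" "y \<in> zhu_below (max N M)"
      by (auto intro: zhu_below_mono)
    then have "x + y \<in> zhu_below (max N M)" by (rule subspace_add[OF subspace_zhu_below])
    then show ?thesis by blast
  qed
  have circ: "\<exists>N. zhu_circle a b \<in> zhu_below N" for a b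
  proof (induction a rule: homogeneous_induct)
    case (homogeneous k a)
    show ?case
    proof (induction b rule: homogeneous_induct)
      case (homogeneous l b)
      then show ?case using zhu_circle_below[OF \<open>a \<in> homogeneous k\<close>, of b l "Suc (k + l + 1)"] by auto
    next
      case (add b b')
      then show ?case unfolding zhu_bilinear_simps by (rule sum_below)
    qed (auto simp: subspace_0)
  next
    case (add a a')
    then show ?case unfolding zhu_bilinear_simps by (rule sum_below)
  qed (auto simp: subspace_0)
  assume "x \<in> zhu_ideal"
  then show ?thesis
    unfolding zhu_ideal_def
  proof (induction rule: span_induct_alt)
    case (step c x y)
    then obtain N where "x \<in> zhu_below N" using circ by blast
    then have "c *s x \<in> zhu_below N" by (rule subspace_scale[OF subspace_zhu_below])
    then show ?case using sum_below[of "c *s x" y] step by blast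
  qed (auto simp: subspace_0)
qed

lemma subspace_zhu_ideal [simp]: "subspace zhu_ideal"
  by (simp add: zhu_ideal_def)

lemma zhu_product_ideal:
  assumes "y \<in> zhu_ideal"
  shows "zhu_product x y \<in> zhu_ideal" "zhu_product y x \<in> zhu_ideal"
proof -
  obtain K where "y \<in> zhu_below K" using zhu_ideal_below[OF assms] by blast
  moreover obtain N where "x \<in> V_less N" using V_less_exists by blast
  ultimately show "zhu_product x y \<in> zhu_ideal" "zhu_product y x \<in> zhu_ideal"
    using zhu_product_below[of x N y K "N + K"] zhu_below_ideal by auto
qed

text \<open>The subspace \<open>V\<^sub>\<le>\<^sub>n\<^sub>-\<^sub>1 + O(V)\<close>.\<close>

definition ideal_less :: "nat \<Rightarrow> 'v set" where
  "ideal_less n = {v. \<exists>z\<in>zhu_ideal. v - z \<in> V_less n}"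

text \<open>The element of \<open>O(V)\<close> in a decomposition of \<open>v\<close> has degree at most \<open>n\<close>. By strictness it is a
  combination of generators of degree at most \<open>n\<close>, and its component \<open>v\<close> of degree \<open>n\<close> is then a sum of
  vectors \<open>a\<^sub>(\<^sub>-\<^sub>2\<^sub>) b\<close>.\<close>

lemma ideal_less_li:
  assumes free: "classically_free" and v: "v \<in> homogeneous n" "v \<in> ideal_less n"
  shows "v \<in> li_filtration 1"
proof -
  obtain z where z: "z \<in> zhu_ideal" "v - z \<in> V_less n" using v(2) by (auto simp: ideal_less_def)
  have "v \<in> V_le n" using v(1) by (simp add: V_le_eq homogeneous_V_less)
  moreover have "v - z \<in> V_le n" using V_less_mono[OF z(2)] by (simp add: V_le_eq)
  ultimately have zn: "z \<in> V_le n" using subspace_diff[OF subspace_V_le, of v n "v - z"] by simp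
  obtain M where "z \<in> zhu_below M" using zhu_ideal_below[OF z(1)] by blast
  then have "z \<in> zhu_below (Suc n)" by (rule zhu_below_V_le[OF free _ zn])
  then have "z \<in> leading_filtration 1 n"
    using zhu_filtration_leading[of z 1 n] zhu_filtration_1[of n] by simp
  moreover have "component n z = v"
    using z(2) component_homogeneous[OF v(1), of n] by (simp add: V_less_iff component_diff)
  ultimately show ?thesis by (simp add: leading_filtration_def)
qed

lemma subspace_ideal_less [simp]: "subspace (ideal_less n)"
proof (rule subspaceI)
  show "0 \<in> ideal_less n"
    unfolding ideal_less_def by (intro CollectI bexI[of _ 0]) (simp_all add: subspace_0)
  fix v w assume "v \<in> ideal_less n" "w \<in> ideal_less n"
  then obtain z z' where "z \<in> zhu_ideal" "z' \<in> zhu_ideal" "v - z \<in> V_less n" "w - z' \<in> V_less n"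
    by (auto simp: ideal_less_def)
  then have "z + z' \<in> zhu_ideal" "(v - z) + (w - z') \<in> V_less n" by (simp_all add: subspace_add)
  moreover have "(v - z) + (w - z') = (v + w) - (z + z')" by simp
  ultimately show "v + w \<in> ideal_less n" unfolding ideal_less_def by auto
next
  fix k v assume "v \<in> ideal_less n"
  then obtain z where "z \<in> zhu_ideal" "v - z \<in> V_less n" by (auto simp: ideal_less_def)
  then have "k *s z \<in> zhu_ideal" "k *s v - k *s z \<in> V_less n"
    by (simp_all add: subspace_scale flip: scale_right_diff_distrib)
  then show "k *s v \<in> ideal_less n" unfolding ideal_less_def by auto
qed

lemma V_less_ideal_less: "v \<in> V_less n \<Longrightarrow> v \<in> ideal_less n"
  unfolding ideal_less_def by (intro CollectI bexI[of _ 0]) (simp_all add: subspace_0)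

lemma zhu_ideal_ideal_less: "v \<in> zhu_ideal \<Longrightarrow> v \<in> ideal_less n"
  unfolding ideal_less_def by (intro CollectI bexI[of _ v]) (simp_all add: subspace_0)

text \<open>A factor \<open>a\<^sub>(\<^sub>-\<^sub>m\<^sub>-\<^sub>1\<^sub>)\<close> with \<open>m > 0\<close> is the leading term of a residue in \<open>O(V)\<close>, and a factor
  \<open>a\<^sub>(\<^sub>-\<^sub>1\<^sub>)\<close> is the leading term of \<open>a *\<close>, which preserves \<open>O(V)\<close>.\<close>

lemma component_monomial_ideal_less:
  "0 < sum_list (map snd xs) \<Longrightarrow> component N (monomial xs) \<in> ideal_less N"
proof (induction xs arbitrary: N)
  case (Cons x xs)
  obtain a m where x: "x = (a, m)" by force
  have "md (component k a) (- int m - 1) (component (N - m - k) (monomial xs)) \<in> ideal_less N"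
    if "m \<le> N" "k \<le> N - m" for k
  proof -
    define l where "l = N - m - k"
    have N: "N = k + l + m" using that by (simp add: l_def)
    let ?u = "component k a" and ?w = "component l (monomial xs)"
    have lead: "zmode k (- int m - 1) ?u ?w - md ?u (- int m - 1) ?w \<in> ideal_less N"
      by (rule V_less_ideal_less[OF zmode_leading[OF component_in component_in]]) (simp add: N)
    have "zmode k (- int m - 1) ?u ?w \<in> ideal_less N"
    proof (cases m)
      case (Suc m')
      have "zmode (k + 0) (- 2 - int m') ?u ?w \<in> zhu_filtration (0 + 0 + 1 + m') (k + l + 1 + m')"
        by (rule zmode_filtration_bigraded) (simp_all add: homogeneous_bigraded)
      then have "zmode (k + 0) (- 2 - int m') ?u ?w \<in> zhu_ideal"
        using zhu_filtration_subset_below[of _ _ _ "Suc (k + l + 1 + m')"] zhu_below_ideal by blast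
      moreover have "- 2 - int m' = - int m - 1" using Suc by simp
      ultimately show ?thesis by (simp add: zhu_ideal_ideal_less)
    next
      case 0
      then have "?w \<in> ideal_less l" using Cons x by simp
      then obtain z where z: "z \<in> zhu_ideal" "?w - z \<in> V_less l" by (auto simp: ideal_less_def)
      have "zhu_product ?u z \<in> ideal_less N"
        by (rule zhu_ideal_ideal_less[OF zhu_product_ideal(1)[OF z(1)]])
      moreover have "zhu_product ?u (?w - z) \<in> ideal_less N"
        by (rule V_less_ideal_less[OF zhu_product_V_less[OF homogeneous_V_less[OF component_in] z(2)]])
          (use N 0 in auto)
      ultimately have "zhu_product ?u z + zhu_product ?u (?w - z) \<in> ideal_less N"
        by (rule subspace_add[OF subspace_ideal_less])
      then have "zhu_product ?u ?w \<in> ideal_less N" by (simp add: zhu_diff)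
      then show ?thesis using 0 by (simp add: zhu_product_homogeneous[OF component_in])
    qed
    from subspace_diff[OF subspace_ideal_less this lead] show ?thesis by (simp add: l_def)
  qed
  then show ?case unfolding x monomial_simps component_md
    by (auto simp: subspace_0 intro!: subspace_sum)
qed simp

lemma component_li_ideal_less: "v \<in> li_filtration 1 \<Longrightarrow> component N v \<in> ideal_less N"
  unfolding li_filtration_def
proof (erule span_induct)
  show "subspace {v. component N v \<in> ideal_less N}"
    by (rule subspaceI) (simp_all add: component_add component_scale subspace_0 subspace_add subspace_scale)
qed (use component_monomial_ideal_less in auto)

lemma zhu_class_vcoset: "zhu_class a = vcoset zhu_ideal a"
  by (simp add: zhu_class_def a_coset_vcoset)

lemma zhu_class_eq_iff: "zhu_class a = zhu_class b \<longleftrightarrow> a - b \<in> zhu_ideal"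
  by (simp add: zhu_class_vcoset vcoset_eq_iff)

lemma zhu_algebra_image: "algebra_image scale zhu_algebra zhu_class zhu_product"
proof unfold_locales
  show "carrier zhu_algebra = range zhu_class"
    by (simp add: zhu_algebra_def quot_vcoset_carrier zhu_class_vcoset[abs_def])
  show "zhu_class x \<oplus>\<^bsub>zhu_algebra\<^esub> zhu_class y = zhu_class (x + y)" for x y
    by (simp add: zhu_algebra_def quot_alg_def zhu_class_vcoset vcoset_add)
  show "k \<odot>\<^bsub>zhu_algebra\<^esub> zhu_class x = zhu_class (k *s x)" for k x
    by (simp add: zhu_algebra_def quot_alg_def zhu_class_vcoset vcoset_smult)
  have "rcoset_mult (with_product zhu_product) zhu_ideal (vcoset zhu_ideal x) (vcoset zhu_ideal y)
      = vcoset zhu_ideal (zhu_product x y)" for x y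
  proof (rule vcoset_mult)
    fix k1 k2 assume "k1 \<in> zhu_ideal" "k2 \<in> zhu_ideal"
    then show "zhu_product (k1 + x) (k2 + y) - zhu_product x y \<in> zhu_ideal"
      by (simp add: zhu_bilinear_simps zhu_product_ideal subspace_add)
  qed simp_all
  then show "zhu_class x \<otimes>\<^bsub>zhu_algebra\<^esub> zhu_class y = zhu_class (zhu_product x y)" for x y
    by (simp add: zhu_algebra_def quot_alg_def zhu_class_vcoset)
qed

text \<open>The class of \<open>a\<close> in the component of degree \<open>n\<close> of \<open>gr A(V)\<close>.\<close>

definition zhu_symbol :: "nat \<Rightarrow> 'v \<Rightarrow> 'v set set" where
  "zhu_symbol n a = algebra_image.coset zhu_class (V_less n) a"

lemma zhu_symbol_eq_iff: "zhu_symbol n a = zhu_symbol n b \<longleftrightarrow> a - b \<in> ideal_less n"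
proof
  assume "zhu_symbol n a = zhu_symbol n b"
  moreover have "zhu_class a \<in> zhu_symbol n a"
    unfolding zhu_symbol_def by (rule algebra_image.coset_self[OF zhu_algebra_image]) simp
  ultimately obtain k where k: "k \<in> V_less n" "zhu_class a = zhu_class (k + b)"
    by (auto simp: zhu_symbol_def algebra_image.coset_def[OF zhu_algebra_image])
  then have "a - (k + b) \<in> zhu_ideal" "a - b - (a - (k + b)) \<in> V_less n"
    by (simp_all add: zhu_class_eq_iff)
  then show "a - b \<in> ideal_less n" unfolding ideal_less_def by blast
next
  assume "a - b \<in> ideal_less n"
  then obtain z where z: "z \<in> zhu_ideal" "a - b - z \<in> V_less n" by (auto simp: ideal_less_def)
  have "zhu_class (k + a) = zhu_class (k + (a - z))" for k
    using z(1) by (simp add: zhu_class_eq_iff)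
  then have "zhu_symbol n a = zhu_symbol n (a - z)"
    by (simp add: zhu_symbol_def algebra_image.coset_def[OF zhu_algebra_image])
  also have "\<dots> = zhu_symbol n b"
    unfolding zhu_symbol_def
    by (rule algebra_image.coset_eqI[OF zhu_algebra_image]) (use z(2) in \<open>simp_all add: algebra_simps\<close>)
  finally show "zhu_symbol n a = zhu_symbol n b" .
qed

lemma zhu_a_coset: "zhu_class ` V_less n +>\<^bsub>zhu_algebra\<^esub> zhu_class a = zhu_symbol n a"
  unfolding zhu_symbol_def by (rule algebra_image.a_coset_image[OF zhu_algebra_image])

lemma zhu_symbol_zero: "zhu_symbol n 0 = zhu_class ` V_less n"
  unfolding zhu_symbol_def by (rule algebra_image.coset_zero[OF zhu_algebra_image])

lemma eta_vcoset: "eta (vcoset (li_filtration 1) a) = (\<lambda>n. zhu_symbol n (component n a))"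
proof
  fix n
  have "(\<Union>b\<in>vcoset (li_filtration 1) a. zhu_symbol n (component n b)) = zhu_symbol n (component n a)"
    by (rule UN_vcoset) (simp_all add: zhu_symbol_eq_iff component_add component_li_ideal_less[simplified])
  then show "eta (vcoset (li_filtration 1) a) n = zhu_symbol n (component n a)"
    by (simp add: eta_def zhu_a_coset)
qed

lemma gr_zhu_carrier:
  "carrier gr_zhu = {f. (\<forall>n. f n \<in> zhu_symbol n ` V_le n) \<and> finite {n. f n \<noteq> zhu_symbol n 0}}"
  by (simp add: gr_zhu_def gr_alg_def zhu_a_coset image_image zhu_symbol_zero)

lemma eta_carrier: "(\<lambda>n. zhu_symbol n (component n a)) \<in> carrier gr_zhu"
proof -
  obtain L where L: "\<And>k. k \<ge> L \<Longrightarrow> component k a = 0" by (rule component_bound) blast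
  have "finite {n. zhu_symbol n (component n a) \<noteq> zhu_symbol n 0}"
    by (rule finite_subset[of _ "{..<L}"]) (auto intro: leI simp: L not_less[symmetric] dest: L[OF leI])
  moreover have "component n a \<in> V_le n" for n
    by (simp add: V_le_iff component_component)
  ultimately show ?thesis by (auto simp: gr_zhu_carrier)
qed

lemma gr_zhu_mult:
  assumes "\<And>p. x p \<in> V_le p" "\<And>p. y p \<in> V_le p"
  shows "(\<lambda>n. zhu_symbol n (x n)) \<otimes>\<^bsub>gr_zhu\<^esub> (\<lambda>n. zhu_symbol n (y n))
    = (\<lambda>n. zhu_symbol n (\<Sum>p\<le>n. zhu_product (x p) (y (n - p))))"
  unfolding gr_zhu_def zhu_symbol_def
proof (rule ext, rule algebra_image.gr_alg_mult[OF zhu_algebra_image])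
  fix n p k1 k2 assume *: "p \<le> n" "k1 \<in> V_less p" "k2 \<in> V_less (n - p)"
  have k: "k2 + y (n - p) \<in> V_less (Suc (n - p))" "x p \<in> V_less (Suc p)"
    using V_less_mono[OF *(3), of "Suc (n - p)"] assms by (simp_all add: V_le_eq subspace_add)
  have "zhu_product k1 (k2 + y (n - p)) \<in> V_less n"
    by (rule zhu_product_V_less[OF *(2) k(1)]) (use * in simp)
  moreover have "zhu_product (x p) k2 \<in> V_less n"
    by (rule zhu_product_V_less[OF k(2) *(3)]) (use * in simp)
  moreover have "zhu_product (k1 + x p) (k2 + y (n - p)) - zhu_product (x p) (y (n - p))
      = zhu_product k1 (k2 + y (n - p)) + zhu_product (x p) k2"
    by (simp add: zhu_bilinear_simps)
  ultimately show "zhu_product (k1 + x p) (k2 + y (n - p)) - zhu_product (x p) (y (n - p)) \<in> V_less n"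
    by (simp add: subspace_add)
qed simp

lemma gr_zhu_add:
  "(\<lambda>n. zhu_symbol n (x n)) \<oplus>\<^bsub>gr_zhu\<^esub> (\<lambda>n. zhu_symbol n (y n)) = (\<lambda>n. zhu_symbol n (x n + y n))"
  unfolding gr_zhu_def zhu_symbol_def
  by (rule ext, rule algebra_image.gr_alg_add[OF zhu_algebra_image]) simp

lemma gr_zhu_smult:
  "k \<odot>\<^bsub>gr_zhu\<^esub> (\<lambda>n. zhu_symbol n (x n)) = (\<lambda>n. zhu_symbol n (k *s x n))"
  unfolding gr_zhu_def zhu_symbol_def
  by (rule ext, rule algebra_image.gr_alg_smult[OF zhu_algebra_image]) simp

lemma gr_zhu_one: "\<one>\<^bsub>gr_zhu\<^esub> = (\<lambda>n. zhu_symbol n (if n = 0 then vac else 0))"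
proof -
  have "\<one>\<^bsub>with_product zhu_product\<^esub> = vac" by (simp add: with_product_def)
  then have "\<one>\<^bsub>zhu_algebra\<^esub> = zhu_class vac"
    by (simp add: zhu_algebra_def quot_alg_def zhu_class_def)
  then show ?thesis
    by (intro ext) (simp add: gr_zhu_def gr_alg_def zhu_a_coset zhu_symbol_zero)
qed

lemma eta_alg_hom: "eta \<in> alg_hom C2_algebra gr_zhu"
proof -
  have le: "component n a \<in> V_le n" for n a by (simp add: V_le_iff component_component)
  have "eta \<in> ring_hom C2_algebra gr_zhu"
  proof (rule ring_hom_memI)
    fix x y assume "x \<in> carrier C2_algebra" "y \<in> carrier C2_algebra"
    then obtain a b where x: "x = vcoset (li_filtration 1) a" "y = vcoset (li_filtration 1) b"
      by (auto simp: C2_carrier)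
    show "eta x \<in> carrier gr_zhu" unfolding x eta_vcoset by (rule eta_carrier)
    show "eta (x \<oplus>\<^bsub>C2_algebra\<^esub> y) = eta x \<oplus>\<^bsub>gr_zhu\<^esub> eta y"
      unfolding x C2_ops eta_vcoset gr_zhu_add by (simp add: component_add)
    show "eta (x \<otimes>\<^bsub>C2_algebra\<^esub> y) = eta x \<otimes>\<^bsub>gr_zhu\<^esub> eta y"
      unfolding x C2_ops eta_vcoset gr_zhu_mult[OF le le]
    proof
      fix n
      have "component n (md a (-1) b) - (\<Sum>p\<le>n. zhu_product (component p a) (component (n - p) b))
        = - (\<Sum>p\<le>n. zhu_product (component p a) (component (n - p) b) - md (component p a) (-1) (component (n - p) b))"
        by (simp add: component_normal_product sum_subtractf)
      also have "\<dots> \<in> ideal_less n"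
      proof (intro subspace_neg subspace_sum subspace_ideal_less)
        fix p assume "p \<in> {..n}"
        then show "zhu_product (component p a) (component (n - p) b) - md (component p a) (-1) (component (n - p) b) \<in> ideal_less n"
          using V_less_ideal_less[OF zhu_product_leading[OF component_in component_in, of p a "n - p" b]] by simp
      qed
      finally show "zhu_symbol n (component n (md a (-1) b))
        = zhu_symbol n (\<Sum>p\<le>n. zhu_product (component p a) (component (n - p) b))"
        by (simp add: zhu_symbol_eq_iff)
    qed
  next
    show "eta \<one>\<^bsub>C2_algebra\<^esub> = \<one>\<^bsub>gr_zhu\<^esub>"
      unfolding C2_ops eta_vcoset gr_zhu_one by (simp add: component_homogeneous[OF vac_homogeneous])
  qed
  moreover have "eta (k \<odot>\<^bsub>C2_algebra\<^esub> x) = k \<odot>\<^bsub>gr_zhu\<^esub> eta x" if x': "x \<in> carrier C2_algebra" for k x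
  proof -
    obtain a where x: "x = vcoset (li_filtration 1) a" using x' by (auto simp: C2_carrier)
    show ?thesis unfolding x C2_ops eta_vcoset gr_zhu_smult by (simp add: component_scale)
  qed
  ultimately show ?thesis by (simp add: alg_hom_def)
qed

lemma eta_surj:
  assumes "f \<in> carrier gr_zhu"
  shows "\<exists>a. f = (\<lambda>n. zhu_symbol n (component n a))"
proof -
  let ?S = "{n. f n \<noteq> zhu_symbol n 0}"
  have S: "finite ?S" and "\<forall>n. \<exists>v. v \<in> V_le n \<and> f n = zhu_symbol n v"
    using assms by (auto simp: gr_zhu_carrier)
  then obtain v where v: "\<And>n. v n \<in> V_le n" "\<And>n. f n = zhu_symbol n (v n)" by metis
  define a where "a = (\<Sum>n\<in>?S. component n (v n))"
  have "f n = zhu_symbol n (component n a)" for n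
  proof -
    have "component n a = (\<Sum>i\<in>?S. if i = n then component n (v n) else 0)"
      unfolding a_def component_sum by (rule sum.cong) (auto simp: component_component)
    then have a: "component n a = (if n \<in> ?S then component n (v n) else 0)"
      using S by simp
    show ?thesis
    proof (cases "n \<in> ?S")
      case True
      have "v n - component n (v n) \<in> V_less n"
        using v(1)[of n] by (auto simp: V_le_iff V_less_iff component_diff component_component)
      then have "zhu_symbol n (v n) = zhu_symbol n (component n (v n))"
        by (simp add: zhu_symbol_eq_iff V_less_ideal_less)
      then show ?thesis using True a v(2) by simp
    qed (use a in simp)
  qed
  then show ?thesis by blast
qed

theorem eta_alg_iso:
  assumes free: "classically_free"
  shows "eta \<in> alg_iso C2_algebra gr_zhu"
proof -
  have "inj_on eta (carrier C2_algebra)"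
  proof (rule inj_onI)
    fix x y assume "x \<in> carrier C2_algebra" "y \<in> carrier C2_algebra" and eq: "eta x = eta y"
    then obtain a b where x: "x = vcoset (li_filtration 1) a" "y = vcoset (li_filtration 1) b"
      by (auto simp: C2_carrier)
    have "component n (a - b) \<in> li_filtration 1" for n
    proof (rule ideal_less_li[OF free component_in])
      have "zhu_symbol n (component n a) = zhu_symbol n (component n b)"
        using fun_cong[OF eq[unfolded x eta_vcoset]] .
      then show "component n (a - b) \<in> ideal_less n"
        by (simp add: zhu_symbol_eq_iff component_diff)
    qed
    then have "a - b \<in> li_filtration 1" by (rule in_span_of_components[OF subspace_li])
    then show "x = y" unfolding x by (rule vcoset_eqI[OF subspace_li])
  qed
  moreover have "eta ` carrier C2_algebra = carrier gr_zhu"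
  proof
    show "eta ` carrier C2_algebra \<subseteq> carrier gr_zhu"
      using eta_alg_hom by (auto simp: alg_hom_def ring_hom_def)
    show "carrier gr_zhu \<subseteq> eta ` carrier C2_algebra"
    proof
      fix f assume "f \<in> carrier gr_zhu"
      then obtain a where "f = (\<lambda>n. zhu_symbol n (component n a))" using eta_surj by blast
      then have "f = eta (vcoset (li_filtration 1) a)" by (simp only: eta_vcoset)
      then show "f \<in> eta ` carrier C2_algebra" by (auto simp: C2_carrier)
    qed
  qed
  ultimately show ?thesis using eta_alg_hom by (simp add: alg_iso_def bij_betw_def)
qed

end

theorem theorem1p2:
  fixes scale :: "complex \<Rightarrow> 'v::ab_group_add \<Rightarrow> 'v"
    and vac :: 'v
    and md :: "'v \<Rightarrow> int \<Rightarrow> 'v \<Rightarrow> 'v"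
    and H :: "'v \<Rightarrow> 'v"
  assumes "graded_vertex_algebra scale vac md H"
    and "vertex_algebra.classically_free scale vac md"
  shows "graded_vertex_algebra.eta scale vac md H
    \<in> alg_iso (vertex_algebra.C2_algebra scale vac md)
              (graded_vertex_algebra.gr_zhu scale vac md H)"
  using graded_vertex_algebra.eta_alg_iso[OF assms] .

end
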